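(* Let $W$, $D$, $\rho^0$ and the random initial data $u^0_{N,j}$ be as described in the context, and let $T>0$ be fixed. For $n,m\in\mathbb{N}$ and $N=nm$, let $\bar\nu_{n,m,t}$ be the empirical measure built from the solution $u_N$ of the discrete system with $N$ oscillators, and let $\bar\nu_t$ be the continuous measure built from the weak solution $\rho$ of the mean field initial value problem (both defined in the context). Then for a given $\epsilon>0$ there exist $n_1,m_1\in\mathbb{N}$ such that for $n\ge n_1$, $m\ge m_1$ and $N=nm$, $$\sup_{t\in[0,T]}\bar d(\bar\nu_{n,m,t},\bar\nu_t)<\epsilon\quad\text{almost surely}.$$
   Context: Let $I=[0,1]$, $\mathbb{S}=\mathbb{R}/2\pi\mathbb{Z}$ with distance $d_{\mathbb S}(\theta,\theta')=\min\{|\theta-\theta'|,2\pi-|\theta-\theta'|\}$ (representatives in $[0,2\pi)$), $G=\mathbb{S}\times I$. Metrics. $\mathcal{M}$ is the space of Borel probability measures on $\mathbb{S}$ with $d(\mu,\eta)=\sup_{f\in\mathcal{L}}\left|\int_{\mathbb S}f\,d\mu-\int_{\mathbb S}f\,d\eta\right|$, where $\mathcal{L}$ is the set of real-valued Lipschitz functions on $\mathbb{S}$ with Lipschitz constant at most $1$. For measurable functions $\bar\mu:x\mapsto\mu^x$, $\bar\eta:x\mapsto\eta^x$ from $I$ to $\mathcal{M}$, $\bar d(\bar\mu,\bar\eta)=\int_I d(\mu^x,\eta^x)\,dx$. Standing assumptions. $W:I^2\to\mathbb{R}$ is symmetric and measurable with $\sup_{I^2}|W|\le 1$ and $\lim_{\delta\to0}\int_I|W(x+\delta,y)-W(x,y)|\,dy=0$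 for all $x\in I$ (over $\delta$ with $x+\delta\in I$). $D:\mathbb{S}\to\mathbb{R}$ (a $2\pi$-periodic function) satisfies $\max|D|\le1$ and $|D(u)-D(v)|\le|u-v|$. The function $\rho^0\in L^1(G)$ is such that $\rho^0(\cdot,x)$ is a probability density on $\mathbb{S}$ for every $x\in I$, and $x\mapsto\int_{\mathbb S}f(u)\rho^0(u,x)\,du$ is Riemann integrable on $I$ for every $f\in C(\mathbb{S})$. Discrete system. For $N\in\mathbb{N}$ put $I_{N,i}=[(i-1)/N,i/N)$, $W_{N,ij}=N^2\int_{I_{N,i}\times I_{N,j}}W(x,y)\,dx\,dy$, $i,j\in\{1,\dots,N\}$. Let $u_N=(u_{N,1},\dots,u_{N,N})$ solve $$\dot u_{N,i}=N^{-1}\sum_{j=1}^N W_{N,ij}D(u_{N,j}-u_{N,i}),\qquad u_{N,i}(0)=u^0_{N,i},$$ where for each $N$ the initial values $u^0_{N,j}$, $j=1,\dots,N$, are independent $\mathbb{S}$-valued random variables, $u^0_{N,j}$ having density $\rho^0(\cdot,j/N)$ (all defined on one probability space). Empirical measure. For $N=nm$, $x\in I_{n,i}=[(i-1)/n,i/n)$, $i\in\{1,\dots,n\}$, and Borel $A\subset\mathbb{S}$, $\nu^x_{n,m,t}(A)=m^{-1}\sum_{j=1}^m\mathbf{1}_A\big(u_{N,(i-1)m+j}(t)\big)$; $\bar\nu_{n,m,t}:x\mapsto\nu^x_{n,m,t}$. Continuous measure. Consider the mean field equation $$\partial_t\rho+\partial_u\{V(t,u,x)\rho\}=0,\quad V(t,u,x)=\int_I\int_{\mathbb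 S}W(x,y)D(v-u)\rho(t,v,y)\,dv\,dy,\quad \rho(0,u,x)=\rho^0(u,x).$$ A weak solution is a measurable $\rho:[0,T]\times G\to\mathbb{R}$ such that for a.e. $x\in I$: (1) $t\mapsto\int_{\mathbb S}\rho(t,u,x)f(u)\,du$ is continuous on $[0,T]$ for every $f\in C(\mathbb{S})$; (2) for every $w\in C^1([0,T]\times\mathbb{S})$ with support in $[0,T)\times\mathbb{S}$, $$\int_0^T\int_{\mathbb S}\rho(t,u,x)\big(\partial_tw(t,u)+V(t,u,x)\partial_uw(t,u)\big)\,du\,dt+\int_{\mathbb S}w(0,u)\rho^0(u,x)\,du=0 .$$ This problem has a unique weak solution $\rho$, and $\nu_t^x(A)=\int_A\rho(t,u,x)\,du$ for Borel $A\subset\mathbb{S}$, $\bar\nu_t:x\mapsto\nu^x_t$.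
   Formalization: The thresholds n₁, m₁ may depend on the random sample (almost surely there exist n₁, m₁ serving all n ≥ n₁, m ≥ m₁); with non-random n₁, m₁ the claim fails, e.g. for W = 0 and uniform initial density. *)

theory Defs
  imports "HOL-Probability.Probability" "HOL-Library.Real_Mod"
begin

section \<open>The circle\<close>

text \<open>
  A point of \<open>R/2\<pi>Z\<close> is given by its representative in \<open>[0,2\<pi>)\<close>, and the class of a real number
  \<open>\<theta>\<close> has the representative \<open>\<theta> rmod (2 * pi)\<close>.  A function on the circle that is evaluated at
  differences of phases, differentiated, or required to be continuous is given as a
  \<open>2\<pi>\<close>-periodic function on the reals.
\<close>

definition circ :: "real set" where
  "circ = {0..<2 * pi}"

definition circ_dist :: "real \<Rightarrow> real \<Rightarrow> real" where
  "circ_dist \<theta> \<theta>' = min \<bar>\<theta> - \<theta>'\<bar> (2 * pi - \<bar>\<theta> - \<theta>'\<bar>)"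

text \<open>
  The Borel sets of the circle, as sets of representatives.  Although \<open>circ_dist\<close> does not induce
  the subspace topology of \<open>[0,2\<pi>)\<close>, both topologies have the same Borel sets; see
  \<open>sets_circle_borel\<close> below.
\<close>

definition circle_borel :: "real measure" where
  "circle_borel = restrict_space borel circ"

definition circ_open :: "real set \<Rightarrow> bool" where
  "circ_open U \<longleftrightarrow> U \<subseteq> circ \<and> (\<forall>a\<in>U. \<exists>r>0. \<forall>b\<in>circ. circ_dist a b < r \<longrightarrow> b \<in> U)"

definition circ_continuous :: "(real \<Rightarrow> real) \<Rightarrow> bool" where
  "circ_continuous f \<longleftrightarrow> continuous_on UNIV f \<and> (\<forall>u. f (u + 2 * pi) = f u)"

definition circ_lipschitz1 :: "(real \<Rightarrow> real) set" where
  "circ_lipschitz1 = {f. \<forall>\<theta>\<in>circ. \<forall>\<theta>'\<in>circ. \<bar>f \<theta> - f \<theta>'\<bar> \<le> circ_dist \<theta> \<theta>'}"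


section \<open>Metrics\<close>

text \<open>
  The suprema and integrals below are meant for measures in \<open>space (prob_algebra circle_borel)\<close>,
  the Borel probability measures on the circle.
\<close>

definition meas_dist :: "real measure \<Rightarrow> real measure \<Rightarrow> real" where
  "meas_dist \<mu> \<eta> = (SUP f\<in>circ_lipschitz1. \<bar>(LINT \<theta>|\<mu>. f \<theta>) - (LINT \<theta>|\<eta>. f \<theta>)\<bar>)"

definition fam_dist :: "(real \<Rightarrow> real measure) \<Rightarrow> (real \<Rightarrow> real measure) \<Rightarrow> real" where
  "fam_dist \<mu> \<eta> = (LINT x|lebesgue_on {0..1}. meas_dist (\<mu> x) (\<eta> x))"


section \<open>Measures on the circle\<close>

text \<open>
  The Borel measure with density \<open>g\<close>: the measure \<open>g(u) du\<close> is first formed on the Lebesgue sets,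
  because \<open>g\<close> need only be Lebesgue measurable, and then restricted to the Borel sets, which is what
  taking the image under the identity does.
\<close>

definition circ_density :: "(real \<Rightarrow> real) \<Rightarrow> real measure" where
  "circ_density g = distr (density (lebesgue_on circ) (\<lambda>u. ennreal (g u))) circle_borel (\<lambda>u. u)"

text \<open>
  The empirical measure of phases \<open>\<theta> 1, \<dots>, \<theta> m\<close>, which are arbitrary real lifts of points of the
  circle; see \<open>measure_empirical\<close> below.
\<close>

definition empirical :: "nat \<Rightarrow> (nat \<Rightarrow> real) \<Rightarrow> real measure" where
  "empirical m \<theta> =
     distr (uniform_count_measure {1..m}) circle_borel (\<lambda>j. \<theta> j rmod (2 * pi))"

lemma sets_circle_borel: "sets circle_borel = sigma_sets circ (Collect circ_open)"
proof
  have space: "space circle_borel = circ"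
    by (simp add: circle_borel_def space_restrict_space)
  have pos: "U \<in> sigma_sets circ (Collect circ_open)" if "open V" "U = V \<inter> circ" for U V
  proof -
    have op: "circ_open (V \<inter> {0<..<2 * pi})"
      unfolding circ_open_def
    proof safe
      fix a assume a: "a \<in> V" "a \<in> {0<..<2 * pi}"
      have "open (V \<inter> {0<..<2 * pi})" using that(1) by auto
      then obtain e where e: "e > 0" "ball a e \<subseteq> V \<inter> {0<..<2 * pi}"
        using a open_contains_ball by blast
      define r where "r = min e (min a (2 * pi - a))"
      have "r > 0" using e a by (auto simp: r_def)
      moreover have "b \<in> V \<inter> {0<..<2 * pi}" if "b \<in> circ" "circ_dist a b < r" for b
      proof -
        have "\<bar>a - b\<bar> < e"
          using that a by (auto simp: circ_dist_def r_def circ_def)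
        then show ?thesis using e(2) by (auto simp: dist_real_def)
      qed
      ultimately show "\<exists>r>0. \<forall>b\<in>circ. circ_dist a b < r \<longrightarrow> b \<in> V \<inter> {0<..<2 * pi}"
        by blast
    qed (auto simp: circ_def)
    have op0: "circ_open (circ - {0})"
      unfolding circ_open_def
    proof (intro conjI ballI)
      fix a assume a: "a \<in> circ - {0}"
      then have "0 < circ_dist a 0" by (auto simp: circ_dist_def circ_def)
      then show "\<exists>r>0. \<forall>b\<in>circ. circ_dist a b < r \<longrightarrow> b \<in> circ - {0}"
        by (intro exI[of _ "circ_dist a 0"]) auto
    qed auto

    have z: "{0} \<in> sigma_sets circ (Collect circ_open)"
    proof -
      have "circ - (circ - {0}) \<in> sigma_sets circ (Collect circ_open)"
        using op0 by (intro sigma_sets.Compl sigma_sets.Basic) simp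
      moreover have "circ - (circ - {0}) = {0}" by (auto simp: circ_def)
      ultimately show ?thesis by simp
    qed
    have U: "U = (V \<inter> {0<..<2 * pi}) \<union> (if 0 \<in> V then {0} else {})"
      using that(2) by (auto simp: circ_def less_le)
    show ?thesis
      unfolding U
      by (intro sigma_sets_Un) (use op z in \<open>auto intro: sigma_sets.Basic sigma_sets.Empty\<close>)
  qed
  have b: "sets (borel :: real measure) = sigma_sets UNIV {S. open S}"
    by (simp add: borel_def sets_measure_of)
  have "circ \<in> sigma_sets UNIV {S. open S}"
    unfolding b[symmetric] by (simp add: circ_def)
  then have eq: "sets circle_borel = sigma_sets circ ((\<inter>) circ ` {S. open S})"
    unfolding circle_borel_def sets_restrict_space b by (intro sigma_sets_Int) auto
  show "sets circle_borel \<subseteq> sigma_sets circ (Collect circ_open)"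
    unfolding eq by (rule sigma_sets_mono) (use pos in \<open>auto simp: Int_commute\<close>)
  have "U \<in> sets circle_borel" if U: "circ_open U" for U
  proof -
    have "open (U - {0})"
      unfolding open_dist
    proof
      fix a assume a: "a \<in> U - {0}"
      then obtain r where r: "r > 0" "\<forall>b\<in>circ. circ_dist a b < r \<longrightarrow> b \<in> U"
        using U by (auto simp: circ_open_def)
      have ac: "a \<in> circ" using a U by (auto simp: circ_open_def)
      show "\<exists>e>0. \<forall>y. dist y a < e \<longrightarrow> y \<in> U - {0}"
      proof (intro exI[of _ "min r (min a (2 * pi - a))"] conjI allI impI)
        show "0 < min r (min a (2 * pi - a))" using r a ac by (auto simp: circ_def)
        fix y assume y: "dist y a < min r (min a (2 * pi - a))"
        then have "0 < y" "y < 2 * pi" by (auto simp: dist_real_def)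
        moreover from this have "y \<in> circ" by (simp add: circ_def)
        moreover have "circ_dist a y < r" using y by (auto simp: circ_dist_def dist_real_def)
        ultimately show "y \<in> U - {0}" using r by auto
      qed
    qed
    then have "(U - {0}) \<union> (if 0 \<in> U then {0} else {}) \<in> sets borel" by auto
    moreover have "(U - {0}) \<union> (if 0 \<in> U then {0} else {}) = U" by auto
    moreover have "U \<subseteq> circ" using U by (auto simp: circ_open_def)
    ultimately show ?thesis
      by (simp add: circle_borel_def sets_restrict_space_iff circ_def)
  qed
  then show "sigma_sets circ (Collect circ_open) \<subseteq> sets circle_borel"
    using sets.sigma_sets_subset[of "Collect circ_open" circle_borel] by (auto simp: space)
qed

lemma emeasure_circ_density:
  assumes "g \<in> borel_measurable (lebesgue_on circ)" "A \<in> sets circle_borel"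
  shows "emeasure (circ_density g) A = (\<integral>\<^sup>+ u. ennreal (g u) * indicator A u \<partial>lebesgue_on circ)"
proof -
  have A: "A \<subseteq> circ" "A \<in> sets borel"
    using assms(2) by (auto simp: circle_borel_def sets_restrict_space_iff circ_def)
  have AL: "A \<in> sets (lebesgue_on circ)"
    using A by (simp add: sets_restrict_space_iff circ_def)
  have id: "(\<lambda>u. u) \<in> lebesgue_on circ \<rightarrow>\<^sub>M circle_borel"
  proof (rule measurableI)
    fix B assume "B \<in> sets circle_borel"
    then show "(\<lambda>u. u) -` B \<inter> space (lebesgue_on circ) \<in> sets (lebesgue_on circ)"
      by (auto simp: circle_borel_def sets_restrict_space_iff circ_def space_restrict_space)
  qed (simp add: circle_borel_def space_restrict_space)
  have "emeasure (circ_density g) A =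
      emeasure (density (lebesgue_on circ) (\<lambda>u. ennreal (g u))) ((\<lambda>u. u) -` A \<inter> circ)"
    unfolding circ_density_def using id assms(2)
    by (subst emeasure_distr) (auto simp: space_restrict_space)
  also have "(\<lambda>u. u) -` A \<inter> circ = A" using A by auto
  also have "emeasure (density (lebesgue_on circ) (\<lambda>u. ennreal (g u))) A =
      (\<integral>\<^sup>+ u. ennreal (g u) * indicator A u \<partial>lebesgue_on circ)"
    using assms(1) AL by (subst emeasure_density) auto
  finally show ?thesis .
qed

lemma measure_empirical:
  assumes "m > 0" "A \<in> sets circle_borel"
  shows "measure (empirical m \<theta>) A = (\<Sum>j = 1..m. indicator A (\<theta> j rmod (2 * pi))) / real m"
proof -
  have "\<theta> j rmod (2 * pi) \<in> circ" for j
    by (auto simp: circ_def rmod_conv_frac frac_lt_1)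
  then have "(\<lambda>j. \<theta> j rmod (2 * pi)) \<in> uniform_count_measure {1..m} \<rightarrow>\<^sub>M circle_borel"
    by (auto simp: measurable_def sets_uniform_count_measure space_uniform_count_measure
        circle_borel_def space_restrict_space)
  then have "measure (empirical m \<theta>) A =
      measure (uniform_count_measure {1..m}) {j \<in> {1..m}. \<theta> j rmod (2 * pi) \<in> A}"
    unfolding empirical_def using assms(2)
    by (subst measure_distr)
       (auto simp: space_uniform_count_measure intro!: arg_cong2[where f = measure])
  also have "\<dots> = real (card {j \<in> {1..m}. \<theta> j rmod (2 * pi) \<in> A}) / real m"
    by (subst measure_uniform_count_measure) auto
  also have "\<dots> = (\<Sum>j = 1..m. indicator A (\<theta> j rmod (2 * pi))) / real m"
    by (simp add: indicator_def sum.If_cases Int_def conj_commute)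
  finally show ?thesis .
qed


section \<open>Riemann integrability\<close>

definition riemann_integrable_on :: "(real \<Rightarrow> real) \<Rightarrow> real \<Rightarrow> real \<Rightarrow> bool" where
  "riemann_integrable_on f a b \<longleftrightarrow>
     (\<exists>J. \<forall>\<epsilon>>0. \<exists>\<delta>>0. \<forall>p. p tagged_division_of {a..b} \<and> (\<forall>(x, K)\<in>p. diameter K < \<delta>) \<longrightarrow>
        \<bar>(\<Sum>(x, K)\<in>p. measure lborel K * f x) - J\<bar> < \<epsilon>)"


section \<open>The discrete system\<close>

definition cell :: "nat \<Rightarrow> nat \<Rightarrow> real set" where
  "cell N i = {(real i - 1) / real N ..< real i / real N}"

definition W_avg :: "(real \<Rightarrow> real \<Rightarrow> real) \<Rightarrow> nat \<Rightarrow> nat \<Rightarrow> nat \<Rightarrow> real" where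
  "W_avg W N i j = (real N)\<^sup>2 * (LINT (x, y)|lebesgue_on (cell N i \<times> cell N j). W x y)"

text \<open>
  A solution on \<open>[0,T]\<close> is given by a real-valued lift of the phases, starting at the
  representatives \<open>\<theta>0 i\<close> of the initial phases.
\<close>

definition discrete_solution ::
  "real \<Rightarrow> (real \<Rightarrow> real \<Rightarrow> real) \<Rightarrow> (real \<Rightarrow> real) \<Rightarrow> nat \<Rightarrow> (nat \<Rightarrow> real) \<Rightarrow> (nat \<Rightarrow> real \<Rightarrow> real) \<Rightarrow> bool"
  where
  "discrete_solution T W D N \<theta>0 \<theta> \<longleftrightarrow>
     (\<forall>i\<in>{1..N}. \<theta> i 0 = \<theta>0 i \<and>
       (\<forall>t\<in>{0..T}. (\<theta> i has_real_derivative
          (\<Sum>j = 1..N. W_avg W N i j * D (\<theta> j t - \<theta> i t)) / real N) (at t within {0..T})))"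

text \<open>
  The block index \<open>i\<close> is undetermined at \<open>x = 1\<close>, which lies in no cell; integrals over \<open>x\<close> do not
  see this point.
\<close>

definition emp_family :: "nat \<Rightarrow> nat \<Rightarrow> (nat \<Rightarrow> real) \<Rightarrow> real \<Rightarrow> real measure" where
  "emp_family n m \<theta> x =
     (let i = (THE i. i \<in> {1..n} \<and> x \<in> cell n i) in empirical m (\<lambda>j. \<theta> ((i - 1) * m + j)))"


section \<open>The mean field equation\<close>

definition velocity ::
  "(real \<Rightarrow> real \<Rightarrow> real) \<Rightarrow> (real \<Rightarrow> real) \<Rightarrow> (real \<Rightarrow> real \<Rightarrow> real \<Rightarrow> real) \<Rightarrow> real \<Rightarrow> real \<Rightarrow> real \<Rightarrow> real"
  where
  "velocity W D \<rho> t u x =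
     (LINT y|lebesgue_on {0..1}. LINT v|lebesgue_on circ. W x y * D (v - u) * \<rho> t v y)"

text \<open>
  Test functions \<open>w\<close> of class \<open>C\<^sup>1\<close> on \<open>[0,T] \<times> S\<close> with support in \<open>[0,T) \<times> S\<close>, together with their
  partial derivatives \<open>wt\<close> in time and \<open>wu\<close> in the phase.
\<close>

definition test_function ::
  "real \<Rightarrow> (real \<Rightarrow> real \<Rightarrow> real) \<Rightarrow> (real \<Rightarrow> real \<Rightarrow> real) \<Rightarrow> (real \<Rightarrow> real \<Rightarrow> real) \<Rightarrow> bool"
  where
  "test_function T w wt wu \<longleftrightarrow>
     (\<forall>t\<in>{0..T}. \<forall>u. w t (u + 2 * pi) = w t u) \<and>
     (\<forall>t\<in>{0..T}. \<forall>u. ((\<lambda>s. w s u) has_real_derivative wt t u) (at t within {0..T})) \<and>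
     (\<forall>t\<in>{0..T}. \<forall>u. ((\<lambda>v. w t v) has_real_derivative wu t u) (at u)) \<and>
     continuous_on ({0..T} \<times> UNIV) (\<lambda>(t, u). wt t u) \<and>
     continuous_on ({0..T} \<times> UNIV) (\<lambda>(t, u). wu t u) \<and>
     closure {(t, u). t \<in> {0..T} \<and> w t u \<noteq> 0} \<subseteq> {0..<T} \<times> UNIV"

text \<open>
  The two integrability requirements on \<open>\<rho>\<close> make the integrals in the equation meaningful (a Bochner
  integral that does not exist is \<open>0\<close> by convention).  Neither a sign nor a normalisation of \<open>\<rho>\<close> is
  required.
\<close>

definition weak_solution ::
  "real \<Rightarrow> (real \<Rightarrow> real \<Rightarrow> real) \<Rightarrow> (real \<Rightarrow> real) \<Rightarrow> (real \<Rightarrow> real \<Rightarrow> real) \<Rightarrow>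
   (real \<Rightarrow> real \<Rightarrow> real \<Rightarrow> real) \<Rightarrow> bool"
  where
  "weak_solution T W D \<rho>0 \<rho> \<longleftrightarrow>
     integrable (lebesgue_on ({0..T} \<times> circ \<times> {0..1})) (\<lambda>(t, u, x). \<rho> t u x) \<and>
     (AE x in lebesgue_on {0..1}.
        (\<forall>t\<in>{0..T}. integrable (lebesgue_on circ) (\<lambda>u. \<rho> t u x)) \<and>
        (\<forall>f. circ_continuous f \<longrightarrow>
           continuous_on {0..T} (\<lambda>t. LINT u|lebesgue_on circ. \<rho> t u x * f u)) \<and>
        (\<forall>w wt wu. test_function T w wt wu \<longrightarrow>
           (LINT t|lebesgue_on {0..T}. LINT u|lebesgue_on circ.
              \<rho> t u x * (wt t u + velocity W D \<rho> t u x * wu t u))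
           + (LINT u|lebesgue_on circ. w 0 u * \<rho>0 u x) = 0))"

end

theory Submission
  imports Defs "HOL-Real_Asymp.Real_Asymp"
begin

text \<open>
  The theorem is a stability estimate for a transport equation.  Fix a sample point.  Every oscillator
  moves along a path \<open>\<theta>\<close> with a velocity bounded by \<open>1\<close>, and for almost every \<open>x\<close> the measures
  \<open>\<rho>(t,u,x) du\<close> are carried by the velocity field \<open>V(t,\<cdot>,x)\<close>, which is \<open>1\<close>-Lipschitz in the phase.  If \<open>\<Phi>\<close>
  is the flow of \<open>V(\<cdot>,\<cdot>,x)\<close> from time \<open>0\<close> to time \<open>t\<close> and \<open>f\<close> is \<open>1\<close>-Lipschitz, then \<open>g = f \<circ> \<Phi>\<close> is
  \<open>exp T\<close>-Lipschitz, the integral of \<open>f\<close> against \<open>\<rho>(t,\<cdot>,x)\<close> is the integral of \<open>g\<close> against \<open>\<rho>0(\<cdot>,x)\<close>, and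
  \<open>\<bar>f(\<theta>(t)) - g(\<theta>(0))\<bar>\<close> is at most \<open>exp T\<close> times the time integral of \<open>\<bar>\<theta>' - V(s,\<theta>,x)\<bar>\<close>.  Hence the distance
  of empirical and continuous measure at time \<open>t\<close> is controlled by the distance at time \<open>0\<close> and by the
  mismatch of the two velocities.  The mismatch consists of the error made by averaging the kernel \<open>W\<close>
  over cells and of a term that is again bounded by the distance, averaged over \<open>x\<close>.  A Gronwall
  argument closes the estimate (\<open>error_propagation\<close>).

  The flow is never constructed.  The function \<open>g\<close> comes from characteristics that are followed
  backwards in small time steps, \<open>g(u) = f(u + A(u))\<close> with \<open>A\<close> the displacement in one step; after a
  smoothing of \<open>A\<close> all functions keep Lipschitz derivatives, so that one step costs an error of second
  order (\<open>transport_step\<close>, \<open>transport_duality\<close>).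

  A weak solution is, a priori, only an integrable function that may change sign, and its velocity field is
  only integrable in time.  The duality is therefore used twice.  The uniform boundedness principle
  turns the continuity of \<open>t \<mapsto> \<integral>\<rho>(t,u,x) f(u) du\<close> for every continuous \<open>f\<close> into a bound that is uniform in \<open>t\<close>
  (\<open>weakly_continuous_imp_bounded\<close>); with this bound the duality shows that \<open>\<rho>(t,\<cdot>,x)\<close> is a probability
  density (\<open>good_density\<close>).  Thereupon the velocity is bounded by \<open>1\<close>, and the duality holds with the
  constants above (\<open>good_duality\<close>).

  Two sources of error remain.  Replacing \<open>W\<close> by its averages over cells costs an error in \<open>L\<^sup>1\<close> that
  vanishes because \<open>W\<close> is a limit of continuous kernels (\<open>kernel_discretization_error\<close>).  For the initial
  data it suffices to test with the finitely many members of a net of Lipschitz functions.  For each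
  of them Riemann integrability makes the means of a block close to the value at \<open>x\<close>
  (\<open>riemann_integrable_oscillation\<close>).  The sum over the blocks of the absolute fluctuations is the largest
  of \<open>2\<^sup>n\<close> signed sums of independent variables, so Hoeffding's inequality bounds it, with an exceptional
  probability of at most \<open>2\<^sup>n exp(-c n m)\<close>.  This is summable over all \<open>n\<close> and all large \<open>m\<close>, which is why
  one pair of thresholds serves all larger \<open>n\<close> and \<open>m\<close> at once.
\<close>

section \<open>Lipschitz functions on the circle\<close>

definition periodic_lipschitz :: "real \<Rightarrow> (real \<Rightarrow> real) \<Rightarrow> bool" where
  "periodic_lipschitz L f \<longleftrightarrow>
     (\<forall>u. f (u + 2 * pi) = f u) \<and> (\<forall>u v. \<bar>f u - f v\<bar> \<le> L * \<bar>u - v\<bar>)"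

text \<open>
  The derivative is an argument, so that both it and its constants can be tracked.  Its Lipschitz
  continuity, rather than a second derivative, is exactly what a sliding average of a Lipschitz
  function provides and what Taylor's formula to second order uses.
\<close>

definition periodic_C11 :: "real \<Rightarrow> real \<Rightarrow> (real \<Rightarrow> real) \<Rightarrow> (real \<Rightarrow> real) \<Rightarrow> bool" where
  "periodic_C11 L L' f f' \<longleftrightarrow>
     (\<forall>u. f (u + 2 * pi) = f u) \<and> (\<forall>u. (f has_real_derivative f' u) (at u)) \<and>
     (\<forall>u. \<bar>f' u\<bar> \<le> L) \<and> (\<forall>u v. \<bar>f' u - f' v\<bar> \<le> L' * \<bar>u - v\<bar>)"

lemma periodic_int:
  fixes f :: "real \<Rightarrow> real" and k :: int
  assumes "\<And>u. f (u + 2 * pi) = f u"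
  shows "f (u + 2 * pi * k) = f u"
proof (induction k rule: int_induct[where k = 0])
  case (step1 i)
  have "f (u + 2 * pi * (i + 1)) = f ((u + 2 * pi * i) + 2 * pi)"
    by (simp add: algebra_simps)
  then show ?case using step1 assms by simp
next
  case (step2 i)
  have "f (u + 2 * pi * i) = f ((u + 2 * pi * (i - 1)) + 2 * pi)"
    by (simp add: algebra_simps)
  then show ?case using step2 assms by simp
qed simp

lemma rmod_eq_int: "u rmod (2 * pi) = u + 2 * pi * (- \<lfloor>u / (2 * pi)\<rfloor>)"
  by (simp add: rmod_def)

lemma periodic_rmod:
  fixes f :: "real \<Rightarrow> real"
  assumes "\<And>u. f (u + 2 * pi) = f u"
  shows "f (u rmod (2 * pi)) = f u"
  using periodic_int[of f u "- \<lfloor>u / (2 * pi)\<rfloor>", OF assms] by (simp add: rmod_eq_int)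

lemma rmod_in_circ: "u rmod (2 * pi) \<in> circ"
  by (auto simp: circ_def rmod_conv_frac frac_lt_1)

lemma periodic_lipschitz_continuous:
  assumes "periodic_lipschitz L f"
  shows "continuous_on A f"
proof -
  have "0 \<le> L" using assms[unfolded periodic_lipschitz_def]
    by (metis abs_ge_zero abs_one diff_zero mult.right_neutral order_trans)
  then have "L-lipschitz_on A f"
    using assms by (auto simp: lipschitz_on_def periodic_lipschitz_def dist_real_def)
  then show ?thesis by (rule lipschitz_on_continuous_on)
qed

lemma periodic_lipschitz_nonneg: "periodic_lipschitz L f \<Longrightarrow> 0 \<le> L"
  unfolding periodic_lipschitz_def by (metis abs_ge_zero abs_one diff_zero mult.right_neutral order_trans)

lemma periodic_lipschitz_circ_continuous: "periodic_lipschitz L f \<Longrightarrow> circ_continuous f"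
  unfolding circ_continuous_def using periodic_lipschitz_continuous periodic_lipschitz_def by blast

lemma periodic_lipschitz_mono:
  "periodic_lipschitz L f \<Longrightarrow> L \<le> L' \<Longrightarrow> periodic_lipschitz L' f"
  unfolding periodic_lipschitz_def by (meson abs_ge_zero mult_right_mono order_trans)

lemma periodic_C11_lipschitz:
  assumes "periodic_C11 L L' f f'"
  shows "periodic_lipschitz L f"
proof -
  have "\<bar>f u - f v\<bar> \<le> L * \<bar>u - v\<bar>" for u v
    using field_differentiable_bound[of UNIV f f' L v u] assms
    by (auto simp: periodic_C11_def abs_minus_commute)
  then show ?thesis using assms by (auto simp: periodic_C11_def periodic_lipschitz_def)
qed

lemma periodic_C11_deriv_lipschitz:
  assumes "periodic_C11 L L' f f'"
  shows "periodic_lipschitz L' f'"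
proof -
  have "f' (u + 2 * pi) = f' u" for u
  proof -
    have "((\<lambda>v. f (v + 2 * pi)) has_real_derivative f' (u + 2 * pi)) (at u)"
      using assms DERIV_shift[of f "f' (u + 2 * pi)" u "2 * pi"] unfolding periodic_C11_def by blast
    moreover have "(\<lambda>v. f (v + 2 * pi)) = f" using assms by (auto simp: periodic_C11_def)
    ultimately show ?thesis using assms DERIV_unique unfolding periodic_C11_def by metis
  qed
  then show ?thesis using assms by (auto simp: periodic_C11_def periodic_lipschitz_def)
qed

lemma periodic_C11_nonneg:
  assumes "periodic_C11 L L' f f'"
  shows "0 \<le> L" "0 \<le> L'"
  using periodic_C11_lipschitz[OF assms] periodic_C11_deriv_lipschitz[OF assms]
  by (auto dest: periodic_lipschitz_nonneg)

text \<open>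
  The mean value theorem for \<open>v \<mapsto> f v - f' u * v\<close>, whose derivative is at most \<open>L' \<bar>z\<bar>\<close> between \<open>u\<close> and
  \<open>u + z\<close>.
\<close>

lemma periodic_C11_linearization:
  assumes "periodic_C11 L L' f f'"
  shows "\<bar>f (u + z) - f u - f' u * z\<bar> \<le> L' * z\<^sup>2"
proof -
  define g where "g = (\<lambda>v. f v - f' u * v)"
  have "(g has_real_derivative f' v - f' u) (at v)" for v
    unfolding g_def using assms by (auto simp: periodic_C11_def intro!: derivative_eq_intros)
  then have "norm (g (u + z) - g u) \<le> (L' * \<bar>z\<bar>) * norm ((u + z) - u)"
  proof (intro field_differentiable_bound[of "closed_segment u (u + z)" g "\<lambda>v. f' v - f' u"])
    fix v assume v: "v \<in> closed_segment u (u + z)"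
    then have "\<bar>v - u\<bar> \<le> \<bar>z\<bar>" by (auto simp: closed_segment_eq_real_ivl split: if_splits)
    then have "L' * \<bar>v - u\<bar> \<le> L' * \<bar>z\<bar>"
      using periodic_C11_nonneg[OF assms] by (intro mult_left_mono) auto
    then show "norm (f' v - f' u) \<le> L' * \<bar>z\<bar>"
      using assms unfolding periodic_C11_def by (smt (verit) real_norm_def)
  qed (auto intro: DERIV_subset)
  then show ?thesis
    by (simp add: g_def algebra_simps power2_eq_square abs_mult_self_eq[of z, symmetric] del: abs_mult_self_eq)
qed

text \<open>
  The smoothed function is the sliding average \<open>g u = (F (u + h) - F u) / h\<close>, where \<open>F' = A\<close>.  Its derivative
  is a difference quotient of \<open>A\<close>, so that the Lipschitz constant does not increase.
\<close>

lemma periodic_lipschitz_smoothing: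
  assumes A: "periodic_lipschitz L A" and h: "h > 0"
  shows "\<exists>g g'. periodic_C11 L (2 * L / h) g g' \<and> (\<forall>u. \<exists>v\<in>{u..u + h}. g u = A v)"
proof -
  have cont: "isCont A u" for u
    using periodic_lipschitz_continuous[OF A, of UNIV] by (simp add: continuous_on_eq_continuous_at)
  have "\<exists>F. \<forall>u::real. - \<infinity> < ereal u \<longrightarrow> ereal u < \<infinity> \<longrightarrow> (F has_vector_derivative A u) (at u)"
    by (rule einterval_antiderivative) (use cont in auto)
  then obtain F where F: "\<And>u. (F has_real_derivative A u) (at u)"
    by (auto simp: has_real_derivative_iff_has_vector_derivative)
  define g where "g = (\<lambda>u. (F (u + h) - F u) / h)"
  define g' where "g' = (\<lambda>u. (A (u + h) - A u) / h)"
  have Fs: "((\<lambda>v. F (v + c)) has_real_derivative A (u + c)) (at u)" for u c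
    using F[of "u + c"] by (simp add: DERIV_shift)
  have per: "g (u + 2 * pi) = g u" for u
  proof -
    have "((\<lambda>v. F (v + 2 * pi) - F v) has_real_derivative 0) (at v)" for v
      using DERIV_diff[OF Fs F, of "2 * pi" v] A by (simp add: periodic_lipschitz_def)
    then have "F (u + 2 * pi) - F u = F (u + h + 2 * pi) - F (u + h)"
      using DERIV_isconst_all[of "\<lambda>v. F (v + 2 * pi) - F v" u "u + h"] by blast
    then show ?thesis by (simp add: g_def algebra_simps)
  qed
  have mean: "\<exists>v\<in>{u..u + h}. g u = A v" for u
  proof -
    obtain z where "u < z" "z < u + h" "F (u + h) - F u = (u + h - u) * A z"
      using MVT2[of u "u + h" F A] F h by auto
    then show ?thesis using h by (auto simp: g_def)
  qed
  have dg: "(g has_real_derivative g' u) (at u)" for u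
    unfolding g_def g'_def by (intro DERIV_cdivide DERIV_diff Fs F)
  have Lip: "\<bar>A u - A v\<bar> \<le> L * \<bar>u - v\<bar>" for u v using A by (simp add: periodic_lipschitz_def)
  have g'b: "\<bar>g' u\<bar> \<le> L" for u
    using Lip[of "u + h" u] h by (simp add: g'_def field_simps)
  have g'l: "\<bar>g' u - g' v\<bar> \<le> 2 * L / h * \<bar>u - v\<bar>" for u v
  proof -
    have "\<bar>g' u - g' v\<bar> = \<bar>(A (u + h) - A (v + h)) - (A u - A v)\<bar> / h"
      using h by (simp add: g'_def diff_divide_distrib[symmetric] algebra_simps)
    also have "\<dots> \<le> (L * \<bar>u - v\<bar> + L * \<bar>u - v\<bar>) / h"
      using Lip[of "u + h" "v + h"] Lip[of u v] h by (intro divide_right_mono) auto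
    finally show ?thesis by (simp add: field_simps)
  qed
  show ?thesis
    using per dg g'b g'l mean unfolding periodic_C11_def by blast
qed

lemma periodic_lipschitz_bound:
  assumes "periodic_lipschitz 1 f" "f 0 = 0"
  shows "\<bar>f u\<bar> \<le> 2 * pi"
proof -
  have "\<bar>f (u rmod (2 * pi)) - f 0\<bar> \<le> \<bar>u rmod (2 * pi) - 0\<bar>"
    using assms(1) unfolding periodic_lipschitz_def by (metis mult_1)
  then show ?thesis
    using rmod_in_circ[of u] periodic_rmod[of f u] assms by (auto simp: circ_def periodic_lipschitz_def)
qed

text \<open>
  A function that is \<open>1\<close>-Lipschitz is determined up to \<open>r\<close> by its values at finitely many points,
  rounded to multiples of \<open>r / 4\<close>.  There are only finitely many patterns of rounded values, and
  the net contains one function for each pattern that occurs.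
\<close>

lemma finite_net_periodic_lipschitz:
  assumes "r > 0"
  shows "\<exists>F. finite F \<and> (\<forall>f\<in>F. periodic_lipschitz 1 f \<and> f 0 = 0) \<and>
    (\<forall>f. periodic_lipschitz 1 f \<and> f 0 = 0 \<longrightarrow> (\<exists>g\<in>F. \<forall>u. \<bar>f u - g u\<bar> \<le> r))"
proof -
  define S where "S = {f. periodic_lipschitz 1 f \<and> f 0 = 0}"
  obtain q :: nat where q: "q > 0" "2 * pi / real q \<le> r / 4"
  proof -
    obtain q :: nat where "real q > 8 * pi / r" using reals_Archimedean2 by blast
    moreover have "8 * pi / r > 0" using assms by simp
    moreover from calculation have "real q > 0" by linarith
    ultimately show ?thesis using assms that by (auto simp: field_simps)
  qed
  \<comment> \<open>The pattern of a function: its rounded values at \<open>q\<close> equidistant points.\<close>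
  define key where "key = (\<lambda>f::real\<Rightarrow>real. map (\<lambda>l. \<lfloor>f (2 * pi * real l / real q) / (r / 4)\<rfloor>) [0..<q])"
  define K where "K = \<lceil>2 * pi / (r / 4)\<rceil> + 1"
  have "key ` S \<subseteq> {xs. set xs \<subseteq> {-K..K} \<and> length xs = q}"
  proof clarify
    fix f assume "f \<in> S"
    then have b: "\<bar>f u\<bar> \<le> 2 * pi" for u using periodic_lipschitz_bound by (auto simp: S_def)
    have "\<bar>f u / (r / 4)\<bar> \<le> 2 * pi / (r / 4)" for u
      using b[of u] assms by (simp add: abs_divide divide_right_mono)
    then have "\<lfloor>f u / (r / 4)\<rfloor> \<in> {-K..K}" for u
    proof -
      have "- (2 * pi / (r / 4)) \<le> f u / (r / 4)" "f u / (r / 4) \<le> 2 * pi / (r / 4)"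
        using \<open>\<bar>f u / (r / 4)\<bar> \<le> 2 * pi / (r / 4)\<close> by (simp_all only: abs_le_iff) linarith
      then show ?thesis unfolding K_def atLeastAtMost_iff by linarith
    qed
    then show "set (key f) \<subseteq> {-K..K} \<and> length (key f) = q"
      by (auto simp: key_def simp del: atLeastAtMost_iff)
  qed
  then have fin: "finite (key ` S)"
    by (rule finite_subset) (rule finite_lists_length_eq, simp)
  define rep where "rep = (\<lambda>k. SOME f. f \<in> S \<and> key f = k)"
  have rep: "rep (key f) \<in> S \<and> key (rep (key f)) = key f" if "f \<in> S" for f
    unfolding rep_def by (rule someI[of _ f]) (use that in auto)
  have close: "\<bar>f u - g u\<bar> \<le> r" if fg: "f \<in> S" "g \<in> S" "key f = key g" for f g u
  proof -
    define w where "w = u rmod (2 * pi)"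
    define l where "l = nat \<lfloor>w * real q / (2 * pi)\<rfloor>"
    define p where "p = 2 * pi * real l / real q"
    have w: "0 \<le> w" "w < 2 * pi" using rmod_in_circ[of u] by (auto simp: w_def circ_def)
    have l: "real l \<le> w * real q / (2 * pi)" "w * real q / (2 * pi) < real l + 1"
      using w by (auto simp: l_def)
    have "w * real q / (2 * pi) < real q" using w q by (simp add: field_simps)
    then have lq: "l < q" using l by linarith
    have pw: "\<bar>w - p\<bar> \<le> r / 4"
    proof -
      have "p \<le> w" "w \<le> p + 2 * pi / real q"
        using l q by (auto simp: p_def field_simps)
      then show ?thesis using q by linarith
    qed
    have "\<lfloor>f p / (r / 4)\<rfloor> = \<lfloor>g p / (r / 4)\<rfloor>"
      using fg(3) lq unfolding key_def p_def by auto
    then have "\<bar>f p / (r / 4) - g p / (r / 4)\<bar> \<le> 1" by linarith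
    then have "\<bar>f p - g p\<bar> / (r / 4) \<le> 1"
      using assms unfolding diff_divide_distrib[symmetric] abs_divide by simp
    then have "\<bar>f p - g p\<bar> \<le> r / 4" using assms by (simp add: pos_divide_le_eq)
    moreover have "\<bar>f w - f p\<bar> \<le> 1 * \<bar>w - p\<bar>" "\<bar>g w - g p\<bar> \<le> 1 * \<bar>w - p\<bar>"
      using fg unfolding S_def periodic_lipschitz_def by blast+
    moreover have "f w = f u" "g w = g u"
      using fg unfolding w_def S_def periodic_lipschitz_def by (auto intro!: periodic_rmod)
    moreover have "\<bar>f w - g w\<bar> \<le> \<bar>f w - f p\<bar> + \<bar>f p - g p\<bar> + \<bar>g w - g p\<bar>" by linarith
    ultimately have "\<bar>f u - g u\<bar> \<le> \<bar>w - p\<bar> + r / 4 + \<bar>w - p\<bar>"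
      unfolding mult_1 by simp
    then show ?thesis using pw assms by linarith
  qed
  show ?thesis
  proof (intro exI[of _ "rep ` key ` S"] conjI ballI allI impI)
    show "finite (rep ` key ` S)" using fin by simp
    fix f assume "f \<in> rep ` key ` S"
    then have "f \<in> S" using rep by auto
    then show "periodic_lipschitz 1 f" "f 0 = 0" by (auto simp: S_def)
  next
    fix f assume "periodic_lipschitz 1 f \<and> f 0 = 0"
    then have f: "f \<in> S" by (simp add: S_def)
    then show "\<exists>g\<in>rep ` key ` S. \<forall>u. \<bar>f u - g u\<bar> \<le> r"
      using close[OF f] rep[OF f] by force
  qed
qed

lemma circ_dist_rmod_le: "circ_dist (u rmod (2 * pi)) (v rmod (2 * pi)) \<le> \<bar>u - v\<bar>"
proof -
  define a b j k where "a = u rmod (2 * pi)" "b = v rmod (2 * pi)"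
    "j = \<lfloor>u / (2 * pi)\<rfloor>" "k = \<lfloor>v / (2 * pi)\<rfloor>"
  have ab: "u = a + 2 * pi * j" "v = b + 2 * pi * k"
    by (auto simp: a_b_j_k_def rmod_eq_int)
  have c: "a \<in> circ" "b \<in> circ" using rmod_in_circ by (auto simp: a_b_j_k_def)
  have "circ_dist a b \<le> \<bar>u - v\<bar>"
  proof (cases "j = k")
    case True then show ?thesis unfolding circ_dist_def ab by simp
  next
    case False
    then have "1 \<le> \<bar>real_of_int (j - k)\<bar>" by linarith
    then have "2 * pi * 1 \<le> 2 * pi * \<bar>real_of_int (j - k)\<bar>" by (intro mult_left_mono) auto
    then have "2 * pi \<le> \<bar>2 * pi * real_of_int (j - k)\<bar>" by (simp add: abs_mult)
    moreover have "u - v = (a - b) + 2 * pi * real_of_int (j - k)" unfolding ab by (simp add: algebra_simps)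
    ultimately have "2 * pi - \<bar>a - b\<bar> \<le> \<bar>u - v\<bar>" by linarith
    then show ?thesis unfolding circ_dist_def by simp
  qed
  then show ?thesis by (simp add: a_b_j_k_def)
qed

lemma space_circle_borel: "space circle_borel = circ"
  by (simp add: circle_borel_def space_restrict_space)

text \<open>
  The members of \<open>circ_lipschitz1\<close> are arbitrary outside \<open>circ\<close>, but their restrictions extend to
  periodic \<open>1\<close>-Lipschitz functions on the line; subtracting a constant does not change the difference
  of two integrals against probability measures.
\<close>

lemma meas_dist_le:
  assumes \<mu>: "prob_space \<mu>" "sets \<mu> = sets circle_borel"
    and \<eta>: "prob_space \<eta>" "sets \<eta> = sets circle_borel"
    and le: "\<And>f. periodic_lipschitz 1 f \<Longrightarrow> f 0 = 0 \<Longrightarrow> \<bar>(LINT \<theta>|\<mu>. f \<theta>) - (LINT \<theta>|\<eta>. f \<theta>)\<bar> \<le> c"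
  shows "meas_dist \<mu> \<eta> \<le> c"
  unfolding meas_dist_def
proof (rule cSUP_least)
  show "circ_lipschitz1 \<noteq> {}"
    by (auto simp: circ_lipschitz1_def circ_dist_def circ_def intro!: exI[of _ "\<lambda>_. 0"])
  fix f assume f: "f \<in> circ_lipschitz1"
  define g where "g = (\<lambda>u. f (u rmod (2 * pi)) - f 0)"
  have g: "periodic_lipschitz 1 g"
    unfolding periodic_lipschitz_def
  proof (intro conjI allI)
    show "g (u + 2 * pi) = g u" for u
    proof -
      have "(u + 2 * pi) / (2 * pi) = u / (2 * pi) + 1" by (simp add: field_simps)
      then have "\<lfloor>(u + 2 * pi) / (2 * pi)\<rfloor> = \<lfloor>u / (2 * pi)\<rfloor> + 1" by linarith
      then have "(u + 2 * pi) rmod (2 * pi) = u rmod (2 * pi)"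
        unfolding rmod_eq_int by (simp add: algebra_simps)
      then show ?thesis by (simp add: g_def)
    qed
    show "\<bar>g u - g v\<bar> \<le> 1 * \<bar>u - v\<bar>" for u v
    proof -
      have "\<bar>f (u rmod (2 * pi)) - f (v rmod (2 * pi))\<bar> \<le> circ_dist (u rmod (2 * pi)) (v rmod (2 * pi))"
        using f rmod_in_circ unfolding circ_lipschitz1_def by blast
      then show ?thesis using circ_dist_rmod_le[of u v] unfolding g_def by simp
    qed
  qed
  have g0: "g 0 = 0" by (simp add: g_def)
  have "(LINT \<theta>|\<nu>. f \<theta>) = (LINT \<theta>|\<nu>. g \<theta>) + f 0"
    if \<nu>: "prob_space \<nu>" "sets \<nu> = sets circle_borel" for \<nu>
  proof -
    interpret prob_space \<nu> by fact
    have "continuous_on UNIV g" using periodic_lipschitz_continuous[OF g] .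
    then have "g \<in> borel_measurable borel" by (rule borel_measurable_continuous_onI)
    then have "g \<in> borel_measurable \<nu>"
      using \<nu>(2) unfolding circle_borel_def
      by (metis measurable_cong_sets measurable_restrict_space1)
    then have int: "integrable \<nu> g"
      using periodic_lipschitz_bound[OF g g0] by (intro integrable_const_bound[of _ "2 * pi"]) auto
    have sp: "space \<nu> = circ" using sets_eq_imp_space_eq[OF \<nu>(2)] space_circle_borel by simp
    have "(LINT \<theta>|\<nu>. f \<theta>) = (LINT \<theta>|\<nu>. g \<theta> + f 0)"
    proof (rule Bochner_Integration.integral_cong)
      fix x assume "x \<in> space \<nu>"
      then have "x rmod (2 * pi) = x" unfolding sp circ_def
        by (intro rmod_idem) auto
      then show "f x = g x + f 0" by (simp add: g_def)
    qed simp
    then show ?thesis using int prob_space by simp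
  qed
  from this[OF \<mu>] this[OF \<eta>] le[OF g g0]
  show "\<bar>(LINT \<theta>|\<mu>. f \<theta>) - (LINT \<theta>|\<eta>. f \<theta>)\<bar> \<le> c" by simp
qed

section \<open>Transport along a Lipschitz velocity field\<close>

lemma LINT_interval_combine:
  fixes f :: "real \<Rightarrow> real"
  assumes "set_integrable lborel {a..c} f" "a \<le> b" "b \<le> c"
  shows "(LINT s:{a..c}|lborel. f s) = (LINT s:{a..b}|lborel. f s) + (LINT s:{b..c}|lborel. f s)"
proof -
  have "set_integrable lborel {a..b} f" "set_integrable lborel {b..c} f"
    using assms by (auto intro: set_integrable_subset)
  then show ?thesis
    using assms by (simp add: set_borel_integral_eq_integral Henstock_Kurzweil_Integration.integral_combine)
qed

lemma circ_continuous_bounded: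
  assumes "circ_continuous g"
  shows "\<exists>c. \<forall>u. \<bar>g u\<bar> \<le> c"
proof -
  have "continuous_on {0..2 * pi} g"
    using assms continuous_on_subset by (auto simp: circ_continuous_def)
  then have "bounded (g ` {0..2 * pi})"
    by (intro compact_imp_bounded compact_continuous_image) auto
  then obtain c where "\<forall>y\<in>g ` {0..2 * pi}. norm y \<le> c" unfolding bounded_iff by blast
  then have c: "\<bar>g u\<bar> \<le> c" if "u \<in> {0..2 * pi}" for u using that by auto
  have "\<bar>g u\<bar> \<le> c" for u
    using c[of "u rmod (2 * pi)"] rmod_in_circ[of u] periodic_rmod[of g u] assms
    by (auto simp: circ_def circ_continuous_def)
  then show ?thesis by blast
qed

lemma circ_lmeasurable: "circ \<in> lmeasurable"
proof (rule bounded_set_imp_lmeasurable)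
  show "bounded circ"
    by (rule bounded_subset[OF bounded_closed_interval[of 0 "2 * pi"]]) (auto simp: circ_def)
qed (simp add: circ_def)

lemma circ_continuous_measurable: "circ_continuous g \<Longrightarrow> g \<in> borel_measurable borel"
  by (auto simp: circ_continuous_def intro: borel_measurable_continuous_onI)

lemma circ_continuous_measurable_circ:
  "circ_continuous g \<Longrightarrow> g \<in> borel_measurable (lebesgue_on circ)"
  by (intro measurable_restrict_space1 measurable_completion) (simp add: circ_continuous_measurable)

lemma LINT_set_nonneg: "(\<And>s. s \<in> A \<Longrightarrow> 0 \<le> f s) \<Longrightarrow> 0 \<le> (LINT s:A|M. f s :: real)"
  by (auto simp: set_lebesgue_integral_def indicator_def intro!: integral_nonneg_AE)

text \<open>
  A form of domination that serves for test functions and for kernels alike.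
\<close>

lemma integrable_mult_bounded:
  fixes q g :: "'a \<Rightarrow> real"
  assumes "integrable M q" "g \<in> borel_measurable M" and c: "\<And>u. \<bar>g u\<bar> \<le> c"
  shows "integrable M (\<lambda>u. q u * g u)"
  proof (rule Bochner_Integration.integrable_bound)
    show "integrable M (\<lambda>u. c * q u)" using assms by simp
    show "(\<lambda>u. q u * g u) \<in> borel_measurable M"
      using assms(1,2) by auto
    show "AE u in M. norm (q u * g u) \<le> norm (c * q u)"
      using c by (auto simp: abs_mult mult.commute[of "\<bar>q _\<bar>"] intro!: mult_right_mono order.trans[OF c])
  qed

lemma integrable_mult_circ_continuous:
  assumes "integrable (lebesgue_on circ) q" "circ_continuous g"
  shows "integrable (lebesgue_on circ) (\<lambda>u. q u * g u)"
  using circ_continuous_bounded[OF assms(2)] assms(1) circ_continuous_measurable_circ[OF assms(2)]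
  by (auto intro: integrable_mult_bounded)

lemma circ_continuous_diff: "circ_continuous f \<Longrightarrow> circ_continuous g \<Longrightarrow> circ_continuous (\<lambda>u. f u - g u)"
  by (auto simp: circ_continuous_def intro!: continuous_intros)

lemma circ_continuous_mult: "circ_continuous f \<Longrightarrow> circ_continuous g \<Longrightarrow> circ_continuous (\<lambda>u. f u * g u)"
  by (auto simp: circ_continuous_def intro!: continuous_intros)

lemma periodic_lipschitz_mult:
  assumes f: "periodic_lipschitz L f" "\<And>u. \<bar>f u\<bar> \<le> a" and g: "periodic_lipschitz L' g" "\<And>u. \<bar>g u\<bar> \<le> b"
  shows "periodic_lipschitz (L * b + a * L') (\<lambda>u. f u * g u)"
proof -
  have "\<bar>f u * g u - f v * g v\<bar> \<le> (L * b + a * L') * \<bar>u - v\<bar>" for u v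
  proof -
    have a: "0 \<le> a" using f(2)[of 0] by linarith
    have "\<bar>f u * g u - f v * g v\<bar> = \<bar>(f u - f v) * g u + f v * (g u - g v)\<bar>" by (simp add: algebra_simps)
    also have "\<dots> \<le> \<bar>f u - f v\<bar> * \<bar>g u\<bar> + \<bar>f v\<bar> * \<bar>g u - g v\<bar>"
      by (metis abs_mult abs_triangle_ineq)
    also have "\<dots> \<le> (L * \<bar>u - v\<bar>) * b + a * (L' * \<bar>u - v\<bar>)"
      using f g periodic_lipschitz_nonneg[OF f(1)] a
      by (intro add_mono mult_mono) (auto simp: periodic_lipschitz_def)
    finally show ?thesis by (simp add: algebra_simps)
  qed
  then show ?thesis using f(1) g(1) by (simp add: periodic_lipschitz_def)
qed

lemma set_integrable_lebesgue:
  fixes f :: "'a::euclidean_space \<Rightarrow> real"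
  assumes "set_integrable lborel A f"
  shows "set_integrable lebesgue A f" "(LINT x:A|lebesgue. f x) = (LINT x:A|lborel. f x)"
  using assms unfolding set_integrable_def set_lebesgue_integral_def
  by (auto simp: integrable_completion integral_completion dest: borel_measurable_integrable)

text \<open>
  Both bounds involve the same function \<open>R\<close> of time, which is merely integrable: this is all that is
  known of a weak solution at first, and the case \<open>R = 1\<close> gives the final estimates.
\<close>

locale velocity_field =
  fixes T :: real and R :: "real \<Rightarrow> real" and V :: "real \<Rightarrow> real \<Rightarrow> real"
  assumes T_nonneg: "0 \<le> T"
    and R_integrable: "set_integrable lborel {0..T} R"
    and V_measurable: "(\<lambda>(s, u). V s u) \<in> borel_measurable (borel \<Otimes>\<^sub>M borel)"
    and V_bound: "s \<in> {0..T} \<Longrightarrow> \<bar>V s u\<bar> \<le> R s"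
    and V_lipschitz: "s \<in> {0..T} \<Longrightarrow> periodic_lipschitz (R s) (V s)"
begin

text \<open>
  How far the field can move a point up to time \<open>t\<close>, and at the same time the logarithm of the factor by
  which it can increase a Lipschitz constant.
\<close>

definition budget :: "real \<Rightarrow> real" where
  "budget t = (LINT s:{0..t}|lborel. R s)"

definition displacement :: "real \<Rightarrow> real \<Rightarrow> real \<Rightarrow> real" where
  "displacement a b u = (LINT s:{a..b}|lborel. V s u)"

definition path :: "(real \<Rightarrow> real) \<Rightarrow> (real \<Rightarrow> real) \<Rightarrow> bool" where
  "path \<theta> U \<longleftrightarrow> continuous_on {0..T} U \<and>
     (\<forall>s\<in>{0..T}. \<bar>U s\<bar> \<le> 1 \<and> (\<theta> has_real_derivative U s) (at s within {0..T}))"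

text \<open>
  The deviation of a path with velocity \<open>U\<close> from the integral curves of the field.
\<close>

definition slip :: "(real \<Rightarrow> real) \<Rightarrow> (real \<Rightarrow> real) \<Rightarrow> real \<Rightarrow> real \<Rightarrow> real" where
  "slip \<theta> U a b = (LINT s:{a..b}|lborel. \<bar>U s - V s (\<theta> s)\<bar>)"

lemma R_nonneg: "s \<in> {0..T} \<Longrightarrow> 0 \<le> R s"
  using V_bound[of s 0] by linarith

lemma R_integrable_sub: "0 \<le> a \<Longrightarrow> b \<le> T \<Longrightarrow> set_integrable lborel {a..b} R"
  using R_integrable by (rule set_integrable_subset) auto

lemma budget_diff:
  assumes "0 \<le> a" "a \<le> b" "b \<le> T"
  shows "(LINT s:{a..b}|lborel. R s) = budget b - budget a"
  unfolding budget_def using LINT_interval_combine[of 0 b R a] assms R_integrable_sub[of 0 b] by simp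

lemma budget_mono:
  assumes "0 \<le> a" "a \<le> b" "b \<le> T"
  shows "budget a \<le> budget b"
proof -
  have "0 \<le> (LINT s:{a..b}|lborel. R s)"
    using R_nonneg assms by (intro LINT_set_nonneg) auto
  then show ?thesis using budget_diff[OF assms] by simp
qed

lemma budget_0: "budget 0 = 0"
  unfolding budget_def using LINT_interval_combine[of 0 0 R 0] R_integrable_sub[of 0 0] T_nonneg by simp

lemma budget_continuous: "continuous_on {0..T} budget"
proof -
  have "continuous_on {0..T} (\<lambda>t. integral {0..t} R)"
    using set_borel_integral_eq_integral(1)[OF R_integrable] by (rule indefinite_integral_continuous_1)
  moreover have "budget t = integral {0..t} R" if "t \<in> {0..T}" for t
    unfolding budget_def using that set_borel_integral_eq_integral(2)[OF R_integrable_sub[of 0 t]] by auto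
  ultimately show ?thesis
    by (metis (no_types, lifting) continuous_on_cong)
qed

lemma V_slice_measurable: "(\<lambda>s. V s u) \<in> borel_measurable borel"
proof -
  have "(\<lambda>s. (s, u)) \<in> borel \<rightarrow>\<^sub>M borel \<Otimes>\<^sub>M borel" by simp
  from measurable_compose[OF this V_measurable] show ?thesis by simp
qed

lemma V_slice_integrable:
  assumes "0 \<le> a" "b \<le> T"
  shows "set_integrable lborel {a..b} (\<lambda>s. V s u)"
  using R_integrable_sub[OF assms] unfolding set_integrable_def
proof (rule Bochner_Integration.integrable_bound)
  show "(\<lambda>s. indicator {a..b} s *\<^sub>R V s u) \<in> borel_measurable lborel"
    using V_slice_measurable[of u] by simp
  show "AE s in lborel. norm (indicator {a..b} s *\<^sub>R V s u) \<le> norm (indicator {a..b} s *\<^sub>R R s)"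
    using V_bound assms R_nonneg by (auto simp: indicator_def intro!: AE_I2)
qed

lemma displacement_bound:
  assumes "0 \<le> a" "a \<le> b" "b \<le> T"
  shows "\<bar>displacement a b u\<bar> \<le> budget b - budget a"
proof -
  have "\<bar>displacement a b u\<bar> \<le> (LINT s:{a..b}|lborel. norm (V s u))"
    unfolding displacement_def using set_integral_norm_bound[OF V_slice_integrable] assms by fastforce
  also have "\<dots> \<le> (LINT s:{a..b}|lborel. R s)"
    using assms V_bound R_integrable_sub V_slice_integrable
    by (intro set_integral_mono set_integrable_norm) auto
  finally show ?thesis using budget_diff assms by simp
qed

lemma displacement_lipschitz:
  assumes "0 \<le> a" "a \<le> b" "b \<le> T"
  shows "periodic_lipschitz (budget b - budget a) (displacement a b)"
  unfolding periodic_lipschitz_def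
proof (intro conjI allI)
  fix u v
  have per: "V s (u + 2 * pi) = V s u" if "s \<in> {a..b}" for s
    using V_lipschitz[of s] that assms by (auto simp: periodic_lipschitz_def)
  show "displacement a b (u + 2 * pi) = displacement a b u"
    unfolding displacement_def by (rule set_lebesgue_integral_cong) (use per in auto)
  have "\<bar>displacement a b u - displacement a b v\<bar> = \<bar>LINT s:{a..b}|lborel. V s u - V s v\<bar>"
    unfolding displacement_def using V_slice_integrable assms by (simp add: set_integral_diff)
  also have "\<dots> \<le> (LINT s:{a..b}|lborel. norm (V s u - V s v))"
    using set_integral_norm_bound[OF set_integral_diff(1)[OF V_slice_integrable V_slice_integrable]] assms
    by fastforce
  also have "\<dots> \<le> (LINT s:{a..b}|lborel. R s * \<bar>u - v\<bar>)"
    using assms V_lipschitz R_integrable_sub V_slice_integrable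
    by (intro set_integral_mono set_integrable_norm set_integral_diff set_integrable_mult_left)
       (auto simp: periodic_lipschitz_def)
  also have "\<dots> = (budget b - budget a) * \<bar>u - v\<bar>"
    using budget_diff assms by simp
  finally show "\<bar>displacement a b u - displacement a b v\<bar> \<le> (budget b - budget a) * \<bar>u - v\<bar>" .
qed

lemma path_continuous: "path \<theta> U \<Longrightarrow> continuous_on {0..T} \<theta>"
  unfolding path_def by (meson DERIV_continuous continuous_on_eq_continuous_within)

lemma path_velocity_measurable:
  assumes "path \<theta> U"
  shows "(\<lambda>s. indicator {0..T} s * V s (\<theta> s)) \<in> borel_measurable borel"
proof -
  have 1: "\<theta> \<in> borel_measurable (restrict_space borel {0..T})"
    using path_continuous[OF assms] by (rule borel_measurable_continuous_on_restrict)
  have "(\<lambda>s. (s, \<theta> s)) \<in> restrict_space borel {0..T} \<rightarrow>\<^sub>M borel \<Otimes>\<^sub>M borel"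
    by (rule measurable_Pair[OF measurable_restrict_space1[OF measurable_ident_sets[OF refl]] 1])
  from measurable_compose[OF this V_measurable]
  have "(\<lambda>s. V s (\<theta> s)) \<in> borel_measurable (restrict_space borel {0..T})" by simp
  then show ?thesis
    by (subst (asm) borel_measurable_restrict_space_iff) (auto simp: mult.commute)
qed

lemma path_integrable:
  assumes "path \<theta> U" "0 \<le> a" "b \<le> T"
  shows "set_integrable lborel {a..b} U" "set_integrable lborel {a..b} (\<lambda>s. V s (\<theta> s))"
proof -
  have "set_integrable lborel {a..b} U"
    using assms by (intro borel_integrable_atLeastAtMost') (auto simp: path_def intro: continuous_on_subset)
  then show "set_integrable lborel {a..b} U" .
  have "set_integrable lborel {0..T} (\<lambda>s. V s (\<theta> s))"
    using R_integrable unfolding set_integrable_def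
  proof (rule Bochner_Integration.integrable_bound)
    show "(\<lambda>s. indicator {0..T} s *\<^sub>R V s (\<theta> s)) \<in> borel_measurable lborel"
      using path_velocity_measurable[OF assms(1)] by simp
    show "AE s in lborel. norm (indicator {0..T} s *\<^sub>R V s (\<theta> s)) \<le> norm (indicator {0..T} s *\<^sub>R R s)"
      using V_bound R_nonneg by (auto simp: indicator_def intro!: AE_I2)
  qed
  then show "set_integrable lborel {a..b} (\<lambda>s. V s (\<theta> s))"
    by (rule set_integrable_subset) (use assms in auto)
qed

lemma path_increment:
  assumes "path \<theta> U" "0 \<le> a" "a \<le> b" "b \<le> T"
  shows "\<theta> b - \<theta> a = (LINT s:{a..b}|lborel. U s)"
proof -
  have "(U has_integral \<theta> b - \<theta> a) {a..b}"
  proof (rule fundamental_theorem_of_calculus)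
    fix s assume "s \<in> {a..b}"
    then have "(\<theta> has_real_derivative U s) (at s within {0..T})" using assms by (auto simp: path_def)
    then have "(\<theta> has_real_derivative U s) (at s within {a..b})"
      by (rule DERIV_subset) (use assms in auto)
    then show "(\<theta> has_vector_derivative U s) (at s within {a..b})"
      by (simp add: has_real_derivative_iff_has_vector_derivative)
  qed fact
  then show ?thesis
    using set_borel_integral_eq_integral(2)[OF path_integrable(1)[OF assms(1,2,4)]]
    by (simp add: integral_unique)
qed

lemma path_lipschitz:
  assumes "path \<theta> U" "0 \<le> a" "a \<le> b" "b \<le> T"
  shows "\<bar>\<theta> b - \<theta> a\<bar> \<le> b - a"
proof -
  have "\<bar>\<theta> b - \<theta> a\<bar> \<le> (LINT s:{a..b}|lborel. norm (U s))"
    unfolding path_increment[OF assms]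
    using set_integral_norm_bound[OF path_integrable(1)] assms by fastforce
  also have "\<dots> \<le> (LINT s:{a..b}|lborel. 1)"
    using assms path_integrable(1)[of \<theta> U a b]
    by (intro set_integral_mono set_integrable_norm) (auto simp: path_def set_integrable_def)
  finally show ?thesis using assms by (simp add: set_lebesgue_integral_def)
qed

text \<open>
  The first-order comparison of a path with the displacement of its starting point: freezing the phase
  at time \<open>a\<close> costs at most \<open>\<integral>R(s) \<bar>\<theta> s - \<theta> a\<bar> ds\<close>.
\<close>

lemma path_step:
  assumes p: "path \<theta> U" and ab: "0 \<le> a" "a \<le> b" "b \<le> T"
  shows "\<bar>\<theta> b - \<theta> a - displacement a b (\<theta> a)\<bar>
    \<le> slip \<theta> U a b + (budget b - budget a) * (b - a)"
proof -
  note I = path_integrable[OF p ab(1,3)] V_slice_integrable[OF ab(1,3), of "\<theta> a"] R_integrable_sub[OF ab(1,3)]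
  have "\<theta> b - \<theta> a - displacement a b (\<theta> a) = (LINT s:{a..b}|lborel. U s - V s (\<theta> a))"
    unfolding path_increment[OF p ab] displacement_def using I by (simp add: set_integral_diff)
  also have "\<bar>\<dots>\<bar> \<le> (LINT s:{a..b}|lborel. norm (U s - V s (\<theta> a)))"
    using set_integral_norm_bound[OF set_integral_diff(1)[OF I(1) I(3)]] by simp
  also have "\<dots> \<le> (LINT s:{a..b}|lborel. norm (U s - V s (\<theta> s)) + R s * (b - a))"
  proof (rule set_integral_mono)
    show "set_integrable lborel {a..b} (\<lambda>s. norm (U s - V s (\<theta> a)))"
      using I by (intro set_integrable_norm set_integral_diff)
    show "set_integrable lborel {a..b} (\<lambda>s. norm (U s - V s (\<theta> s)) + R s * (b - a))"
      using I by (intro set_integral_add set_integrable_norm set_integral_diff) auto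
    fix s assume s: "s \<in> {a..b}"
    have "\<bar>V s (\<theta> s) - V s (\<theta> a)\<bar> \<le> R s * \<bar>\<theta> s - \<theta> a\<bar>"
      using V_lipschitz[of s] s ab by (auto simp: periodic_lipschitz_def)
    also have "\<dots> \<le> R s * (b - a)"
      using path_lipschitz[OF p ab(1), of s] s ab R_nonneg[of s] by (intro mult_left_mono) auto
    finally show "norm (U s - V s (\<theta> a)) \<le> norm (U s - V s (\<theta> s)) + R s * (b - a)" by simp
  qed
  also have "\<dots> = (LINT s:{a..b}|lborel. norm (U s - V s (\<theta> s))) + (LINT s:{a..b}|lborel. R s * (b - a))"
    using I by (intro set_integral_add set_integrable_norm set_integral_diff) auto
  also have "\<dots> = slip \<theta> U a b + (budget b - budget a) * (b - a)"
    using budget_diff[OF ab] by (simp add: slip_def)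
  finally show ?thesis .
qed

lemma slip_combine:
  assumes p: "path \<theta> U" and ab: "0 \<le> a" "a \<le> b" "b \<le> c" "c \<le> T"
  shows "slip \<theta> U a c = slip \<theta> U a b + slip \<theta> U b c"
  unfolding slip_def
  using path_integrable[OF p ab(1,4)] ab set_integrable_norm[OF set_integral_diff(1), of lborel "{a..c}" U "\<lambda>s. V s (\<theta> s)"]
  by (intro LINT_interval_combine) auto

lemma slip_nonneg: "0 \<le> slip \<theta> U a b"
  unfolding slip_def by (intro LINT_set_nonneg) auto

end

text \<open>
  The densities \<open>q s\<close> may be signed.  The evolution is integrated against Lebesgue measure on the Lebesgue
  sets, since the flux of a weak solution agrees with a Borel function of time only almost
  everywhere.
\<close>

locale transported_curve = velocity_field +
  fixes q :: "real \<Rightarrow> real \<Rightarrow> real" and B :: real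
  assumes q_integrable: "s \<in> {0..T} \<Longrightarrow> integrable (lebesgue_on circ) (q s)"
    and q_bound: "s \<in> {0..T} \<Longrightarrow> circ_continuous g \<Longrightarrow> (\<And>u. \<bar>g u\<bar> \<le> c) \<Longrightarrow>
      \<bar>LINT u|lebesgue_on circ. q s u * g u\<bar> \<le> B * c"
    and evolution_integrable: "periodic_C11 L L' g g' \<Longrightarrow>
      set_integrable lebesgue {0..T} (\<lambda>s. LINT u|lebesgue_on circ. q s u * (V s u * g' u))"
    and evolution: "0 \<le> a \<Longrightarrow> a \<le> b \<Longrightarrow> b \<le> T \<Longrightarrow> periodic_C11 L L' g g' \<Longrightarrow>
      (LINT u|lebesgue_on circ. q b u * g u) - (LINT u|lebesgue_on circ. q a u * g u) =
      (LINT s:{a..b}|lebesgue. LINT u|lebesgue_on circ. q s u * (V s u * g' u))"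
begin

definition pair :: "real \<Rightarrow> (real \<Rightarrow> real) \<Rightarrow> real" where
  "pair s g = (LINT u|lebesgue_on circ. q s u * g u)"

lemma B_nonneg: "0 \<le> B"
  using q_bound[of 0 "\<lambda>_. 0" 1] T_nonneg by (simp add: circ_continuous_def)

lemma pair_diff:
  assumes "s \<in> {0..T}" "circ_continuous f" "circ_continuous g"
  shows "pair s (\<lambda>u. f u - g u) = pair s f - pair s g"
  unfolding pair_def using integrable_mult_circ_continuous[OF q_integrable] assms
  by (simp add: right_diff_distrib)

lemma flux_lipschitz:
  assumes "s \<in> {0..T}" "periodic_C11 L L' g g'"
  shows "periodic_lipschitz (R s * L + R s * L') (\<lambda>u. V s u * g' u)"
  using periodic_lipschitz_mult[OF V_lipschitz V_bound periodic_C11_deriv_lipschitz[OF assms(2)], of s L] assms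
  by (simp add: periodic_C11_def)

lemma flux_bound:
  assumes "s \<in> {0..T}" "periodic_C11 L L' g g'"
  shows "\<bar>V s u * g' u\<bar> \<le> R s * L"
  unfolding abs_mult using V_bound[OF assms(1), of u] assms(2)
  by (intro mult_mono) (auto simp: periodic_C11_def intro: R_nonneg assms(1))

text \<open>
  For smooth \<open>g\<close> this is the evolution with the flux bounded by \<open>B L R\<close>.  A Lipschitz function is a uniform
  limit of smooth functions with the same constant.
\<close>

lemma pair_time_lipschitz:
  assumes g: "periodic_lipschitz L g" and ab: "0 \<le> a" "a \<le> b" "b \<le> T"
  shows "\<bar>pair b g - pair a g\<bar> \<le> B * L * (budget b - budget a)"
proof (rule field_le_epsilon)
  fix e :: real assume e: "e > 0"
  have L: "0 \<le> L" using periodic_lipschitz_nonneg[OF g] .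
  define h where "h = e / (2 * B * L + 1)"
  have BL: "0 \<le> B * L" using B_nonneg L by simp
  have h: "h > 0" using e BL by (auto simp: h_def intro!: divide_pos_pos add_nonneg_pos)
  have he: "2 * B * L * h \<le> e" using e BL by (simp add: h_def field_simps)
  obtain G G' where G: "periodic_C11 L (2 * L / h) G G'" "\<And>u. \<exists>v\<in>{u..u + h}. G u = g v"
    using periodic_lipschitz_smoothing[OF g h] by blast
  have close: "\<bar>G u - g u\<bar> \<le> L * h" for u
  proof -
    obtain v where v: "v \<in> {u..u + h}" "G u = g v" using G(2) by blast
    have "\<bar>g v - g u\<bar> \<le> L * \<bar>v - u\<bar>" using g by (simp add: periodic_lipschitz_def)
    also have "\<dots> \<le> L * h" using v L by (intro mult_left_mono) auto
    finally show ?thesis using v by simp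
  qed
  have cc: "circ_continuous g" "circ_continuous G"
    using g G periodic_C11_lipschitz periodic_lipschitz_circ_continuous by blast+
  have d: "\<bar>pair s G - pair s g\<bar> \<le> B * (L * h)" if "s \<in> {0..T}" for s
    using q_bound[OF that circ_continuous_diff[OF cc(2,1)] close] pair_diff[OF that cc(2,1)]
    by (simp add: pair_def)
  have Fint: "set_integrable lebesgue {a..b} (\<lambda>s. pair s (\<lambda>u. V s u * G' u))"
    unfolding pair_def using evolution_integrable[OF G(1)] by (rule set_integrable_subset) (use ab in auto)
  have "\<bar>pair b G - pair a G\<bar> = \<bar>LINT s:{a..b}|lebesgue. pair s (\<lambda>u. V s u * G' u)\<bar>"
    using evolution[OF ab G(1)] by (simp add: pair_def)
  also have "\<dots> \<le> (LINT s:{a..b}|lebesgue. norm (pair s (\<lambda>u. V s u * G' u)))"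
    using set_integral_norm_bound[OF Fint] by simp
  also have "\<dots> \<le> (LINT s:{a..b}|lebesgue. B * L * R s)"
  proof (rule set_integral_mono)
    show "set_integrable lebesgue {a..b} (\<lambda>s. norm (pair s (\<lambda>u. V s u * G' u)))"
      using Fint by (rule set_integrable_norm)
    show "set_integrable lebesgue {a..b} (\<lambda>s. B * L * R s)"
      using set_integrable_lebesgue(1)[OF R_integrable_sub[OF ab(1,3)]] by simp
    fix s assume "s \<in> {a..b}"
    then have s: "s \<in> {0..T}" using ab by auto
    have "circ_continuous (\<lambda>u. V s u * G' u)"
      using flux_lipschitz[OF s G(1)] periodic_lipschitz_circ_continuous by blast
    then have "\<bar>pair s (\<lambda>u. V s u * G' u)\<bar> \<le> B * (R s * L)"
      unfolding pair_def by (rule q_bound[OF s _ flux_bound[OF s G(1)]])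
    then show "norm (pair s (\<lambda>u. V s u * G' u)) \<le> B * L * R s"
      by (simp add: mult_ac)
  qed
  also have "\<dots> = B * L * (budget b - budget a)" 
    using budget_diff[OF ab] set_integrable_lebesgue(2)[OF R_integrable_sub[OF ab(1,3)]] by simp
  finally have "\<bar>pair b G - pair a G\<bar> \<le> B * L * (budget b - budget a)" .
  moreover have "\<bar>pair b G - pair b g\<bar> \<le> B * (L * h)" "\<bar>pair a G - pair a g\<bar> \<le> B * (L * h)"
    using d ab by auto
  moreover have "\<bar>pair b g - pair a g\<bar>
      \<le> \<bar>pair b G - pair b g\<bar> + \<bar>pair b G - pair a G\<bar> + \<bar>pair a G - pair a g\<bar>" by linarith
  moreover have "B * (L * h) + B * (L * h) \<le> e" using he by (simp add: algebra_simps)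
  ultimately show "\<bar>pair b g - pair a g\<bar> \<le> B * L * (budget b - budget a) + e" by simp
qed

text \<open>
  The constants after one step.  They grow by factors \<open>1 + p\<close>, so that a composition of many short steps
  keeps them bounded by exponentials of the total budget.
\<close>

lemma step_regularity:
  assumes f: "periodic_C11 L L' f f'" and A: "periodic_C11 p k A A'" and p: "0 \<le> p"
  shows "periodic_C11 (L * (1 + p)) (L' * (1 + p)\<^sup>2 + L * k) (\<lambda>u. f (u + A u)) (\<lambda>u. f' (u + A u) * (1 + A' u))"
  unfolding periodic_C11_def
proof (intro conjI allI)
  fix u v
  have L: "0 \<le> L" "0 \<le> L'" using periodic_C11_nonneg[OF f] .
  have f1: "\<bar>f' w\<bar> \<le> L" "\<bar>f' w - f' z\<bar> \<le> L' * \<bar>w - z\<bar>" "f (w + 2 * pi) = f w"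
    "(f has_real_derivative f' w) (at w)" for w z
    using f by (auto simp: periodic_C11_def)
  have A1: "\<bar>A' w\<bar> \<le> p" "\<bar>A' w - A' z\<bar> \<le> k * \<bar>w - z\<bar>" "A (w + 2 * pi) = A w"
    "(A has_real_derivative A' w) (at w)" for w z
    using A by (auto simp: periodic_C11_def)
  have Al: "\<bar>A w - A z\<bar> \<le> p * \<bar>w - z\<bar>" for w z
    using periodic_C11_lipschitz[OF A] by (simp add: periodic_lipschitz_def)
  have A2: "\<bar>1 + A' w\<bar> \<le> 1 + p" for w using A1(1)[of w] by linarith
  show "f (u + 2 * pi + A (u + 2 * pi)) = f (u + A u)"
    using f1(3)[of "u + A u"] by (simp add: A1(3) add_ac)
  show "((\<lambda>u. f (u + A u)) has_real_derivative f' (u + A u) * (1 + A' u)) (at u)"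
    by (rule DERIV_chain2[OF f1(4)]) (auto intro!: derivative_eq_intros A1(4))
  show "\<bar>f' (u + A u) * (1 + A' u)\<bar> \<le> L * (1 + p)"
    unfolding abs_mult using f1(1) A2 L by (intro mult_mono) auto
  have "\<bar>u + A u - (v + A v)\<bar> \<le> (1 + p) * \<bar>u - v\<bar>"
    using Al[of u v] by (simp add: algebra_simps)
  then have *: "\<bar>f' (u + A u) - f' (v + A v)\<bar> \<le> L' * ((1 + p) * \<bar>u - v\<bar>)"
    using f1(2)[of "u + A u" "v + A v"] L by (meson mult_left_mono order_trans)
  have "\<bar>f' (u + A u) * (1 + A' u) - f' (v + A v) * (1 + A' v)\<bar>
    = \<bar>(f' (u + A u) - f' (v + A v)) * (1 + A' u) + f' (v + A v) * (A' u - A' v)\<bar>"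
    by (simp add: algebra_simps)
  also have "\<dots> \<le> \<bar>f' (u + A u) - f' (v + A v)\<bar> * \<bar>1 + A' u\<bar> + \<bar>f' (v + A v)\<bar> * \<bar>A' u - A' v\<bar>"
    by (metis abs_mult abs_triangle_ineq)
  also have "\<dots> \<le> (L' * ((1 + p) * \<bar>u - v\<bar>)) * (1 + p) + L * (k * \<bar>u - v\<bar>)"
    using * A2 f1(1) A1(2) L p by (intro add_mono mult_mono) auto
  finally show "\<bar>f' (u + A u) * (1 + A' u) - f' (v + A v) * (1 + A' v)\<bar>
    \<le> (L' * (1 + p)\<^sup>2 + L * k) * \<bar>u - v\<bar>"
    by (simp add: algebra_simps power2_eq_square)
qed

text \<open>
  Fubini's theorem: pairing commutes with the time integral that defines the displacement.
\<close>

lemma pair_displacement: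
  assumes f: "periodic_C11 L L' f f'" and ab: "0 \<le> a" "a \<le> b" "b \<le> T"
  shows "set_integrable lborel {a..b} (\<lambda>s. pair a (\<lambda>u. V s u * f' u))"
    and "pair a (\<lambda>u. f' u * displacement a b u) = (LINT s:{a..b}|lborel. pair a (\<lambda>u. V s u * f' u))"
proof -
  have a: "a \<in> {0..T}" using ab by auto
  define C where "C = lebesgue_on circ"
  interpret P: pair_sigma_finite lborel C
    unfolding C_def
    by (intro pair_sigma_finite.intro sigma_finite_lborel finite_measure.axioms(1)
        finite_measure_lebesgue_on circ_lmeasurable)
  have qm: "q a \<in> borel_measurable C" using q_integrable[OF a] by (auto simp: C_def)
  have f'c: "circ_continuous f'"
    using f periodic_C11_deriv_lipschitz periodic_lipschitz_circ_continuous by blast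
  have f'm: "f' \<in> borel_measurable C" using circ_continuous_measurable_circ[OF f'c] by (simp add: C_def)
  have idm: "(\<lambda>u. u) \<in> C \<rightarrow>\<^sub>M borel"
    unfolding C_def by (intro measurable_restrict_space1 measurable_completion) simp
  have Vm: "(\<lambda>(s, u). V s u) \<in> borel_measurable (lborel \<Otimes>\<^sub>M C)"
  proof -
    have "(\<lambda>x. (fst x, snd x)) \<in> lborel \<Otimes>\<^sub>M C \<rightarrow>\<^sub>M borel \<Otimes>\<^sub>M borel"
      by (intro measurable_Pair measurable_compose[OF measurable_snd idm]) simp
    from measurable_compose[OF this V_measurable] show ?thesis by simp
  qed
  define F where "F = (\<lambda>s u. indicator {a..b} s * (q a u * (V s u * f' u)))"
  have Fm: "case_prod F \<in> borel_measurable (lborel \<Otimes>\<^sub>M C)"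
    unfolding F_def using qm f'm Vm by (simp add: case_prod_beta') measurable
  have maj: "integrable (lborel \<Otimes>\<^sub>M C) (\<lambda>(s, u). (indicator {a..b} s * R s) * (L * \<bar>q a u\<bar>))"
  proof (rule P.Fubini_integrable)
    have R1: "integrable lborel (\<lambda>s. indicator {a..b} s * R s)"
      using R_integrable_sub[OF ab(1,3)] by (simp add: set_integrable_def)
    have q1: "integrable C (q a)" using q_integrable[OF a] by (simp add: C_def)
    show "(\<lambda>(s, u). indicator {a..b} s * R s * (L * \<bar>q a u\<bar>)) \<in> borel_measurable (lborel \<Otimes>\<^sub>M C)"
      using borel_measurable_integrable[OF R1] borel_measurable_integrable[OF q1] by measurable
    show "integrable lborel (\<lambda>s. LINT u|C. norm (case (s, u) of (s, u) \<Rightarrow> indicator {a..b} s * R s * (L * \<bar>q a u\<bar>)))"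
      using integrable_norm[OF R1] by (simp add: abs_mult)
    show "AE s in lborel. integrable C (\<lambda>u. case (s, u) of (s, u) \<Rightarrow> indicator {a..b} s * R s * (L * \<bar>q a u\<bar>))"
      using q1 by simp
  qed
  have FI: "integrable (lborel \<Otimes>\<^sub>M C) (case_prod F)"
  proof (rule Bochner_Integration.integrable_bound[OF maj Fm], intro AE_I2)
    fix x :: "real \<times> real"
    obtain s u where x: "x = (s, u)" by fastforce
    have "\<bar>F s u\<bar> \<le> indicator {a..b} s * R s * (L * \<bar>q a u\<bar>)"
    proof (cases "s \<in> {a..b}")
      case True
      then have "\<bar>V s u * f' u\<bar> \<le> R s * L" using flux_bound[of s, OF _ f] ab by auto
      then have "\<bar>q a u\<bar> * \<bar>V s u * f' u\<bar> \<le> \<bar>q a u\<bar> * (R s * L)" by (rule mult_left_mono) simp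
      then show ?thesis using True by (simp add: F_def abs_mult mult_ac)
    qed (simp add: F_def)
    then show "norm (case_prod F x) \<le> norm (case x of (s, u) \<Rightarrow> indicator {a..b} s * R s * (L * \<bar>q a u\<bar>))"
      unfolding x real_norm_def prod.case by (rule order_trans[OF _ abs_ge_self])
  qed
  have swap: "(LINT u|C. LINT s|(lborel :: real measure). F s u) = (LINT s|(lborel :: real measure). LINT u|C. F s u)"
    by (rule P.Fubini_integral[OF FI])
  have inner: "(LINT u|C. F s u) = indicator {a..b} s * pair a (\<lambda>u. V s u * f' u)" for s
    by (simp add: F_def pair_def C_def)
  have "integrable (lborel :: real measure) (\<lambda>s. LINT u|C. F s u)" using P.integrable_fst[OF FI] .
  then show "set_integrable lborel {a..b} (\<lambda>s. pair a (\<lambda>u. V s u * f' u))"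
    unfolding inner set_integrable_def by simp
  have inner2: "(LINT s|(lborel :: real measure). F s u) = q a u * (f' u * displacement a b u)" for u
  proof -
    have "(LINT s|(lborel :: real measure). F s u) = (LINT s|lborel. (q a u * f' u) * (indicator {a..b} s * V s u))"
      by (intro Bochner_Integration.integral_cong) (auto simp: F_def)
    also have "\<dots> = (q a u * f' u) * (LINT s|lborel. indicator {a..b} s * V s u)"
      by (rule integral_mult_right_zero)
    finally show ?thesis by (simp add: displacement_def set_lebesgue_integral_def)
  qed
  show "pair a (\<lambda>u. f' u * displacement a b u) = (LINT s:{a..b}|lborel. pair a (\<lambda>u. V s u * f' u))"
    using swap unfolding inner inner2 by (simp add: pair_def C_def set_lebesgue_integral_def)
qed

text \<open>
  One backward step, \<open>g u = f (u + S u)\<close> with \<open>S\<close> a smoothed displacement.  To first order \<open>g - f\<close> is \<open>f' A\<close>,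
  and the pairing of \<open>f' A\<close> at time \<open>a\<close> differs from the evolution over \<open>{a..b}\<close> only because the flux is
  tested at time \<open>a\<close> instead of \<open>s\<close>; the pairing being Lipschitz in time, this is of order \<open>p\<^sup>2\<close>.
  The same \<open>g\<close> works for all paths.
\<close>

lemma transport_step:
  assumes f: "periodic_C11 L L' f f'" and ab: "0 \<le> a" "a \<le> b" "b \<le> T" and h: "h > 0"
  defines "p \<equiv> budget b - budget a"
  shows "\<exists>g g'. periodic_C11 (L * (1 + p)) (L' * (1 + p)\<^sup>2 + L * (2 * p / h)) g g' \<and>
    (\<forall>u. \<exists>v. g u = f v) \<and>
    \<bar>pair b f - pair a g\<bar> \<le> B * (p * ((2 * L' + L) * p + L * h)) \<and>
    (\<forall>\<theta> U. path \<theta> U \<longrightarrow> \<bar>f (\<theta> b) - g (\<theta> a)\<bar> \<le> L * (slip \<theta> U a b + p * (b - a) + p * h))"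
proof -
  have a: "a \<in> {0..T}" and b: "b \<in> {0..T}" using ab by auto
  have p: "0 \<le> p" using budget_mono[OF ab] by (simp add: p_def)
  note L = periodic_C11_nonneg[OF f]
  define A where "A = displacement a b"
  have A: "periodic_lipschitz p A" "\<And>u. \<bar>A u\<bar> \<le> p"
    using displacement_lipschitz[OF ab] displacement_bound[OF ab] by (auto simp: A_def p_def)
  obtain S S' where S: "periodic_C11 p (2 * p / h) S S'" "\<And>u. \<exists>v\<in>{u..u + h}. S u = A v"
    using periodic_lipschitz_smoothing[OF A(1) h] by blast
  have SA: "\<bar>S u - A u\<bar> \<le> p * h" "\<bar>S u\<bar> \<le> p" for u
  proof -
    obtain v where v: "v \<in> {u..u + h}" "S u = A v" using S(2) by blast
    have "\<bar>A v - A u\<bar> \<le> p * \<bar>v - u\<bar>" using A(1) by (simp add: periodic_lipschitz_def)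
    also have "\<dots> \<le> p * h" using v p by (intro mult_left_mono) auto
    finally show "\<bar>S u - A u\<bar> \<le> p * h" using v by simp
    show "\<bar>S u\<bar> \<le> p" using v A(2) by simp
  qed
  define g where "g = (\<lambda>u. f (u + S u))"
  define g' where "g' = (\<lambda>u. f' (u + S u) * (1 + S' u))"
  have g: "periodic_C11 (L * (1 + p)) (L' * (1 + p)\<^sup>2 + L * (2 * p / h)) g g'"
    unfolding g_def g'_def by (rule step_regularity[OF f S(1) p])
  have fl: "\<bar>f u - f v\<bar> \<le> L * \<bar>u - v\<bar>" for u v
    using periodic_C11_lipschitz[OF f] by (simp add: periodic_lipschitz_def)
  have cc: "circ_continuous f" "circ_continuous g" "circ_continuous f'" "circ_continuous A"
    using f g A periodic_C11_lipschitz periodic_C11_deriv_lipschitz periodic_lipschitz_circ_continuous by blast+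
  have D: "\<bar>pair b f - pair a g\<bar> \<le> B * (p * ((2 * L' + L) * p + L * h))"
  proof -
    define G where "G = (\<lambda>c s. pair c (\<lambda>u. V s u * f' u))"
    have cG: "circ_continuous (\<lambda>u. V s u * f' u)" if "s \<in> {0..T}" for s
      using flux_lipschitz[OF that f] periodic_lipschitz_circ_continuous by blast
    have I1: "set_integrable lebesgue {a..b} (\<lambda>s. G s s)"
      unfolding G_def pair_def using evolution_integrable[OF f] by (rule set_integrable_subset) (use ab in auto)
    have I2: "set_integrable lebesgue {a..b} (\<lambda>s. G a s)"
      unfolding G_def by (rule set_integrable_lebesgue(1)[OF pair_displacement(1)[OF f ab]])
    have e1: "pair b f - pair a f = (LINT s:{a..b}|lebesgue. G s s)"
      unfolding G_def pair_def by (rule evolution[OF ab f])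
    have e2: "pair a (\<lambda>u. f' u * A u) = (LINT s:{a..b}|lebesgue. G a s)"
      unfolding G_def A_def set_integrable_lebesgue(2)[OF pair_displacement(1)[OF f ab]]
      by (rule pair_displacement(2)[OF f ab])
    have "\<bar>(LINT s:{a..b}|lebesgue. G s s) - (LINT s:{a..b}|lebesgue. G a s)\<bar>
      = \<bar>LINT s:{a..b}|lebesgue. G s s - G a s\<bar>"
      using I1 I2 by (simp add: set_integral_diff)
    also have "\<dots> \<le> (LINT s:{a..b}|lebesgue. norm (G s s - G a s))"
      using set_integral_norm_bound[OF set_integral_diff(1)[OF I1 I2]] by simp
    also have "\<dots> \<le> (LINT s:{a..b}|lebesgue. B * (L + L') * p * R s)"
    proof (rule set_integral_mono)
      show "set_integrable lebesgue {a..b} (\<lambda>s. norm (G s s - G a s))"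
        using I1 I2 by (intro set_integrable_norm set_integral_diff)
      show "set_integrable lebesgue {a..b} (\<lambda>s. B * (L + L') * p * R s)"
        using set_integrable_lebesgue(1)[OF R_integrable_sub[OF ab(1,3)]] by simp
      fix s assume s': "s \<in> {a..b}"
      then have s: "s \<in> {0..T}" using ab by auto
      have "\<bar>G s s - G a s\<bar> \<le> B * (R s * L + R s * L') * (budget s - budget a)"
        unfolding G_def using pair_time_lipschitz[OF flux_lipschitz[OF s f] ab(1)] s' ab by auto
      also have "\<dots> \<le> B * (R s * L + R s * L') * p"
        using budget_mono[of s b] s' ab s B_nonneg R_nonneg[OF s] L
        by (intro mult_left_mono) (auto simp: p_def)
      finally show "norm (G s s - G a s) \<le> B * (L + L') * p * R s"
        by (simp add: algebra_simps)
    qed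
    also have "\<dots> = B * (L + L') * p * p"
      using budget_diff[OF ab] set_integrable_lebesgue(2)[OF R_integrable_sub[OF ab(1,3)]] by (simp add: p_def)
    finally have m: "\<bar>(pair b f - pair a f) - pair a (\<lambda>u. f' u * A u)\<bar> \<le> B * (L + L') * p * p"
      unfolding e1 e2 .
    have cfA: "circ_continuous (\<lambda>u. f' u * A u)" "circ_continuous (\<lambda>u. g u - f u)"
      using cc by (auto intro: circ_continuous_mult circ_continuous_diff)
    have e: "\<bar>(g u - f u) - f' u * A u\<bar> \<le> L' * p\<^sup>2 + L * (p * h)" for u
    proof -
      have "\<bar>f (u + S u) - f u - f' u * S u\<bar> \<le> L' * (S u)\<^sup>2"
        by (rule periodic_C11_linearization[OF f])
      also have "\<dots> \<le> L' * p\<^sup>2"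
        using SA(2)[of u] L by (intro mult_left_mono) (auto simp: abs_le_square_iff[symmetric] p)
      finally have "\<bar>f (u + S u) - f u - f' u * S u\<bar> \<le> L' * p\<^sup>2" .
      moreover have "\<bar>f' u * (S u - A u)\<bar> \<le> L * (p * h)"
        unfolding abs_mult using f SA(1)[of u] L by (intro mult_mono) (auto simp: periodic_C11_def)
      moreover have "(g u - f u) - f' u * A u = (f (u + S u) - f u - f' u * S u) + f' u * (S u - A u)"
        by (simp add: g_def algebra_simps)
      ultimately show ?thesis by linarith
    qed
    have "\<bar>pair a (\<lambda>u. (g u - f u) - f' u * A u)\<bar> \<le> B * (L' * p\<^sup>2 + L * (p * h))"
      unfolding pair_def by (rule q_bound[OF a circ_continuous_diff[OF cfA(2,1)] e])
    moreover have "pair a (\<lambda>u. (g u - f u) - f' u * A u) = pair a g - pair a f - pair a (\<lambda>u. f' u * A u)"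
      using pair_diff[OF a cfA(2,1)] pair_diff[OF a cc(2,1)] by simp
    ultimately have "\<bar>pair b f - pair a g\<bar> \<le> B * (L + L') * p * p + B * (L' * p\<^sup>2 + L * (p * h))"
      using m by simp
    then show ?thesis by (simp add: algebra_simps power2_eq_square)
  qed
  have "\<bar>f (\<theta> b) - g (\<theta> a)\<bar> \<le> L * (slip \<theta> U a b + p * (b - a) + p * h)" if "path \<theta> U" for \<theta> U
  proof -
    have "\<bar>f (\<theta> b) - g (\<theta> a)\<bar> \<le> L * \<bar>\<theta> b - (\<theta> a + S (\<theta> a))\<bar>" unfolding g_def by (rule fl)
    also have "\<bar>\<theta> b - (\<theta> a + S (\<theta> a))\<bar> \<le> slip \<theta> U a b + p * (b - a) + p * h"
      using path_step[OF that ab] SA(1)[of "\<theta> a"] unfolding A_def p_def by linarith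
    finally show ?thesis using L by (meson mult_left_mono order_trans)
  qed
  then show ?thesis using g D by (intro exI[of _ g] exI[of _ g']) (auto simp: g_def)
qed

text \<open>
  Iterating the step along times \<open>\<tau> 0 = t, \<tau> 1, \<dots>\<close> that decrease to \<open>0\<close>.  The constant \<open>M'\<close> of the derivative
  depends on the smoothing parameter \<open>h\<close> but not on the number of steps, so the accumulated error
  \<open>(2 M' + M) \<kappa> + M h\<close>, per unit of budget, is made small by choosing first \<open>h\<close> and then \<open>\<kappa>\<close>.
\<close>

lemma transport_chain:
  assumes f: "periodic_C11 L L' f f'" and t: "t \<in> {0..T}" and h: "h > 0" and \<tau>0: "\<tau> 0 = t"
    and \<tau>: "\<And>j. j < n \<Longrightarrow> 0 \<le> \<tau> (Suc j) \<and> \<tau> (Suc j) \<le> \<tau> j \<and> \<tau> j - \<tau> (Suc j) \<le> \<kappa> \<and>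
      budget (\<tau> j) - budget (\<tau> (Suc j)) \<le> \<kappa>"
  defines "M \<equiv> L * exp (budget T)"
  defines "c \<equiv> 2 * M / h"
  defines "M' \<equiv> exp (2 * budget T) * (L' + c * budget T)"
  shows "j \<le> n \<Longrightarrow> 0 \<le> \<tau> j \<and> \<tau> j \<le> t \<and> (\<exists>g g'.
    periodic_C11 (L * exp (budget t - budget (\<tau> j)))
      (exp (2 * (budget t - budget (\<tau> j))) * (L' + c * (budget t - budget (\<tau> j)))) g g' \<and>
    (\<forall>u. \<exists>v. g u = f v) \<and>
    \<bar>pair t f - pair (\<tau> j) g\<bar> \<le> B * (((2 * M' + M) * \<kappa> + M * h) * (budget t - budget (\<tau> j))) \<and>
    (\<forall>\<theta> U. path \<theta> U \<longrightarrow> \<bar>f (\<theta> t) - g (\<theta> (\<tau> j))\<bar>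
       \<le> M * (slip \<theta> U (\<tau> j) t + (budget t - budget (\<tau> j)) * (\<kappa> + h))))"
proof (induction j)
  case 0
  show ?case unfolding \<tau>0
    using f t by (intro conjI exI[of _ f] exI[of _ f']) (auto intro: slip_nonneg simp: M_def
        intro!: mult_nonneg_nonneg periodic_C11_nonneg(1)[OF f])
next
  case (Suc j)
  define a b where "a = \<tau> (Suc j)" and "b = \<tau> j"
  define Q where "Q = budget t - budget b"
  define p where "p = budget b - budget a"
  have ab: "0 \<le> a" "a \<le> b" "b \<le> t" "b - a \<le> \<kappa>" "p \<le> \<kappa>" and IH: "\<exists>g g'.
    periodic_C11 (L * exp Q) (exp (2 * Q) * (L' + c * Q)) g g' \<and>
    (\<forall>u. \<exists>v. g u = f v) \<and>
    \<bar>pair t f - pair b g\<bar> \<le> B * (((2 * M' + M) * \<kappa> + M * h) * Q) \<and>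
    (\<forall>\<theta> U. path \<theta> U \<longrightarrow> \<bar>f (\<theta> t) - g (\<theta> b)\<bar> \<le> M * (slip \<theta> U b t + Q * (\<kappa> + h)))"
    using Suc \<tau>[of j] by (auto simp: a_def b_def Q_def p_def)
  then obtain g g' where g: "periodic_C11 (L * exp Q) (exp (2 * Q) * (L' + c * Q)) g g'"
    and gr: "\<And>u. \<exists>v. g u = f v"
    and gp: "\<bar>pair t f - pair b g\<bar> \<le> B * (((2 * M' + M) * \<kappa> + M * h) * Q)"
    and g\<theta>: "\<And>\<theta> U. path \<theta> U \<Longrightarrow> \<bar>f (\<theta> t) - g (\<theta> b)\<bar> \<le> M * (slip \<theta> U b t + Q * (\<kappa> + h))"
    by blast
  have bT: "b \<le> T" "t \<le> T" using ab t by auto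
  note L = periodic_C11_nonneg[OF f]
  have M: "0 \<le> M" using L by (simp add: M_def)
  have c: "0 \<le> c" using M h by (simp add: c_def)
  have Qp: "0 \<le> Q" "0 \<le> p" and QT: "Q \<le> budget T" "Q + p \<le> budget T"
    using budget_mono[of b t] budget_mono[of a b] budget_mono[of t T] budget_mono[of 0 b] budget_mono[of 0 a]
      budget_0 ab bT by (auto simp: Q_def p_def)
  have LM: "L * exp Q \<le> M" using L QT by (auto simp: M_def intro!: mult_left_mono)
  have LM': "exp (2 * Q) * (L' + c * Q) \<le> M'"
    unfolding M'_def using L QT c Qp by (intro mult_mono add_mono mult_left_mono) auto
  obtain k k' where k: "periodic_C11 (L * exp Q * (1 + p))
      (exp (2 * Q) * (L' + c * Q) * (1 + p)\<^sup>2 + L * exp Q * (2 * p / h)) k k'"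
    and kr: "\<And>u. \<exists>v. k u = g v"
    and kp: "\<bar>pair b g - pair a k\<bar>
      \<le> B * (p * ((2 * (exp (2 * Q) * (L' + c * Q)) + L * exp Q) * p + L * exp Q * h))"
    and k\<theta>: "\<And>\<theta> U. path \<theta> U \<Longrightarrow> \<bar>g (\<theta> b) - k (\<theta> a)\<bar>
      \<le> L * exp Q * (slip \<theta> U a b + p * (b - a) + p * h)"
    using transport_step[OF g ab(1,2) bT(1) h] unfolding p_def by blast
  have "L * exp Q * (1 + p) \<le> L * exp Q * exp p"
    using L by (intro mult_left_mono exp_ge_add_one_self) auto
  then have r1: "L * exp Q * (1 + p) \<le> L * exp (Q + p)" by (simp add: exp_add mult.assoc)
  have e2: "(1 + p)\<^sup>2 \<le> exp (2 * p)"
    using power_mono[OF exp_ge_add_one_self[of p], of 2] Qp by (simp add: exp_double)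
  have r2: "exp (2 * Q) * (L' + c * Q) * (1 + p)\<^sup>2 + L * exp Q * (2 * p / h)
    \<le> exp (2 * (Q + p)) * (L' + c * (Q + p))"
  proof -
    have "exp (2 * Q) * (L' + c * Q) * (1 + p)\<^sup>2 \<le> exp (2 * Q) * (L' + c * Q) * exp (2 * p)"
      using e2 L c Qp by (intro mult_left_mono) auto
    also have "\<dots> = exp (2 * (Q + p)) * (L' + c * Q)" by (simp add: exp_add distrib_left mult_ac)
    finally have x: "exp (2 * Q) * (L' + c * Q) * (1 + p)\<^sup>2 \<le> exp (2 * (Q + p)) * (L' + c * Q)" .
    have "L * exp Q * (2 * p / h) \<le> M * (2 * p / h)" using LM Qp h by (intro mult_right_mono) auto
    also have "\<dots> = c * p" by (simp add: c_def)
    also have "\<dots> \<le> exp (2 * (Q + p)) * (c * p)"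
      using c Qp mult_right_mono[of 1 "exp (2 * (Q + p))" "c * p"] by simp
    finally show ?thesis using x by (simp add: algebra_simps)
  qed
  have kC: "periodic_C11 (L * exp (Q + p)) (exp (2 * (Q + p)) * (L' + c * (Q + p))) k k'"
    using k r1 r2 unfolding periodic_C11_def by (meson abs_ge_zero mult_right_mono order_trans)
  have rng: "\<exists>v. k u = f v" for u using kr[of u] gr by metis
  have pp: "\<bar>pair t f - pair a k\<bar> \<le> B * (((2 * M' + M) * \<kappa> + M * h) * (Q + p))"
  proof -
    have "0 \<le> exp (2 * Q) * (L' + c * Q)" using L c Qp by simp
    then have "0 \<le> M'" using LM' by linarith
    have "(2 * (exp (2 * Q) * (L' + c * Q)) + L * exp Q) * p \<le> (2 * M' + M) * \<kappa>"
      using LM LM' M ab(5) Qp \<open>0 \<le> M'\<close> by (intro mult_mono) linarith+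
    moreover have "L * exp Q * h \<le> M * h" using LM h by (intro mult_right_mono) linarith+
    ultimately have "(2 * (exp (2 * Q) * (L' + c * Q)) + L * exp Q) * p + L * exp Q * h
      \<le> (2 * M' + M) * \<kappa> + M * h" by linarith
    then have "\<bar>pair b g - pair a k\<bar> \<le> B * (p * ((2 * M' + M) * \<kappa> + M * h))"
      using kp B_nonneg Qp by (meson mult_left_mono order_trans)
    then show ?thesis using gp by (simp add: algebra_simps)
  qed
  have \<theta>\<theta>: "\<bar>f (\<theta> t) - k (\<theta> a)\<bar> \<le> M * (slip \<theta> U a t + (Q + p) * (\<kappa> + h))" if P: "path \<theta> U" for \<theta> U
  proof -
    have "L * exp Q * (slip \<theta> U a b + p * (b - a) + p * h) \<le> M * (slip \<theta> U a b + p * \<kappa> + p * h)"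
    proof (intro mult_mono add_mono mult_left_mono LM M Qp ab order_refl)
      show "0 \<le> slip \<theta> U a b + p * (b - a) + p * h" using slip_nonneg[of \<theta> U a b] Qp ab h by simp
    qed (use ab h in auto)
    then have "\<bar>g (\<theta> b) - k (\<theta> a)\<bar> \<le> M * (slip \<theta> U a b + p * \<kappa> + p * h)" using k\<theta>[OF P] by linarith
    then have "\<bar>f (\<theta> t) - k (\<theta> a)\<bar>
      \<le> M * (slip \<theta> U b t + Q * (\<kappa> + h)) + M * (slip \<theta> U a b + p * \<kappa> + p * h)"
      using g\<theta>[OF P] by linarith
    also have "\<dots> = M * (slip \<theta> U a t + (Q + p) * (\<kappa> + h))"
      using slip_combine[OF P ab(1,2,3) bT(2)] by (simp add: algebra_simps)
    finally show ?thesis .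
  qed
  have Qeq: "Q + p = budget t - budget (\<tau> (Suc j))" by (simp add: Q_def p_def a_def)
  show ?case
    using ab kC rng pp \<theta>\<theta> unfolding Qeq a_def[symmetric] by auto
qed

text \<open>
  The function \<open>g\<close> plays the role of \<open>f\<close> composed with the flow from \<open>0\<close> to \<open>t\<close>.  Its values are values of \<open>f\<close>,
  which transfers signs and bounds.
\<close>

theorem transport_duality:
  assumes f: "periodic_C11 L L' f f'" and t: "t \<in> {0..T}" and \<eta>: "\<eta> > 0"
  shows "\<exists>g. periodic_lipschitz (L * exp (budget t)) g \<and> (\<forall>u. \<exists>v. g u = f v) \<and>
    \<bar>pair t f - pair 0 g\<bar> \<le> \<eta> \<and>
    (\<forall>\<theta> U. path \<theta> U \<longrightarrow> \<bar>f (\<theta> t) - g (\<theta> 0)\<bar> \<le> L * exp (budget T) * slip \<theta> U 0 t + \<eta>)"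
proof -
  define M where "M = L * exp (budget T)"
  define X where "X = (B + 1) * budget T + 1"
  have P: "0 \<le> budget T" using budget_mono[of 0 T] budget_0 T_nonneg by simp
  have M: "0 \<le> M" using periodic_C11_nonneg[OF f] by (simp add: M_def)
  have X: "1 \<le> X" "budget T \<le> X" "B * budget T \<le> X"
    using B_nonneg P by (auto simp: X_def algebra_simps)
  \<comment> \<open>First \<open>h\<close> is chosen, because \<open>M'\<close> and thus \<open>\<kappa>\<close> depend on it; each takes half of \<open>\<eta>\<close>.\<close>
  define h where "h = \<eta> / (2 * X * (M + 1))"
  have h: "h > 0" using \<eta> X M by (simp add: h_def)
  define c where "c = 2 * M / h"
  define M' where "M' = exp (2 * budget T) * (L' + c * budget T)"
  have M': "0 \<le> M'" using periodic_C11_nonneg[OF f] P M h by (simp add: M'_def c_def)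
  define \<kappa> where "\<kappa> = \<eta> / (2 * X * (2 * M' + M + 1))"
  have \<kappa>: "\<kappa> > 0" using \<eta> X M M' by (simp add: \<kappa>_def)
  have hX: "X * (M * h) \<le> \<eta> / 2"
  proof -
    have "X * (M * h) \<le> X * ((M + 1) * h)" using X h by (intro mult_left_mono mult_right_mono) auto
    also have "\<dots> = \<eta> / 2" using X M by (simp add: h_def)
    finally show ?thesis .
  qed
  have \<kappa>X: "X * ((2 * M' + M) * \<kappa>) \<le> \<eta> / 2"
  proof -
    have "X * ((2 * M' + M) * \<kappa>) \<le> X * ((2 * M' + M + 1) * \<kappa>)"
      using X \<kappa> by (intro mult_left_mono mult_right_mono) auto
    also have "\<dots> = \<eta> / 2" using X M M' by (simp add: \<kappa>_def)
    finally show ?thesis .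
  qed
  have "uniformly_continuous_on {0..T} budget"
    using budget_continuous by (rule compact_uniformly_continuous) simp
  then obtain d where d: "d > 0" "\<And>x y. x \<in> {0..T} \<Longrightarrow> y \<in> {0..T} \<Longrightarrow> dist y x < d \<Longrightarrow> dist (budget y) (budget x) < \<kappa>"
    using \<kappa> unfolding uniformly_continuous_on_def by blast
  obtain n :: nat where n: "real n > t / min d \<kappa>" using reals_Archimedean2 by blast
  have n0: "n > 0" 
  proof (rule ccontr)
    assume "\<not> n > 0"
    moreover have "0 \<le> t / min d \<kappa>" using t d \<kappa> by auto
    ultimately show False using n by simp
  qed
  have "t < real n * min d \<kappa>"
    using n d \<kappa> pos_divide_less_eq[of "min d \<kappa>" t "real n"] by simp
  then have tn: "t / real n < min d \<kappa>"
    using n0 pos_divide_less_eq[of "real n" t "min d \<kappa>"] by (simp add: mult.commute)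
  define \<tau> where "\<tau> = (\<lambda>j. t - t * real j / real n)"
  have \<tau>: "0 \<le> \<tau> (Suc j) \<and> \<tau> (Suc j) \<le> \<tau> j \<and> \<tau> j - \<tau> (Suc j) \<le> \<kappa> \<and>
      budget (\<tau> j) - budget (\<tau> (Suc j)) \<le> \<kappa>" if "j < n" for j
  proof -
    have diff: "\<tau> j - \<tau> (Suc j) = t / real n" using n0 by (simp add: \<tau>_def field_simps)
    have "t * real (Suc j) \<le> t * real n" using that t by (intro mult_left_mono) auto
    then have nn: "0 \<le> \<tau> (Suc j)" using n0 by (simp add: \<tau>_def field_simps)
    have "\<tau> j \<le> t" using t n0 by (simp add: \<tau>_def)
    moreover have "0 \<le> t / real n" using t by simp
    ultimately have "dist (budget (\<tau> j)) (budget (\<tau> (Suc j))) < \<kappa>"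
      using diff nn tn t by (intro d(2)) (auto simp: dist_real_def)
    then show ?thesis using diff nn tn \<open>0 \<le> t / real n\<close> by (auto simp: dist_real_def)
  qed
  have \<tau>n: "\<tau> n = 0" and \<tau>0: "\<tau> 0 = t" using n0 by (auto simp: \<tau>_def)
  obtain g g' where g: "periodic_C11 (L * exp (budget t)) (exp (2 * budget t) * (L' + c * budget t)) g g'"
    and gr: "\<forall>u. \<exists>v. g u = f v"
    and gp: "\<bar>pair t f - pair 0 g\<bar> \<le> B * (((2 * M' + M) * \<kappa> + M * h) * budget t)"
    and g\<theta>: "\<And>\<theta> U. path \<theta> U \<Longrightarrow> \<bar>f (\<theta> t) - g (\<theta> 0)\<bar> \<le> M * (slip \<theta> U 0 t + budget t * (\<kappa> + h))"
    using transport_chain[OF f t h \<tau>0 \<tau>, of n n] unfolding \<tau>n budget_0 M_def c_def M'_def by auto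
  have bt: "0 \<le> budget t" "budget t \<le> budget T"
    using budget_mono[of 0 t] budget_mono[of t T] budget_0 t by auto
  define E where "E = (2 * M' + M) * \<kappa> + M * h"
  have E: "0 \<le> E" "X * E \<le> \<eta>" using M M' \<kappa> h hX \<kappa>X by (auto simp: E_def distrib_left)
  have "B * (E * budget t) \<le> X * E"
  proof -
    have "B * (E * budget t) \<le> B * (E * budget T)"
      using bt E B_nonneg by (intro mult_left_mono) auto
    also have "\<dots> = (B * budget T) * E" by simp
    also have "\<dots> \<le> X * E" using X E by (intro mult_right_mono)
    finally show ?thesis .
  qed
  then have 1: "\<bar>pair t f - pair 0 g\<bar> \<le> \<eta>" using gp E unfolding E_def by linarith
  have 2: "M * (budget t * (\<kappa> + h)) \<le> \<eta>"
  proof -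
    have "M * (budget t * (\<kappa> + h)) = budget t * (M * \<kappa> + M * h)" by (simp add: algebra_simps)
    also have "\<dots> \<le> X * E"
      unfolding E_def using bt X M M' \<kappa> h by (intro mult_mono add_mono) (auto simp: mult_right_mono)
    finally show ?thesis using E by linarith
  qed
  show ?thesis
  proof (intro exI[of _ g] conjI allI impI)
    show "periodic_lipschitz (L * exp (budget t)) g" by (rule periodic_C11_lipschitz[OF g])
    fix \<theta> U assume "path \<theta> U"
    from g\<theta>[OF this] show "\<bar>f (\<theta> t) - g (\<theta> 0)\<bar> \<le> L * exp (budget T) * slip \<theta> U 0 t + \<eta>"
      using 2 by (simp add: M_def distrib_left)
  qed (use gr 1 in auto)
qed

end

section \<open>Uniform boundedness of weakly continuous curves\<close>

text \<open>
  The uniform boundedness principle.  The space of continuous periodic functions is complete and is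
  covered by the closed sets \<open>F n\<close> of functions on which all functionals are bounded by \<open>n\<close>; by
  Baire's theorem one of them contains a ball.
\<close>

theorem weakly_continuous_imp_bounded:
  fixes q :: "real \<Rightarrow> real \<Rightarrow> real"
  assumes I: "compact I"
    and q: "\<And>s. s \<in> I \<Longrightarrow> integrable (lebesgue_on circ) (q s)"
    and cont: "\<And>g. circ_continuous g \<Longrightarrow> continuous_on I (\<lambda>s. LINT u|lebesgue_on circ. q s u * g u)"
  shows "\<exists>B. \<forall>s\<in>I. \<forall>g c. circ_continuous g \<longrightarrow> (\<forall>u. \<bar>g u\<bar> \<le> c) \<longrightarrow>
    \<bar>LINT u|lebesgue_on circ. q s u * g u\<bar> \<le> B * c"
proof -
  define K where "K = (\<lambda>s (g::real \<Rightarrow> real). LINT u|lebesgue_on circ. q s u * g u)"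
  define S where "S = {f :: real \<Rightarrow>\<^sub>C real. \<forall>u. apply_bcontfun f (u + 2 * pi) = apply_bcontfun f u}"
  define F where "F = (\<lambda>n::nat. {f \<in> S. \<forall>s\<in>I. \<bar>K s (apply_bcontfun f)\<bar> \<le> real n})"
  have app_cont: "continuous_on UNIV (\<lambda>f :: real \<Rightarrow>\<^sub>C real. apply_bcontfun f u)" for u
  proof (rule continuous_onI)
    fix f :: "real \<Rightarrow>\<^sub>C real" and e :: real assume "e > 0"
    then show "\<exists>d>0. \<forall>g\<in>UNIV. dist g f < d \<longrightarrow> dist (apply_bcontfun g u) (apply_bcontfun f u) \<le> e"
      using dist_bounded[of _ u f] by (intro exI[of _ e]) (metis less_eq_real_def order_le_less_trans)
  qed
  have Scl: "closed S"
  proof -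
    have "S = (\<Inter>u. {f :: real \<Rightarrow>\<^sub>C real. apply_bcontfun f (u + 2 * pi) = apply_bcontfun f u})"
      by (auto simp: S_def)
    then show ?thesis using app_cont by (auto intro!: closed_INT closed_Collect_eq)
  qed
  have bint: "integrable (lebesgue_on circ) (\<lambda>u. q s u * apply_bcontfun f u)" if "s \<in> I" for s f
  proof (rule integrable_mult_bounded[OF q[OF that]])
    show "apply_bcontfun f \<in> borel_measurable (lebesgue_on circ)"
      by (intro measurable_restrict_space1 measurable_completion) (simp add: borel_measurable_continuous_onI)
    show "\<bar>apply_bcontfun f u\<bar> \<le> norm f" for u using norm_bounded[of f u] by simp
  qed
  have Kcont: "continuous_on UNIV (\<lambda>f. K s (apply_bcontfun f))" if s: "s \<in> I" for s
  proof -
    define A where "A = (LINT u|lebesgue_on circ. \<bar>q s u\<bar>)"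
    have "\<bar>K s (apply_bcontfun f) - K s (apply_bcontfun g)\<bar> \<le> A * dist f g" for f g :: "real \<Rightarrow>\<^sub>C real"
    proof -
      have "K s (apply_bcontfun f) - K s (apply_bcontfun g)
        = (LINT u|lebesgue_on circ. q s u * (apply_bcontfun f u - apply_bcontfun g u))"
        unfolding K_def using bint[OF s] by (simp add: right_diff_distrib)
      also have "norm \<dots> \<le> (LINT u|lebesgue_on circ. \<bar>q s u\<bar> * dist f g)"
      proof (rule Bochner_Integration.integral_norm_bound_integral)
        show "integrable (lebesgue_on circ) (\<lambda>u. q s u * (apply_bcontfun f u - apply_bcontfun g u))"
          using bint[OF s] by (simp add: right_diff_distrib)
        show "integrable (lebesgue_on circ) (\<lambda>u. \<bar>q s u\<bar> * dist f g)" using q[OF s] by simp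
        show "norm (q s u * (apply_bcontfun f u - apply_bcontfun g u)) \<le> \<bar>q s u\<bar> * dist f g" for u
          using dist_bounded[of f u g] by (auto simp: abs_mult dist_real_def intro: mult_left_mono)
      qed
      finally show ?thesis by (simp add: A_def)
    qed
    moreover have "0 \<le> A" by (simp add: A_def)
    ultimately have "A-lipschitz_on UNIV (\<lambda>f. K s (apply_bcontfun f))"
      by (auto simp: lipschitz_on_def dist_real_def)
    then show ?thesis by (rule lipschitz_on_continuous_on)
  qed
  have Fcl: "closed (F n)" for n
  proof -
    have "F n = S \<inter> (\<Inter>s\<in>I. {f. \<bar>K s (apply_bcontfun f)\<bar> \<le> real n})" by (auto simp: F_def)
    then show ?thesis
      using Scl Kcont by (auto intro!: closed_Int closed_INT closed_Collect_le continuous_on_rabs)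
  qed
  have cc: "circ_continuous (apply_bcontfun f)" if "f \<in> S" for f
    using that by (auto simp: S_def circ_continuous_def)
  have cover: "S \<subseteq> (\<Union>n. F n)"
  proof
    fix f assume f: "f \<in> S"
    have "bounded ((\<lambda>s. K s (apply_bcontfun f)) ` I)"
      unfolding K_def using cont[OF cc[OF f]] I by (intro compact_imp_bounded compact_continuous_image)
    then obtain b where "\<forall>y\<in>(\<lambda>s. K s (apply_bcontfun f)) ` I. norm y \<le> b" unfolding bounded_iff by blast
    moreover obtain n :: nat where "b \<le> real n" using real_arch_simple by blast
    ultimately have "f \<in> F n" using f by (force simp: F_def)
    then show "f \<in> (\<Union>n. F n)" by blast
  qed
  have "\<exists>n. top_of_set S interior_of F n \<noteq> {}"
  proof (rule ccontr)
    assume c: "\<not> ?thesis"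
    have "top_of_set S interior_of (\<Union>(range F)) = {}"
    proof (rule Baire_category_alt)
      show "completely_metrizable_space (top_of_set S) \<or> locally_compact_space (top_of_set S) \<and> regular_space (top_of_set S)"
        using completely_metrizable_space_closedin[OF completely_metrizable_space_euclidean closed_closedin[THEN iffD1, OF Scl]]
        by blast
      fix Z assume "Z \<in> range F"
      then show "closedin (top_of_set S) Z \<and> top_of_set S interior_of Z = {}"
        using c Fcl by (auto simp: closedin_closed_eq[OF Scl] F_def)
    qed auto
    moreover have "\<Union>(range F) = S" using cover by (auto simp: F_def)
    ultimately have "S = {}" using interior_of_topspace[of "top_of_set S"] by simp
    moreover have "0 \<in> S" by (simp add: S_def)
    ultimately show False by simp
  qed
  then obtain n f0 where f0: "f0 \<in> top_of_set S interior_of F n" by blast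
  then obtain U where U: "openin (top_of_set S) U" "f0 \<in> U" "U \<subseteq> F n"
    by (meson interior_of_subset openin_interior_of)
  then obtain e where e: "e > 0" "ball f0 e \<inter> S \<subseteq> F n"
    using openin_contains_ball by (metis subset_trans)
  have f0S: "f0 \<in> S" and f0n: "\<And>s. s \<in> I \<Longrightarrow> \<bar>K s (apply_bcontfun f0)\<bar> \<le> real n"
    using U by (auto simp: F_def)
  have main: "\<bar>K s g\<bar> \<le> (4 * real n / e) * c"
    if s: "s \<in> I" and g: "circ_continuous g" "\<And>u. \<bar>g u\<bar> \<le> c" for s g c
  proof (cases "c > 0")
    case False
    then have "g u = 0" for u using g(2)[of u] by linarith
    then have "K s g = 0" by (simp add: K_def)
    moreover have "c = 0" using False g(2)[of 0] by linarith
    ultimately show ?thesis by simp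
  next
    case True
    define b where "b = Bcontfun g"
    have b: "apply_bcontfun b = g"
      unfolding b_def using g by (intro Bcontfun_inverse bcontfun_normI[of g c]) (auto simp: circ_continuous_def)
    \<comment> \<open>The factor scales \<open>g\<close> so that \<open>f1\<close> stays in the ball of radius \<open>e\<close> around \<open>f0\<close>.\<close>
    define f1 where "f1 = f0 + (e / (2 * c)) *\<^sub>R b"
    have "norm b \<le> c" using g(2) b by (intro norm_bound) auto
    then have "(e / (2 * c)) * norm b \<le> (e / (2 * c)) * c"
      using e True by (intro mult_left_mono) auto
    moreover have "dist f0 f1 = (e / (2 * c)) * norm b"
      using e True by (simp add: f1_def dist_norm)
    ultimately have "dist f0 f1 \<le> (e / (2 * c)) * c" by simp
    also have "\<dots> < e" using e True by simp
    finally have "f1 \<in> ball f0 e" by simp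
    moreover have "f1 \<in> S"
      using f0S g by (auto simp: S_def f1_def b circ_continuous_def)
    ultimately have "\<bar>K s (apply_bcontfun f1)\<bar> \<le> real n" using e(2) s by (auto simp: F_def)
    moreover have "K s (apply_bcontfun f1) = K s (apply_bcontfun f0) + (e / (2 * c)) * K s g"
      unfolding K_def f1_def using bint[OF s, of f0] bint[OF s, of b] b
      by (simp add: distrib_left mult.left_commute)
    ultimately have "\<bar>(e / (2 * c)) * K s g\<bar> \<le> 2 * real n" using f0n[OF s] by linarith
    then have "(e / (2 * c)) * \<bar>K s g\<bar> \<le> 2 * real n" using e True by (simp add: abs_mult)
    then show ?thesis using e True by (simp add: field_simps)
  qed
  show ?thesis using main unfolding K_def by blast
qed

section \<open>Time evolution from the weak formulation\<close>

text \<open>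
  Lebesgue measure is complete, so a function that agrees almost everywhere with a measurable function
  is itself measurable.
\<close>

lemma lebesgue_on_cong_AE:
  fixes f g :: "'a::euclidean_space \<Rightarrow> real"
  assumes S: "S \<in> sets lebesgue" and g: "g \<in> borel_measurable (lebesgue_on S)"
    and ae: "AE x in lebesgue_on S. f x = g x"
  shows "f \<in> borel_measurable (lebesgue_on S)"
    and "(LINT x|lebesgue_on S. f x) = (LINT x|lebesgue_on S. g x)"
proof -
  have "(\<lambda>x. if x \<in> S then g x else 0) \<in> borel_measurable lebesgue"
    using g S by (simp add: borel_measurable_if)
  moreover have "AE x in lebesgue. (if x \<in> S then g x else 0) = (if x \<in> S then f x else 0)"
    using ae S by (subst (asm) AE_restrict_space_iff) auto
  ultimately have "(\<lambda>x. if x \<in> S then f x else 0) \<in> borel_measurable lebesgue"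
    by (rule borel_measurable_AE)
  then show f: "f \<in> borel_measurable (lebesgue_on S)" using S by (simp add: borel_measurable_if)
  show "(LINT x|lebesgue_on S. f x) = (LINT x|lebesgue_on S. g x)"
    by (rule integral_cong_AE[OF f g ae])
qed

lemma LINT_lebesgue_on_eq:
  fixes f :: "'a::euclidean_space \<Rightarrow> real"
  assumes "S \<in> sets lebesgue"
  shows "(LINT x|lebesgue_on S. f x) = (LINT x:S|lebesgue. f x)"
    and "integrable (lebesgue_on S) f \<longleftrightarrow> set_integrable lebesgue S f"
  using assms by (simp_all add: integral_restrict_space integrable_restrict_space
      set_lebesgue_integral_def set_integrable_def)

lemma DERIV_max_0_square: "((\<lambda>z::real. (max 0 z)\<^sup>2) has_real_derivative 2 * max 0 z) (at z)"
proof -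
  consider "z > 0" | "z < 0" | "z = 0" by linarith
  then show ?thesis
  proof cases
    case 1
    have "((\<lambda>z::real. z\<^sup>2) has_real_derivative 2 * z) (at z)" by (auto intro!: derivative_eq_intros)
    then have "((\<lambda>z::real. (max 0 z)\<^sup>2) has_real_derivative 2 * z) (at z)"
      by (rule has_field_derivative_transform_within_open[where S = "{0<..}"]) (use 1 in auto)
    then show ?thesis using 1 by simp
  next
    case 2
    have "((\<lambda>z::real. 0) has_real_derivative 0) (at z)" by simp
    then have "((\<lambda>z::real. (max 0 z)\<^sup>2) has_real_derivative 0) (at z)"
      by (rule has_field_derivative_transform_within_open[where S = "{..<0}"]) (use 2 in auto)
    then show ?thesis using 2 by simp
  next
    case 3
    have "isCont (\<lambda>z::real. max 0 z) 0" by (intro continuous_intros)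
    then show ?thesis
      unfolding CARAT_DERIV 3
      by (intro exI[of _ "\<lambda>z. max 0 z"]) (auto simp: power2_eq_square max_def)
  qed
qed

text \<open>
  A \<open>C\<^sup>1\<close> function of time that equals \<open>1\<close> up to time \<open>b - d\<close> and \<open>0\<close> from time \<open>b\<close> on.
\<close>

definition cutoff :: "real \<Rightarrow> real \<Rightarrow> real \<Rightarrow> real" where
  "cutoff b d t = (max 0 (b - t))\<^sup>2 / ((max 0 (b - t))\<^sup>2 + (max 0 (t - (b - d)))\<^sup>2)"

text \<open>
  The derivative of \<open>cutoff\<close>, by the quotient rule.
\<close>

definition cutoff' :: "real \<Rightarrow> real \<Rightarrow> real \<Rightarrow> real" where
  "cutoff' b d t = (- 2 * max 0 (b - t) * (max 0 (t - (b - d)))\<^sup>2 - (max 0 (b - t))\<^sup>2 * (2 * max 0 (t - (b - d)))) /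
     ((max 0 (b - t))\<^sup>2 + (max 0 (t - (b - d)))\<^sup>2)\<^sup>2"

lemma cutoff:
  assumes d: "d > 0"
  shows cutoff_deriv: "(cutoff b d has_real_derivative cutoff' b d t) (at t)"
    and cutoff'_continuous: "continuous_on UNIV (cutoff' b d)"
    and cutoff_range: "0 \<le> cutoff b d t" "cutoff b d t \<le> 1"
    and cutoff_eq_1: "t \<le> b - d \<Longrightarrow> cutoff b d t = 1"
    and cutoff_eq_0: "b \<le> t \<Longrightarrow> cutoff b d t = 0"
    and cutoff'_nonpos: "cutoff' b d t \<le> 0"
    and cutoff'_support: "cutoff' b d t \<noteq> 0 \<Longrightarrow> b - d < t \<and> t < b"
proof -
  define A where "A = (\<lambda>t. (max 0 (b - t))\<^sup>2)"
  define C where "C = (\<lambda>t. (max 0 (t - (b - d)))\<^sup>2)"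
  define A' where "A' = (\<lambda>t. - 2 * max 0 (b - t))"
  define C' where "C' = (\<lambda>t. 2 * max 0 (t - (b - d)))"
  have AC: "A t + C t > 0" for t
  proof (cases "t < b")
    case True then show ?thesis by (simp add: A_def C_def add_pos_nonneg)
  next
    case False then show ?thesis using d by (simp add: A_def C_def add_nonneg_pos)
  qed
  have dA: "(A has_real_derivative A' t) (at t)" for t
  proof -
    have "((\<lambda>t. b - t) has_real_derivative -1) (at t)" by (auto intro!: derivative_eq_intros)
    from DERIV_chain2[OF DERIV_max_0_square this] show ?thesis by (simp add: A_def A'_def)
  qed
  have dC: "(C has_real_derivative C' t) (at t)" for t
  proof -
    have "((\<lambda>t. t - (b - d)) has_real_derivative 1) (at t)" by (auto intro!: derivative_eq_intros)
    from DERIV_chain2[OF DERIV_max_0_square this] show ?thesis by (simp add: C_def C'_def)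
  qed
  define \<phi> where phi: "\<phi> = cutoff b d"
  define \<phi>' where phi': "\<phi>' = cutoff' b d"
  have \<phi>_def: "\<phi> = (\<lambda>t. A t / (A t + C t))"
    by (auto simp: fun_eq_iff phi cutoff_def A_def C_def)
  have \<phi>'_def: "\<phi>' = (\<lambda>t. (A' t * C t - A t * C' t) / (A t + C t)\<^sup>2)"
    by (auto simp: fun_eq_iff phi' cutoff'_def A_def C_def A'_def C'_def)
  have d\<phi>: "(\<phi> has_real_derivative \<phi>' t) (at t)" for t
    unfolding \<phi>_def
    by (rule derivative_eq_intros dA dC refl | use AC[of t] in \<open>simp add: \<phi>'_def algebra_simps power2_eq_square\<close>)+
  have cont: "continuous_on UNIV \<phi>'"
    unfolding \<phi>'_def A_def C_def A'_def C'_def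
  proof (intro continuous_intros ballI)
    fix t show "((max 0 (b - t))\<^sup>2 + (max 0 (t - (b - d)))\<^sup>2)\<^sup>2 \<noteq> 0"
      using AC[of t] unfolding A_def C_def by (metis less_irrefl power_not_zero)
  qed
  have nn: "0 \<le> A t" "0 \<le> C t" "A' t \<le> 0" "0 \<le> C' t" for t
    by (auto simp: A_def C_def A'_def C'_def)
  have p1: "0 \<le> \<phi> t \<and> \<phi> t \<le> 1" for t using nn[of t] AC[of t] by (simp add: \<phi>_def)
  have p2: "\<phi> t = 1" if "t \<le> b - d" for t using AC[of t] that by (simp add: \<phi>_def C_def)
  have p3: "\<phi> t = 0" if "b \<le> t" for t using that by (simp add: \<phi>_def A_def)
  have p4: "\<phi>' t \<le> 0" for t
  proof -
    have "A' t * C t \<le> 0" "0 \<le> A t * C' t" using nn[of t] by (auto simp: mult_nonpos_nonneg)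
    then show ?thesis by (simp add: \<phi>'_def divide_nonpos_nonneg)
  qed
  have p5: "b - d < t \<and> t < b" if "\<phi>' t \<noteq> 0" for t
  proof (rule ccontr)
    assume "\<not> (b - d < t \<and> t < b)"
    then have "A t = 0 \<and> A' t = 0 \<or> C t = 0 \<and> C' t = 0"
      by (auto simp: A_def A'_def C_def C'_def)
    then show False using that by (auto simp: \<phi>'_def)
  qed
  show "(cutoff b d has_real_derivative cutoff' b d t) (at t)" "continuous_on UNIV (cutoff' b d)"
    "0 \<le> cutoff b d t" "cutoff b d t \<le> 1" "t \<le> b - d \<Longrightarrow> cutoff b d t = 1"
    "b \<le> t \<Longrightarrow> cutoff b d t = 0" "cutoff' b d t \<le> 0" "cutoff' b d t \<noteq> 0 \<Longrightarrow> b - d < t \<and> t < b"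
    using d\<phi>[of t] cont p1[of t] p2[of t] p3[of t] p4[of t] p5[of t] unfolding phi phi' by blast+
qed

text \<open>
  Products \<open>\<phi>(t) g(u)\<close> carry all the information of the weak formulation that is used below.
\<close>

lemma test_function_product:
  assumes \<phi>: "\<And>t. (\<phi> has_real_derivative \<phi>' t) (at t)" "continuous_on UNIV \<phi>'"
    and b: "b < T" "\<And>t. t \<ge> b \<Longrightarrow> \<phi> t = 0"
    and g: "periodic_C11 L L' g g'"
  shows "test_function T (\<lambda>t u. \<phi> t * g u) (\<lambda>t u. \<phi>' t * g u) (\<lambda>t u. \<phi> t * g' u)"
proof -
  have g1: "\<And>u. g (u + 2 * pi) = g u" "\<And>u. (g has_real_derivative g' u) (at u)"
    using g by (auto simp: periodic_C11_def)
  have gc: "continuous_on UNIV g" "continuous_on UNIV g'"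
    using periodic_lipschitz_continuous[OF periodic_C11_lipschitz[OF g]]
      periodic_lipschitz_continuous[OF periodic_C11_deriv_lipschitz[OF g]] by auto
  have \<phi>c: "continuous_on UNIV \<phi>" using \<phi>(1) DERIV_continuous_on by blast
  have cp: "continuous_on ({0..T} \<times> UNIV) (\<lambda>(t, u). p t * k u)"
    if "continuous_on UNIV p" "continuous_on UNIV k" for p k :: "real \<Rightarrow> real"
    unfolding case_prod_beta'
    by (intro continuous_intros continuous_on_compose2[OF that(1)] continuous_on_compose2[OF that(2)]) auto
  have "closure {(t, u). t \<in> {0..T} \<and> \<phi> t * g u \<noteq> 0} \<subseteq> {0..b} \<times> UNIV"
  proof (rule closure_minimal)
    show "{(t, u). t \<in> {0..T} \<and> \<phi> t * g u \<noteq> 0} \<subseteq> {0..b} \<times> UNIV"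
    proof
      fix z :: "real \<times> real" assume "z \<in> {(t, u). t \<in> {0..T} \<and> \<phi> t * g u \<noteq> 0}"
      then show "z \<in> {0..b} \<times> UNIV" using b(2)[of "fst z"] by (cases "fst z \<le> b") auto
    qed
  qed (auto intro: closed_Times)
  also have "\<dots> \<subseteq> {0..<T} \<times> UNIV" using b(1) by auto
  finally show ?thesis
    unfolding test_function_def
    using g1 \<phi>(1) cp[OF \<phi>(2) gc(1)] cp[OF \<phi>c gc(2)]
    by (auto intro!: DERIV_cmult DERIV_cmult_right has_field_derivative_at_within[OF \<phi>(1)])
qed

text \<open>
  Test with \<open>\<phi>(t) g(u)\<close>, where \<open>\<phi>\<close> is a cutoff at time \<open>b\<close>, and let its width tend to \<open>0\<close>: the measure
  \<open>- \<phi>'(t) dt\<close> concentrates at \<open>b\<close>, where the pairing with \<open>g\<close> is continuous, and \<open>\<phi>\<close> tends to the indicator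
  of \<open>{0..<b}\<close>.  The support condition forces \<open>b < T\<close>; the endpoints follow by continuity.
\<close>

theorem weak_form_evolution:
  fixes q vel V :: "real \<Rightarrow> real \<Rightarrow> real" and q0 :: "real \<Rightarrow> real"
  assumes T: "0 < T"
    and q: "\<And>s. s \<in> {0..T} \<Longrightarrow> integrable (lebesgue_on circ) (q s)"
    and cont: "\<And>g. circ_continuous g \<Longrightarrow> continuous_on {0..T} (\<lambda>s. LINT u|lebesgue_on circ. q s u * g u)"
    and weak: "\<And>w wt wu. test_function T w wt wu \<Longrightarrow>
      (LINT t|lebesgue_on {0..T}. LINT u|lebesgue_on circ. q t u * (wt t u + vel t u * wu t u))
        + (LINT u|lebesgue_on circ. w 0 u * q0 u) = 0"
    and vel: "AE t in lebesgue_on {0..T}. \<forall>u. vel t u = V t u"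
    and V: "\<And>s. s \<in> {0..T} \<Longrightarrow> circ_continuous (V s)"
    and g: "periodic_C11 L L' g g'"
    and flux: "set_integrable lebesgue {0..T} (\<lambda>s. LINT u|lebesgue_on circ. q s u * (V s u * g' u))"
    and b: "b \<in> {0..T}"
  shows "(LINT u|lebesgue_on circ. q b u * g u) = (LINT u|lebesgue_on circ. g u * q0 u)
    + (LINT s:{0..b}|lebesgue. LINT u|lebesgue_on circ. q s u * (V s u * g' u))"
proof -
  define k where "k = (\<lambda>s. LINT u|lebesgue_on circ. q s u * g u)"
  define G where "G = (\<lambda>s. LINT u|lebesgue_on circ. q s u * (V s u * g' u))"
  define c where "c = (LINT u|lebesgue_on circ. g u * q0 u)"
  have gcc: "circ_continuous g" "circ_continuous g'"
    using g periodic_C11_lipschitz periodic_C11_deriv_lipschitz periodic_lipschitz_circ_continuous by blast+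
  have kc: "continuous_on {0..T} k" unfolding k_def by (rule cont[OF gcc(1)])
  have GI: "set_integrable lebesgue {0..T} G" using flux by (simp add: G_def)
  have interior: "k b = c + (LINT s:{0..b}|lebesgue. G s)" if b: "0 < b" "b < T" for b
  proof -
    \<comment> \<open>The width is less than \<open>b\<close>, so that \<open>\<phi> n 0 = 1\<close>.\<close>
    define \<phi> where "\<phi> = (\<lambda>n::nat. cutoff b (b / (real n + 2)))"
    define \<phi>' where "\<phi>' = (\<lambda>n::nat. cutoff' b (b / (real n + 2)))"
    have dpos: "b / (real n + 2) > 0" for n :: nat using b by simp
    have \<phi>a: "\<And>n t. (\<phi> n has_real_derivative \<phi>' n t) (at t)" "\<And>n. continuous_on UNIV (\<phi>' n)"
      "\<And>n t. 0 \<le> \<phi> n t \<and> \<phi> n t \<le> 1" "\<And>n t. t \<le> b - b / (real n + 2) \<Longrightarrow> \<phi> n t = 1"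
      "\<And>n t. t \<ge> b \<Longrightarrow> \<phi> n t = 0" "\<And>n t. \<phi>' n t \<le> 0"
      unfolding \<phi>_def \<phi>'_def
      by (rule cutoff_deriv[OF dpos] cutoff'_continuous[OF dpos] conjI cutoff_range[OF dpos]
          cutoff'_nonpos[OF dpos] | erule cutoff_eq_1[OF dpos] cutoff_eq_0[OF dpos])+
    have \<phi>b: "b - b / (real n + 2) < t \<and> t < b" if "\<phi>' n t \<noteq> 0" for n t
      using cutoff'_support[OF dpos, of b n t] that by (simp add: \<phi>'_def)
    note \<phi> = \<phi>a \<phi>b
    have \<phi>m: "\<phi> n \<in> borel_measurable borel" for n
      by (rule borel_measurable_continuous_onI) (use \<phi>(1) DERIV_continuous_on in blast)
    have I1: "set_integrable lebesgue {0..T} (\<lambda>t. \<phi>' n t * k t)" for n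
      by (intro set_integrable_lebesgue(1) borel_integrable_atLeastAtMost' continuous_intros kc
          continuous_on_subset[OF \<phi>(2)]) simp
    have I2: "set_integrable lebesgue {0..T} (\<lambda>t. \<phi> n t * G t)" for n
      unfolding set_integrable_def
    proof (rule Bochner_Integration.integrable_bound[OF GI[unfolded set_integrable_def]])
      have "(\<lambda>t. indicator {0..T} t *\<^sub>R G t) \<in> borel_measurable lebesgue" using GI by (auto simp: set_integrable_def)
      then have "(\<lambda>t. \<phi> n t * (indicator {0..T} t *\<^sub>R G t)) \<in> borel_measurable lebesgue"
        using measurable_completion[of "\<phi> n" lborel borel] \<phi>m[of n] by (intro borel_measurable_times) simp_all
      then show "(\<lambda>t. indicator {0..T} t *\<^sub>R (\<phi> n t * G t)) \<in> borel_measurable lebesgue"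
        by (simp add: mult.left_commute)
      show "AE t in lebesgue. norm (indicator {0..T} t *\<^sub>R (\<phi> n t * G t)) \<le> norm (indicator {0..T} t *\<^sub>R G t)"
        using \<phi>(3) by (auto intro!: AE_I2 simp: abs_mult indicator_def mult_left_le_one_le)
    qed
    have eq: "(LINT t:{0..T}|lebesgue. \<phi>' n t * k t) + (LINT t:{0..T}|lebesgue. \<phi> n t * G t) + c = 0" for n
    proof -
      define F where "F = (\<lambda>t. \<phi>' n t * k t + \<phi> n t * G t)"
      have FI: "set_integrable lebesgue {0..T} F" unfolding F_def using I1 I2 by (rule set_integral_add)
      have ae: "AE t in lebesgue_on {0..T}.
        (LINT u|lebesgue_on circ. q t u * (\<phi>' n t * g u + vel t u * (\<phi> n t * g' u))) = F t"
        using vel AE_space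
      proof (eventually_elim)
        case (elim t)
        then have t: "t \<in> {0..T}" by (simp add: space_restrict_space)
        have i1: "integrable (lebesgue_on circ) (\<lambda>u. q t u * g u)"
          by (rule integrable_mult_circ_continuous[OF q[OF t] gcc(1)])
        have i2: "integrable (lebesgue_on circ) (\<lambda>u. q t u * (V t u * g' u))"
          by (rule integrable_mult_circ_continuous[OF q[OF t] circ_continuous_mult[OF V[OF t] gcc(2)]])
        have "(LINT u|lebesgue_on circ. q t u * (\<phi>' n t * g u + vel t u * (\<phi> n t * g' u)))
          = (LINT u|lebesgue_on circ. \<phi>' n t * (q t u * g u) + \<phi> n t * (q t u * (V t u * g' u)))"
          using elim by (intro Bochner_Integration.integral_cong) (auto simp: algebra_simps)
        also have "\<dots> = F t" using i1 i2 by (simp add: F_def k_def G_def)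
        finally show ?case .
      qed
      have "(LINT t|lebesgue_on {0..T}. LINT u|lebesgue_on circ. q t u * (\<phi>' n t * g u + vel t u * (\<phi> n t * g' u)))
        = (LINT t|lebesgue_on {0..T}. F t)"
        using FI by (intro lebesgue_on_cong_AE(2)[OF _ _ ae])
          (auto simp: LINT_lebesgue_on_eq(2)[symmetric])
      also have "\<dots> = (LINT t:{0..T}|lebesgue. F t)" by (rule LINT_lebesgue_on_eq(1)) simp
      also have "\<dots> = (LINT t:{0..T}|lebesgue. \<phi>' n t * k t) + (LINT t:{0..T}|lebesgue. \<phi> n t * G t)"
        unfolding F_def using I1 I2 by (rule set_integral_add)
      finally have 1: "(LINT t|lebesgue_on {0..T}. LINT u|lebesgue_on circ. q t u * (\<phi>' n t * g u + vel t u * (\<phi> n t * g' u)))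
        = (LINT t:{0..T}|lebesgue. \<phi>' n t * k t) + (LINT t:{0..T}|lebesgue. \<phi> n t * G t)" .
      have "b / (real n + 2) \<le> b" using b by (simp add: divide_le_eq_1 pos_divide_le_eq)
      then have "\<phi> n 0 = 1" by (intro \<phi>(4)) simp
      moreover have "test_function T (\<lambda>t u. \<phi> n t * g u) (\<lambda>t u. \<phi>' n t * g u) (\<lambda>t u. \<phi> n t * g' u)"
        using \<phi> b g by (intro test_function_product[where b = b]) auto
      ultimately show ?thesis using weak 1 by (fastforce simp: c_def)
    qed
    have lim1: "(\<lambda>n. LINT t:{0..T}|lebesgue. \<phi> n t * G t) \<longlonglongrightarrow> (LINT t:{0..b}|lebesgue. G t)"
    proof -
      have "(\<lambda>n. LINT t|lebesgue. indicator {0..T} t *\<^sub>R (\<phi> n t * G t)) \<longlonglongrightarrow> (LINT t|lebesgue. indicator {0..<b} t * G t)"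
      proof (rule integral_dominated_convergence)
        have Gm: "(\<lambda>t. indicator {0..T} t *\<^sub>R G t) \<in> borel_measurable lebesgue" using GI by (auto simp: set_integrable_def)
        have "(\<lambda>t. indicator {0..<b} t * (indicator {0..T} t *\<^sub>R G t)) \<in> borel_measurable lebesgue"
          using Gm measurable_completion[of "indicator {0..<b} :: real \<Rightarrow> real" lborel borel]
          by (intro borel_measurable_times) simp_all
        also have "(\<lambda>t. indicator {0..<b} t * (indicator {0..T} t *\<^sub>R G t)) = (\<lambda>t. indicator {0..<b} t * G t)"
          using b by (auto simp: indicator_def)
        finally show "(\<lambda>t. indicator {0..<b} t * G t) \<in> borel_measurable lebesgue" .
        show "(\<lambda>t. indicator {0..T} t *\<^sub>R (\<phi> n t * G t)) \<in> borel_measurable lebesgue" for n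
          using I2 by (auto simp: set_integrable_def)
        show "integrable lebesgue (\<lambda>t. norm (indicator {0..T} t *\<^sub>R G t))"
          using GI by (auto simp: set_integrable_def)
        show "AE t in lebesgue. norm (indicator {0..T} t *\<^sub>R (\<phi> n t * G t)) \<le> norm (indicator {0..T} t *\<^sub>R G t)" for n
          using \<phi>(3) by (auto intro!: AE_I2 simp: abs_mult indicator_def mult_left_le_one_le)
        show "AE t in lebesgue. (\<lambda>n. indicator {0..T} t *\<^sub>R (\<phi> n t * G t)) \<longlonglongrightarrow> indicator {0..<b} t * G t"
        proof (intro AE_I2)
          fix t
          have "eventually (\<lambda>n. indicator {0..T} t *\<^sub>R (\<phi> n t * G t) = indicator {0..<b} t * G t) sequentially"
          proof (cases "t < b")
            case False
            then show ?thesis using \<phi>(5) by (auto simp: indicator_def)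
          next
            case True
            have "(\<lambda>n. b / (real n + 2)) \<longlonglongrightarrow> 0" by real_asymp
            then have "eventually (\<lambda>n. b / (real n + 2) < b - t) sequentially"
              using True by (intro order_tendstoD) auto
            then show ?thesis
            proof eventually_elim
              case (elim n)
              then have "\<phi> n t = 1" by (intro \<phi>(4)) simp
              then show ?case using True b by (auto simp: indicator_def)
            qed
          qed
          then show "(\<lambda>n. indicator {0..T} t *\<^sub>R (\<phi> n t * G t)) \<longlonglongrightarrow> indicator {0..<b} t * G t"
            by (rule tendsto_eventually)
        qed
      qed
      moreover have "(LINT t|lebesgue. indicator {0..<b} t * G t) = (LINT t:{0..b}|lebesgue. G t)"
      proof -
        have "set_integrable lebesgue {0..b} G" using GI by (rule set_integrable_subset) (use b in auto)
        then have m: "(\<lambda>t. indicator {0..b} t *\<^sub>R G t) \<in> borel_measurable lebesgue" by (auto simp: set_integrable_def)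
        have "(\<lambda>t. indicator {0..<b} t * (indicator {0..b} t *\<^sub>R G t)) \<in> borel_measurable lebesgue"
          using m measurable_completion[of "indicator {0..<b} :: real \<Rightarrow> real" lborel borel]
          by (intro borel_measurable_times) simp_all
        also have "(\<lambda>t. indicator {0..<b} t * (indicator {0..b} t *\<^sub>R G t)) = (\<lambda>t. indicator {0..<b} t * G t)"
          by (auto simp: indicator_def)
        finally have m2: "(\<lambda>t. indicator {0..<b} t * G t) \<in> borel_measurable lebesgue" .
        have "AE t in lebesgue. t \<noteq> b" by (rule AE_completion[OF AE_lborel_singleton])
        then show ?thesis
          unfolding set_lebesgue_integral_def using m m2
          by (intro integral_cong_AE) (auto simp: indicator_def)
      qed
      ultimately show ?thesis by (simp add: set_lebesgue_integral_def)
    qed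
    have lim2: "(\<lambda>n. LINT t:{0..T}|lebesgue. \<phi>' n t * k t) \<longlonglongrightarrow> - k b"
    proof (rule LIMSEQ_I)
      fix e :: real assume e: "e > 0"
      have "b \<in> {0..T}" using b by auto
      then obtain d where d: "d > 0" "\<And>t. t \<in> {0..T} \<Longrightarrow> dist t b < d \<Longrightarrow> dist (k t) (k b) < e / 2"
        using kc e unfolding continuous_on_iff by (metis half_gt_zero)
      have "(\<lambda>n. b / (real n + 2)) \<longlonglongrightarrow> 0" by real_asymp
      then have "eventually (\<lambda>n. b / (real n + 2) < d) sequentially"
        using d by (intro order_tendstoD) auto
      then obtain n0 where n0: "\<And>n. n \<ge> n0 \<Longrightarrow> b / (real n + 2) < d" by (auto simp: eventually_sequentially)
      have "norm ((LINT t:{0..T}|lebesgue. \<phi>' n t * k t) - - k b) < e" if "n \<ge> n0" for n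
      proof -
        have \<phi>'I: "set_integrable lebesgue {0..T} (\<phi>' n)"
          by (intro set_integrable_lebesgue(1) borel_integrable_atLeastAtMost' continuous_on_subset[OF \<phi>(2)]) simp
        have "b / (real n + 2) \<le> b" using b by (simp add: divide_le_eq_1 pos_divide_le_eq)
        then have "\<phi> n 0 = 1" "\<phi> n T = 0" using b by (auto intro!: \<phi>(4,5))
        moreover have "(\<phi>' n has_integral \<phi> n T - \<phi> n 0) {0..T}"
          using T \<phi>(1)[of n] by (intro fundamental_theorem_of_calculus)
            (auto simp: has_real_derivative_iff_has_vector_derivative[symmetric] intro: has_field_derivative_at_within)
        ultimately have tot: "(LINT t:{0..T}|lebesgue. \<phi>' n t) = -1"
          using set_lebesgue_integral_eq_integral(2)[OF \<phi>'I] by (simp add: integral_unique)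
        have "(LINT t:{0..T}|lebesgue. \<phi>' n t * k t) - - k b
          = (LINT t:{0..T}|lebesgue. \<phi>' n t * k t) - (LINT t:{0..T}|lebesgue. \<phi>' n t * k b)"
          using tot by simp
        also have "\<dots> = (LINT t:{0..T}|lebesgue. \<phi>' n t * k t - \<phi>' n t * k b)"
          using I1 \<phi>'I by (intro set_integral_diff(2)[symmetric]) auto
        also have "norm \<dots> \<le> (LINT t:{0..T}|lebesgue. norm (\<phi>' n t * k t - \<phi>' n t * k b))"
          using I1 \<phi>'I by (intro set_integral_norm_bound set_integral_diff) auto
        also have "\<dots> \<le> (LINT t:{0..T}|lebesgue. - \<phi>' n t * (e / 2))"
        proof (rule set_integral_mono)
          show "set_integrable lebesgue {0..T} (\<lambda>t. norm (\<phi>' n t * k t - \<phi>' n t * k b))"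
            using I1 \<phi>'I by (intro set_integrable_norm set_integral_diff) auto
          show "set_integrable lebesgue {0..T} (\<lambda>t. - \<phi>' n t * (e / 2))" 
            using set_integrable_mult_left[of "- (e / 2)" lebesgue "{0..T}" "\<phi>' n"] \<phi>'I by simp
          fix t assume t: "t \<in> {0..T}"
          show "norm (\<phi>' n t * k t - \<phi>' n t * k b) \<le> - \<phi>' n t * (e / 2)"
          proof (cases "\<phi>' n t = 0")
            case False
            then have "b - b / (real n + 2) < t" "t < b" using \<phi>(7)[of n t] by auto
            then have "dist t b < d" using n0[OF that] by (auto simp: dist_real_def)
            then have "\<bar>k t - k b\<bar> \<le> e / 2" using d(2)[OF t] by (simp add: dist_real_def)
            then have "\<bar>\<phi>' n t\<bar> * \<bar>k t - k b\<bar> \<le> \<bar>\<phi>' n t\<bar> * (e / 2)" by (intro mult_left_mono) auto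
            moreover have "norm (\<phi>' n t * k t - \<phi>' n t * k b) = \<bar>\<phi>' n t\<bar> * \<bar>k t - k b\<bar>"
              by (simp add: abs_mult[symmetric] right_diff_distrib)
            moreover have "\<bar>\<phi>' n t\<bar> = - \<phi>' n t" using \<phi>(6)[of n t] by simp
            ultimately show ?thesis by simp
          qed simp
        qed
        also have "\<dots> = (LINT t:{0..T}|lebesgue. (- (e / 2)) * \<phi>' n t)" by (simp add: mult.commute)
        also have "\<dots> = (- (e / 2)) * (LINT t:{0..T}|lebesgue. \<phi>' n t)" by (rule set_integral_mult_right)
        also have "\<dots> = e / 2" using tot by simp
        finally show ?thesis using e by simp
      qed
      then show "\<exists>n0. \<forall>n\<ge>n0. norm ((LINT t:{0..T}|lebesgue. \<phi>' n t * k t) - - k b) < e" by blast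
    qed
    have "(\<lambda>n. (LINT t:{0..T}|lebesgue. \<phi>' n t * k t) + (LINT t:{0..T}|lebesgue. \<phi> n t * G t) + c)
      \<longlonglongrightarrow> - k b + (LINT t:{0..b}|lebesgue. G t) + c"
      by (intro tendsto_intros lim1 lim2)
    then have "(\<lambda>n. 0) \<longlonglongrightarrow> - k b + (LINT t:{0..b}|lebesgue. G t) + c" unfolding eq .
    then have "- k b + (LINT t:{0..b}|lebesgue. G t) + c = 0" by (simp add: LIMSEQ_const_iff)
    then show ?thesis by simp
  qed
  have Gc: "continuous_on {0..T} (\<lambda>b. LINT s:{0..b}|lebesgue. G s)"
  proof -
    have "continuous_on {0..T} (\<lambda>t. integral {0..t} G)"
      using set_lebesgue_integral_eq_integral(1)[OF GI] by (rule indefinite_integral_continuous_1)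
    moreover have "integral {0..t} G = (LINT s:{0..t}|lebesgue. G s)" if "t \<in> {0..T}" for t
      using that by (intro set_lebesgue_integral_eq_integral(2)[symmetric] set_integrable_subset[OF GI]) auto
    ultimately show ?thesis by (metis (no_types, lifting) continuous_on_cong)
  qed
  have "continuous_on (closure {0<..<T}) (\<lambda>b. k b - (c + (LINT s:{0..b}|lebesgue. G s)))"
    using T by (auto intro!: continuous_intros kc Gc)
  then have "k b - (c + (LINT s:{0..b}|lebesgue. G s)) = 0"
    by (rule continuous_constant_on_closure) (use T b interior in auto)
  then show ?thesis by (simp add: k_def G_def c_def)
qed

section \<open>The velocity of a weak solution\<close>

text \<open>
  Borel functions allow the use of Fubini's theorem for product measures and of the automation for
  measurability.
\<close>

lemma borel_representative:
  fixes f :: "'a::euclidean_space \<Rightarrow> real"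
  assumes f: "f \<in> borel_measurable (lebesgue_on S)" and S: "S \<in> sets borel"
  shows "\<exists>g\<in>borel_measurable borel. (\<forall>x. x \<notin> S \<longrightarrow> g x = 0) \<and> (AE x in lborel. x \<in> S \<longrightarrow> f x = g x)"
proof -
  have "(\<lambda>x. if x \<in> S then f x else 0) \<in> borel_measurable (completion lborel)"
    using f S by (simp add: borel_measurable_if)
  then obtain g where g: "g \<in> borel_measurable lborel" "AE x in lborel. (if x \<in> S then f x else 0) = g x"
    using completion_ex_borel_measurable_real by blast
  have "(\<lambda>x. indicator S x * g x) \<in> borel_measurable borel" using g S by simp
  moreover have "AE x in lborel. x \<in> S \<longrightarrow> f x = indicator S x * g x"
    using g(2) by eventually_elim (auto simp: indicator_def)
  ultimately show ?thesis by (intro bexI[of _ "\<lambda>x. indicator S x * g x"]) auto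
qed

lemma LINT_lebesgue_on_borel:
  fixes f g :: "'a::euclidean_space \<Rightarrow> real"
  assumes S: "S \<in> sets borel" and g: "g \<in> borel_measurable borel" and g0: "\<And>x. x \<notin> S \<Longrightarrow> g x = 0"
    and ae: "AE x in lborel. x \<in> S \<longrightarrow> f x = g x"
  shows "(LINT x|lebesgue_on S. f x) = (LINT x|lborel. g x)"
    and "integrable (lebesgue_on S) f \<longleftrightarrow> integrable lborel g"
proof -
  have S': "S \<in> sets lebesgue" using S by simp
  have gL: "g \<in> borel_measurable lebesgue" using g by (intro measurable_completion) simp
  then have gS: "g \<in> borel_measurable (lebesgue_on S)" by (rule measurable_restrict_space1)
  have ae': "AE x in lebesgue_on S. f x = g x"
    using AE_completion[OF ae] S' by (subst AE_restrict_space_iff) auto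
  have ind: "(\<lambda>x. indicator S x *\<^sub>R g x) = g"
  proof
    fix x show "indicator S x *\<^sub>R g x = g x" by (cases "x \<in> S") (simp_all add: g0)
  qed
  have m: "f \<in> borel_measurable (lebesgue_on S)" by (rule lebesgue_on_cong_AE(1)[OF S' gS ae'])
  have "(LINT x|lebesgue_on S. f x) = (LINT x|lebesgue_on S. g x)" by (rule lebesgue_on_cong_AE(2)[OF S' gS ae'])
  also have "\<dots> = (LINT x|lebesgue. g x)" using S' ind by (simp add: integral_restrict_space)
  also have "\<dots> = (LINT x|lborel. g x)" using g by (simp add: integral_completion)
  finally show "(LINT x|lebesgue_on S. f x) = (LINT x|lborel. g x)" .
  have "integrable (lebesgue_on S) f \<longleftrightarrow> integrable (lebesgue_on S) g"
    by (rule integrable_cong_AE[OF m gS ae'])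
  also have "\<dots> \<longleftrightarrow> integrable lebesgue g" using S' ind by (simp add: integrable_restrict_space)
  also have "\<dots> \<longleftrightarrow> integrable lborel g" using g by (simp add: integrable_completion)
  finally show "integrable (lebesgue_on S) f \<longleftrightarrow> integrable lborel g" .
qed

lemma integral_norm_bound_integral_AE:
  fixes f g :: "'a \<Rightarrow> real"
  assumes "integrable M f" "integrable M g" "AE x in M. norm (f x) \<le> g x"
  shows "norm (LINT x|M. f x) \<le> (LINT x|M. g x)"
  using integral_norm_bound[of M f] integral_mono_AE[OF integrable_norm[OF assms(1)] assms(2,3)] by linarith

text \<open>
  The set of exceptions is replaced by a Borel null set, for which the iterated integrals of the
  indicator can be interchanged.
\<close>

lemma AE_lborel_triple:
  fixes P :: "real \<Rightarrow> real \<Rightarrow> real \<Rightarrow> bool"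
  assumes "AE z in lborel. P (fst z) (fst (snd z)) (snd (snd z))"
  shows "AE t in lborel. AE x in lborel. AE u in lborel. P t u x"
    and "AE x in lborel. AE t in lborel. AE u in lborel. P t u x"
proof -
  obtain N where N: "N \<in> null_sets lborel" "\<And>z. z \<notin> N \<Longrightarrow> P (fst z) (fst (snd z)) (snd (snd z))"
    using assms by (auto elim!: AE_E3)
  define ind :: "real \<Rightarrow> real \<Rightarrow> real \<Rightarrow> ennreal" where "ind = (\<lambda>t u x. indicator N (t, u, x))"
  have N': "N \<in> sets borel" using N(1) by auto
  have ind [measurable (raw)]: "(\<lambda>z. ind (f z) (g z) (h z)) \<in> borel_measurable M"
    if "f \<in> borel_measurable M" "g \<in> borel_measurable M" "h \<in> borel_measurable M" for f g h and M :: "'z measure"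
  proof -
    have "(\<lambda>z. (f z, g z, h z)) \<in> M \<rightarrow>\<^sub>M borel"
      using measurable_Pair[OF that(1) measurable_Pair[OF that(2,3)]] by (simp add: borel_prod)
    from measurable_compose[OF this borel_measurable_indicator[OF N', where 'b = ennreal]] show ?thesis by (simp add: ind_def)
  qed
  have "(\<integral>\<^sup>+z. indicator N z \<partial>lborel) = emeasure lborel N" using N' by (intro nn_integral_indicator) simp
  then have "0 = (\<integral>\<^sup>+z. indicator N z \<partial>lborel)" using N(1) by (simp add: null_sets_def)
  also have "\<dots> = (\<integral>\<^sup>+t. \<integral>\<^sup>+y. indicator N (t, y) \<partial>lborel \<partial>lborel)"
    using N' by (subst lborel_prod[symmetric], subst lborel.nn_integral_fst[symmetric]) (auto simp: borel_prod lborel_prod)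
  also have "\<dots> = (\<integral>\<^sup>+t. \<integral>\<^sup>+u. \<integral>\<^sup>+x. ind t u x \<partial>lborel \<partial>lborel \<partial>lborel)"
  proof (rule nn_integral_cong)
    fix t
    have "(\<lambda>y. indicator N (t, y) :: ennreal) \<in> borel_measurable (lborel \<Otimes>\<^sub>M lborel)"
      using ind[of "\<lambda>_. t" "lborel \<Otimes>\<^sub>M lborel" fst snd] by (simp add: ind_def)
    then show "(\<integral>\<^sup>+y. indicator N (t, y) \<partial>lborel) = (\<integral>\<^sup>+u. \<integral>\<^sup>+x. ind t u x \<partial>lborel \<partial>lborel)"
      by (subst lborel_prod[symmetric], subst lborel.nn_integral_fst[symmetric]) (auto simp: ind_def)
  qed
  also have "\<dots> = (\<integral>\<^sup>+t. \<integral>\<^sup>+x. \<integral>\<^sup>+u. ind t u x \<partial>lborel \<partial>lborel \<partial>lborel)"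
    by (intro nn_integral_cong lborel_pair.Fubini'[symmetric]) measurable
  finally have z1: "(\<integral>\<^sup>+t. \<integral>\<^sup>+x. \<integral>\<^sup>+u. ind t u x \<partial>lborel \<partial>lborel \<partial>lborel) = 0" by simp
  also have "(\<integral>\<^sup>+t. \<integral>\<^sup>+x. \<integral>\<^sup>+u. ind t u x \<partial>lborel \<partial>lborel \<partial>lborel) = (\<integral>\<^sup>+x. \<integral>\<^sup>+t. \<integral>\<^sup>+u. ind t u x \<partial>lborel \<partial>lborel \<partial>lborel)"
    by (intro lborel_pair.Fubini'[symmetric]) measurable
  finally have z2: "(\<integral>\<^sup>+x. \<integral>\<^sup>+t. \<integral>\<^sup>+u. ind t u x \<partial>lborel \<partial>lborel \<partial>lborel) = 0" .
  have imp: "P t u x" if "ind t u x = 0" for t u x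
    using that N(2)[of "(t, u, x)"] by (auto simp: ind_def indicator_def split: if_splits)
  have "AE t in lborel. (\<integral>\<^sup>+x. \<integral>\<^sup>+u. ind t u x \<partial>lborel \<partial>lborel) = 0"
    using z1 by (subst (asm) nn_integral_0_iff_AE) auto
  then show "AE t in lborel. AE x in lborel. AE u in lborel. P t u x"
  proof eventually_elim
    case (elim t)
    then have "AE x in lborel. (\<integral>\<^sup>+u. ind t u x \<partial>lborel) = 0" by (subst (asm) nn_integral_0_iff_AE) auto
    then show ?case
    proof eventually_elim
      case (elim x)
      then have "AE u in lborel. ind t u x = 0" by (subst (asm) nn_integral_0_iff_AE) auto
      then show ?case by eventually_elim (rule imp)
    qed
  qed
  have "AE x in lborel. (\<integral>\<^sup>+t. \<integral>\<^sup>+u. ind t u x \<partial>lborel \<partial>lborel) = 0"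
    using z2 by (subst (asm) nn_integral_0_iff_AE) auto
  then show "AE x in lborel. AE t in lborel. AE u in lborel. P t u x"
  proof eventually_elim
    case (elim x)
    then have "AE t in lborel. (\<integral>\<^sup>+u. ind t u x \<partial>lborel) = 0" by (subst (asm) nn_integral_0_iff_AE) auto
    then show ?case
    proof eventually_elim
      case (elim t)
      then have "AE u in lborel. ind t u x = 0" by (subst (asm) nn_integral_0_iff_AE) auto
      then show ?case by eventually_elim (rule imp)
    qed
  qed
qed

text \<open>
  The data of the limit problem, without the particles.
\<close>

locale mean_field =
  fixes W :: "real \<Rightarrow> real \<Rightarrow> real" and D :: "real \<Rightarrow> real"
    and \<rho>0 :: "real \<Rightarrow> real \<Rightarrow> real" and \<rho> :: "real \<Rightarrow> real \<Rightarrow> real \<Rightarrow> real" and T :: real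
  assumes W_meas: "(\<lambda>(x, y). W x y) \<in> borel_measurable (lebesgue_on ({0..1} \<times> {0..1}))"
    and W_bound: "\<forall>x\<in>{0..1}. \<forall>y\<in>{0..1}. \<bar>W x y\<bar> \<le> 1"
    and D_periodic: "\<forall>v. D (v + 2 * pi) = D v"
    and D_bound: "\<forall>v. \<bar>D v\<bar> \<le> 1"
    and D_lipschitz: "\<forall>v v'. \<bar>D v - D v'\<bar> \<le> \<bar>v - v'\<bar>"
    and \<rho>0_density: "\<forall>x\<in>{0..1}. integrable (lebesgue_on circ) (\<lambda>v. \<rho>0 v x) \<and>
                        (AE v in lebesgue_on circ. 0 \<le> \<rho>0 v x) \<and>
                        (LINT v|lebesgue_on circ. \<rho>0 v x) = 1"
    and T_pos: "T > 0"
    and \<rho>_solution: "weak_solution T W D \<rho>0 \<rho>"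
begin

abbreviation spacetime :: "(real \<times> real \<times> real) set" where "spacetime \<equiv> {0..T} \<times> circ \<times> {0..1}"

text \<open>
  A Borel representative of \<open>\<rho>\<close> that vanishes outside \<open>spacetime\<close>.
\<close>

definition p :: "real \<Rightarrow> real \<Rightarrow> real \<Rightarrow> real" where
  "p t u x = (SOME g. g \<in> borel_measurable borel \<and> (\<forall>z. z \<notin> spacetime \<longrightarrow> g z = 0) \<and>
     (AE z in lborel. z \<in> spacetime \<longrightarrow> (case z of (t, u, x) \<Rightarrow> \<rho> t u x) = g z)) (t, u, x)"

text \<open>
  A Borel representative of \<open>W\<close>, truncated so that it is bounded by \<open>1\<close> everywhere.
\<close>

definition w :: "real \<Rightarrow> real \<Rightarrow> real" where
  "w x y = max (- 1) (min 1 ((SOME g. g \<in> borel_measurable borel \<and> (\<forall>z. z \<notin> {0..1} \<times> {0..1} \<longrightarrow> g z = 0) \<and>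
     (AE z in lborel. z \<in> {0..1} \<times> {0..1} \<longrightarrow> (case z of (x, y) \<Rightarrow> W x y) = g z)) (x, y)))"

lemma spacetime_borel: "spacetime \<in> sets borel"
  by (simp add: circ_def borel_Times)

lemma p_spec: "(\<lambda>z. p (fst z) (fst (snd z)) (snd (snd z))) \<in> borel_measurable borel"
    "(t, u, x) \<notin> spacetime \<Longrightarrow> p t u x = 0"
    "AE z in lborel. z \<in> spacetime \<longrightarrow> \<rho> (fst z) (fst (snd z)) (snd (snd z)) = p (fst z) (fst (snd z)) (snd (snd z))"
proof -
  have "(\<lambda>(t, u, x). \<rho> t u x) \<in> borel_measurable (lebesgue_on spacetime)"
    using \<rho>_solution unfolding weak_solution_def by blast
  from borel_representative[OF this spacetime_borel]
  have "\<exists>g. g \<in> borel_measurable borel \<and> (\<forall>z. z \<notin> spacetime \<longrightarrow> g z = 0) \<and>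
     (AE z in lborel. z \<in> spacetime \<longrightarrow> (case z of (t, u, x) \<Rightarrow> \<rho> t u x) = g z)" by blast
  from someI_ex[OF this]
  show "(\<lambda>z. p (fst z) (fst (snd z)) (snd (snd z))) \<in> borel_measurable borel"
    "(t, u, x) \<notin> spacetime \<Longrightarrow> p t u x = 0"
    "AE z in lborel. z \<in> spacetime \<longrightarrow> \<rho> (fst z) (fst (snd z)) (snd (snd z)) = p (fst z) (fst (snd z)) (snd (snd z))"
    by (simp_all add: p_def case_prod_beta')
qed

lemma p_measurable [measurable (raw)]:
  assumes "f \<in> borel_measurable M" "g \<in> borel_measurable M" "h \<in> borel_measurable M"
  shows "(\<lambda>z. p (f z) (g z) (h z)) \<in> borel_measurable M"
proof -
  have "(\<lambda>z. (f z, g z, h z)) \<in> M \<rightarrow>\<^sub>M borel"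
    using measurable_Pair[OF assms(1) measurable_Pair[OF assms(2,3)]] by (simp add: borel_prod)
  from measurable_compose[OF this p_spec(1)] show ?thesis by simp
qed

lemma p_integrable: "integrable lborel (\<lambda>z. p (fst z) (fst (snd z)) (snd (snd z)))"
proof -
  have "integrable (lebesgue_on spacetime) (\<lambda>(t, u, x). \<rho> t u x)"
    using \<rho>_solution unfolding weak_solution_def by blast
  then show ?thesis
    using LINT_lebesgue_on_borel(2)[OF spacetime_borel p_spec(1), of "\<lambda>(t, u, x). \<rho> t u x"] p_spec(2,3)
    by (auto simp: case_prod_beta')
qed

lemma w_spec: "(\<lambda>z. w (fst z) (snd z)) \<in> borel_measurable borel" "\<bar>w x y\<bar> \<le> 1"
    "AE z in lborel. z \<in> {0..1} \<times> {0..1} \<longrightarrow> W (fst z) (snd z) = w (fst z) (snd z)"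
proof -
  have S: "{0..1::real} \<times> {0..1::real} \<in> sets borel" by (simp add: borel_Times)
  define g where "g = (SOME g. g \<in> borel_measurable borel \<and> (\<forall>z. z \<notin> {0..1} \<times> {0..1} \<longrightarrow> g z = 0) \<and>
     (AE z in lborel. z \<in> {0..1} \<times> {0..1} \<longrightarrow> (case z of (x, y) \<Rightarrow> W x y) = g z))"
  from borel_representative[OF W_meas S]
  have "\<exists>g. g \<in> borel_measurable borel \<and> (\<forall>z. z \<notin> {0..1} \<times> {0..1} \<longrightarrow> g z = 0) \<and>
     (AE z in lborel. z \<in> {0..1} \<times> {0..1} \<longrightarrow> (case z of (x, y) \<Rightarrow> W x y) = g z)" by blast
  from someI_ex[OF this] have g: "g \<in> borel_measurable borel"
    "AE z in lborel. z \<in> {0..1} \<times> {0..1} \<longrightarrow> W (fst z) (snd z) = g z"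
    unfolding g_def[symmetric] by (simp_all add: case_prod_beta')
  have w: "w x y = max (- 1) (min 1 (g (x, y)))" for x y by (simp add: w_def g_def)
  show "(\<lambda>z. w (fst z) (snd z)) \<in> borel_measurable borel" unfolding w using g(1) by simp
  show "\<bar>w x y\<bar> \<le> 1" by (auto simp: w)
  show "AE z in lborel. z \<in> {0..1} \<times> {0..1} \<longrightarrow> W (fst z) (snd z) = w (fst z) (snd z)"
    using g(2)
  proof eventually_elim
    case (elim z)
    show ?case
    proof
      assume z: "z \<in> {0..1} \<times> {0..1}"
      then have "\<bar>W (fst z) (snd z)\<bar> \<le> 1" using W_bound by (cases z) auto
      then show "W (fst z) (snd z) = w (fst z) (snd z)" using elim z unfolding w by (simp add: abs_le_iff)
    qed
  qed
qed

lemma w_measurable [measurable (raw)]: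
  assumes "f \<in> borel_measurable M" "g \<in> borel_measurable M"
  shows "(\<lambda>z. w (f z) (g z)) \<in> borel_measurable M"
proof -
  have "(\<lambda>z. (f z, g z)) \<in> M \<rightarrow>\<^sub>M borel" using measurable_Pair[OF assms] by (simp add: borel_prod)
  from measurable_compose[OF this w_spec(1)] show ?thesis by simp
qed

lemma D_shift: "periodic_lipschitz 1 (\<lambda>u. D (v - u))" "periodic_lipschitz 1 (\<lambda>v. D (v - u))"
proof -
  have "D (v - (u + 2 * pi)) = D (v - u)" for u
    using D_periodic[rule_format, of "v - (u + 2 * pi)"] by (simp add: algebra_simps)
  moreover have "\<bar>D (v - u) - D (v - u')\<bar> \<le> 1 * \<bar>u - u'\<bar>" for u u'
    using D_lipschitz[rule_format, of "v - u" "v - u'"] by (simp add: abs_minus_commute)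
  ultimately show "periodic_lipschitz 1 (\<lambda>u. D (v - u))" by (simp add: periodic_lipschitz_def)
  have "D (v + 2 * pi - u) = D (v - u)" for v
    using D_periodic[rule_format, of "v - u"] by (simp add: algebra_simps)
  moreover have "\<bar>D (v - u) - D (v' - u)\<bar> \<le> 1 * \<bar>v - v'\<bar>" for v v'
    using D_lipschitz[rule_format, of "v - u" "v' - u"] by simp
  ultimately show "periodic_lipschitz 1 (\<lambda>v. D (v - u))" by (simp add: periodic_lipschitz_def)
qed

lemma D_measurable [measurable]: "D \<in> borel_measurable borel"
  using periodic_lipschitz_continuous[OF D_shift(2)[of 0], of UNIV] by (simp add: borel_measurable_continuous_onI)

text \<open>
  The total variation of \<open>\<rho>(t,\<cdot>,\<cdot>)\<close>, possibly infinite at exceptional times.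
\<close>

definition mass :: "real \<Rightarrow> ennreal" where
  "mass t = (\<integral>\<^sup>+y. \<integral>\<^sup>+v. ennreal \<bar>p t v y\<bar> \<partial>lborel \<partial>lborel)"

text \<open>
  The value is \<open>0\<close> at the times of infinite mass, where also \<open>V\<close> is set to \<open>0\<close>.
\<close>

definition R :: "real \<Rightarrow> real" where "R t = enn2real (mass t)"

text \<open>
  At a time of finite mass, almost every layer \<open>y\<close> is integrable; the layers that are not form a null set
  and do not contribute.
\<close>

definition layer_mass :: "real \<Rightarrow> real \<Rightarrow> real" where
  "layer_mass t y = (LINT v|lborel. \<bar>p t v y\<bar>)"

text \<open>
  The force that the oscillators at \<open>y\<close> exert on phase \<open>u\<close>, before weighting by the kernel.
\<close>

definition force :: "real \<Rightarrow> real \<Rightarrow> real \<Rightarrow> real" where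
  "force t u y = (LINT v|lborel. D (v - u) * p t v y)"

text \<open>
  A version of \<open>velocity\<close> that is Borel measurable and satisfies its bounds at all times; the two agree
  almost everywhere by \<open>velocity_eq_V\<close>.
\<close>

definition V :: "real \<Rightarrow> real \<Rightarrow> real \<Rightarrow> real" where
  "V t u x = (if mass t < \<infinity> then LINT y|lborel. w x y * force t u y else 0)"

lemma mass_measurable [measurable]: "mass \<in> borel_measurable borel"
  unfolding mass_def by measurable

lemma R_measurable [measurable]: "R \<in> borel_measurable borel"
  unfolding R_def by measurable

lemma force_measurable [measurable (raw)]:
  assumes [measurable]: "f \<in> borel_measurable M" "g \<in> borel_measurable M" "h \<in> borel_measurable M"
  shows "(\<lambda>z. force (f z) (g z) (h z)) \<in> borel_measurable M"
  unfolding force_def by measurable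

lemma V_measurable: "(\<lambda>(t, u). V t u x) \<in> borel_measurable (borel \<Otimes>\<^sub>M borel)"
  unfolding V_def by measurable

lemma mass_total: "(\<integral>\<^sup>+t. mass t \<partial>lborel) < \<infinity>"
proof -
  have "(\<integral>\<^sup>+t. mass t \<partial>lborel) = (\<integral>\<^sup>+t. \<integral>\<^sup>+u. \<integral>\<^sup>+x. ennreal \<bar>p t u x\<bar> \<partial>lborel \<partial>lborel \<partial>lborel)"
    unfolding mass_def by (intro nn_integral_cong lborel_pair.Fubini') measurable
  also have "\<dots> = (\<integral>\<^sup>+t. \<integral>\<^sup>+y. ennreal \<bar>p t (fst y) (snd y)\<bar> \<partial>lborel \<partial>lborel)"
    by (intro nn_integral_cong, subst lborel_prod[symmetric], subst lborel.nn_integral_fst[symmetric]) auto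
  also have "\<dots> = (\<integral>\<^sup>+z. ennreal \<bar>p (fst z) (fst (snd z)) (snd (snd z))\<bar> \<partial>lborel)"
    using borel_measurable_abs[OF p_spec(1)]
    by (subst (2) lborel_prod[symmetric], subst lborel.nn_integral_fst[symmetric])
      (auto simp: lborel_prod borel_prod)
  also have "\<dots> < \<infinity>" using p_integrable by (simp add: integrable_iff_bounded)
  finally show ?thesis .
qed

lemma mass_finite_AE: "AE t in lborel. mass t < \<infinity>"
  using nn_integral_PInf_AE[of mass lborel] mass_total by (auto simp: less_top)

lemma R_integrable: "integrable lborel R"
proof (rule integrableI_bounded)
  have "(\<integral>\<^sup>+t. ennreal (norm (R t)) \<partial>lborel) \<le> (\<integral>\<^sup>+t. mass t \<partial>lborel)"
    unfolding R_def by (intro nn_integral_mono) (simp add: enn2real_le less_top[symmetric] ennreal_enn2real_if)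
  then show "(\<integral>\<^sup>+t. ennreal (norm (R t)) \<partial>lborel) < \<infinity>" using mass_total by (rule order_le_less_trans)
qed measurable

lemma layer_mass:
  assumes "mass t < \<infinity>"
  shows "AE y in lborel. integrable lborel (\<lambda>v. p t v y)"
    and "integrable lborel (layer_mass t)" and "(LINT y|lborel. layer_mass t y) = R t"
proof -
  have fin: "AE y in lborel. (\<integral>\<^sup>+v. ennreal \<bar>p t v y\<bar> \<partial>lborel) < \<infinity>"
    using assms nn_integral_PInf_AE[of "\<lambda>y. \<integral>\<^sup>+v. ennreal \<bar>p t v y\<bar> \<partial>lborel" lborel]
    by (auto simp: less_top mass_def)
  then show 1: "AE y in lborel. integrable lborel (\<lambda>v. p t v y)"
    by eventually_elim (auto simp: integrable_iff_bounded)
  have m: "layer_mass t \<in> borel_measurable lborel" unfolding layer_mass_def by measurable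
  have eq: "AE y in lborel. ennreal (layer_mass t y) = (\<integral>\<^sup>+v. ennreal \<bar>p t v y\<bar> \<partial>lborel)"
    using 1 by eventually_elim (simp add: layer_mass_def nn_integral_eq_integral)
  then have nn: "(\<integral>\<^sup>+y. ennreal (layer_mass t y) \<partial>lborel) = mass t"
    unfolding mass_def by (rule nn_integral_cong_AE)
  have pos: "0 \<le> layer_mass t y" for y by (simp add: layer_mass_def)
  show "integrable lborel (layer_mass t)"
    using m pos nn assms by (simp add: integrable_iff_bounded)
  show "(LINT y|lborel. layer_mass t y) = R t"
    using m pos nn by (simp add: R_def integral_eq_nn_integral)
qed

lemma force_bound:
  assumes "integrable lborel (\<lambda>v. p t v y)"
  shows "\<bar>force t u y\<bar> \<le> layer_mass t y" "\<bar>force t u y - force t u' y\<bar> \<le> \<bar>u - u'\<bar> * layer_mass t y"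
proof -
  have i: "integrable lborel (\<lambda>v. D (v - u) * p t v y)" for u
    using integrable_mult_bounded[OF assms, of "\<lambda>v. D (v - u)" 1] D_bound by (simp add: mult.commute)
  have a: "integrable lborel (\<lambda>v. \<bar>p t v y\<bar>)" using assms by simp
  have "norm (force t u y) \<le> (LINT v|lborel. \<bar>p t v y\<bar>)"
    unfolding force_def using i a D_bound
    by (intro Bochner_Integration.integral_norm_bound_integral) (auto simp: abs_mult mult_left_le_one_le)
  then show "\<bar>force t u y\<bar> \<le> layer_mass t y" by (simp add: layer_mass_def)
  have eq: "force t u y - force t u' y = (LINT v|lborel. D (v - u) * p t v y - D (v - u') * p t v y)"
    unfolding force_def using i by simp
  have "norm (force t u y - force t u' y) \<le> (LINT v|lborel. \<bar>u - u'\<bar> * \<bar>p t v y\<bar>)"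
    unfolding eq
  proof (rule Bochner_Integration.integral_norm_bound_integral)
    fix v
    have "\<bar>D (v - u) - D (v - u')\<bar> \<le> \<bar>u - u'\<bar>"
      using D_lipschitz[rule_format, of "v - u" "v - u'"] by (simp add: abs_minus_commute)
    then show "norm (D (v - u) * p t v y - D (v - u') * p t v y) \<le> \<bar>u - u'\<bar> * \<bar>p t v y\<bar>"
      by (simp add: left_diff_distrib[symmetric] abs_mult mult_right_mono)
  next
    show "integrable lborel (\<lambda>v. D (v - u) * p t v y - D (v - u') * p t v y)"
      by (intro Bochner_Integration.integrable_diff i)
    show "integrable lborel (\<lambda>v. \<bar>u - u'\<bar> * \<bar>p t v y\<bar>)" by (intro integrable_mult_right a)
  qed
  then show "\<bar>force t u y - force t u' y\<bar> \<le> \<bar>u - u'\<bar> * layer_mass t y"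
    unfolding layer_mass_def real_norm_def integral_mult_right_zero .
qed

lemma w_force_integrable:
  assumes t: "mass t < \<infinity>"
  shows "integrable lborel (\<lambda>y. w x y * force t u y)"
proof (rule Bochner_Integration.integrable_bound[OF layer_mass(2)[OF t]])
  show "AE y in lborel. norm (w x y * force t u y) \<le> norm (layer_mass t y)"
    using layer_mass(1)[OF t]
  proof eventually_elim
    case (elim y)
    have "\<bar>w x y\<bar> * \<bar>force t u y\<bar> \<le> 1 * layer_mass t y"
      using force_bound(1)[OF elim] w_spec(2) by (intro mult_mono) auto
    then show ?case by (simp add: abs_mult)
  qed
qed measurable

lemma R_nonneg: "0 \<le> R t" by (simp add: R_def)

lemma V_bound: "\<bar>V t u x\<bar> \<le> R t"
proof (cases "mass t < \<infinity>")
  case True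
  have "norm (LINT y|lborel. w x y * force t u y) \<le> (LINT y|lborel. layer_mass t y)"
  proof (rule integral_norm_bound_integral_AE)
    show "AE y in lborel. norm (w x y * force t u y) \<le> layer_mass t y"
      using layer_mass(1)[OF True]
    proof eventually_elim
      case (elim y)
      have "\<bar>w x y\<bar> * \<bar>force t u y\<bar> \<le> 1 * layer_mass t y"
        using force_bound(1)[OF elim] w_spec(2) by (intro mult_mono) auto
      then show ?case by (simp add: abs_mult)
    qed
  qed (use w_force_integrable[OF True] layer_mass(2)[OF True] in auto)
  then show ?thesis using layer_mass(3)[OF True] True by (simp add: V_def)
qed (simp add: V_def R_nonneg)

lemma V_lipschitz: "periodic_lipschitz (R t) (\<lambda>u. V t u x)"
  unfolding periodic_lipschitz_def
proof (intro conjI allI)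
  fix u u'
  have "force t (u + 2 * pi) y = force t u y" for y
    unfolding force_def using D_shift(1) by (simp add: periodic_lipschitz_def)
  then show "V t (u + 2 * pi) x = V t u x" by (simp add: V_def)
  show "\<bar>V t u x - V t u' x\<bar> \<le> R t * \<bar>u - u'\<bar>"
  proof (cases "mass t < \<infinity>")
    case True
    have eq: "V t u x - V t u' x = (LINT y|lborel. w x y * force t u y - w x y * force t u' y)"
      using True w_force_integrable[OF True] by (simp add: V_def)
    have "norm (V t u x - V t u' x) \<le> (LINT y|lborel. \<bar>u - u'\<bar> * layer_mass t y)"
      unfolding eq
    proof (rule integral_norm_bound_integral_AE)
      show "AE y in lborel. norm (w x y * force t u y - w x y * force t u' y) \<le> \<bar>u - u'\<bar> * layer_mass t y"
        using layer_mass(1)[OF True]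
      proof eventually_elim
        case (elim y)
        have "\<bar>w x y\<bar> * \<bar>force t u y - force t u' y\<bar> \<le> 1 * (\<bar>u - u'\<bar> * layer_mass t y)"
          using force_bound(2)[OF elim] w_spec(2) by (intro mult_mono) auto
        then show ?case by (simp add: right_diff_distrib[symmetric] abs_mult)
      qed
    next
      show "integrable lborel (\<lambda>y. w x y * force t u y - w x y * force t u' y)"
        by (intro Bochner_Integration.integrable_diff w_force_integrable[OF True])
      show "integrable lborel (\<lambda>y. \<bar>u - u'\<bar> * layer_mass t y)"
        by (intro integrable_mult_right layer_mass(2)[OF True])
    qed
    then show ?thesis
      unfolding integral_mult_right_zero layer_mass(3)[OF True] real_norm_def by (simp only: mult.commute)
  qed (simp add: V_def R_nonneg)
qed

text \<open>
  For almost all \<open>x\<close> and \<open>t\<close> the functions \<open>W\<close> and \<open>\<rho>\<close> agree with their representatives at almost all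
  \<open>y\<close> and \<open>v\<close>, and this suffices for both integrals that define \<open>velocity\<close>.
\<close>

lemma velocity_eq_V:
  "AE x in lborel. x \<in> {0..1} \<longrightarrow> (AE t in lborel. t \<in> {0..T} \<longrightarrow> (\<forall>u. velocity W D \<rho> t u x = V t u x))"
proof -
  have "AE x in lborel. AE y in lborel. (x, y) \<in> {0..1} \<times> {0..1} \<longrightarrow> W x y = w x y"
  proof -
    have "AE z in lborel \<Otimes>\<^sub>M lborel. z \<in> {0..1} \<times> {0..1} \<longrightarrow> W (fst z) (snd z) = w (fst z) (snd z)"
      using w_spec(3) by (simp only: lborel_prod)
    from lborel_pair.AE_pair[OF this] show ?thesis by simp
  qed
  moreover have \<rho>p: "AE t in lborel. AE y in lborel. AE v in lborel. (t, v, y) \<in> spacetime \<longrightarrow> \<rho> t v y = p t v y"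
    using AE_lborel_triple(1)[of "\<lambda>t v y. (t, v, y) \<in> spacetime \<longrightarrow> \<rho> t v y = p t v y"] p_spec(3) by simp
  ultimately show ?thesis
  proof eventually_elim
    case (elim x)
    show ?case
    proof
      assume x: "x \<in> {0..1}"
      have Wx: "AE y in lborel. y \<in> {0..1} \<longrightarrow> W x y = w x y" using elim(1) x by simp
      from \<rho>p mass_finite_AE
      show "AE t in lborel. t \<in> {0..T} \<longrightarrow> (\<forall>u. velocity W D \<rho> t u x = V t u x)"
      proof eventually_elim
        case (elim t)
        show ?case
        proof (intro impI allI)
          fix u assume t: "t \<in> {0..T}"
          have p0: "p t v y = 0" if "v \<notin> circ \<or> y \<notin> {0..1}" for v y using that p_spec(2) by auto
          have inner: "AE y in lborel. y \<in> {0..1} \<longrightarrow>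
            (LINT v|lebesgue_on circ. W x y * D (v - u) * \<rho> t v y) = w x y * force t u y"
            using Wx elim(1)
          proof eventually_elim
            case (elim y)
            show ?case
            proof
              assume y: "y \<in> {0..1}"
              have "(LINT v|lebesgue_on circ. W x y * D (v - u) * \<rho> t v y) = (LINT v|lborel. w x y * (D (v - u) * p t v y))"
              proof (rule LINT_lebesgue_on_borel(1))
                show "AE v in lborel. v \<in> circ \<longrightarrow> W x y * D (v - u) * \<rho> t v y = w x y * (D (v - u) * p t v y)"
                  using elim(2) by eventually_elim (use elim(1) y t in auto)
              qed (use p0 in \<open>auto simp: circ_def\<close>)
              then show "(LINT v|lebesgue_on circ. W x y * D (v - u) * \<rho> t v y) = w x y * force t u y"
                by (simp add: force_def)
            qed
          qed
          have "velocity W D \<rho> t u x = (LINT y|lborel. w x y * force t u y)"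
            unfolding velocity_def
            by (rule LINT_lebesgue_on_borel(1)[OF _ _ _ inner]) (auto simp: force_def p0)
          then show "velocity W D \<rho> t u x = V t u x" using elim(2) by (simp add: V_def)
        qed
      qed
    qed
  qed
qed

end

section \<open>Weak solutions consist of probability densities\<close>

lemma LINT_interval_combine_lebesgue:
  fixes f :: "real \<Rightarrow> real"
  assumes "set_integrable lebesgue {a..c} f" "a \<le> b" "b \<le> c"
  shows "(LINT s:{a..c}|lebesgue. f s) = (LINT s:{a..b}|lebesgue. f s) + (LINT s:{b..c}|lebesgue. f s)"
proof -
  have "set_integrable lebesgue {a..b} f" "set_integrable lebesgue {b..c} f"
    using assms by (auto intro: set_integrable_subset)
  then show ?thesis
    using assms by (simp add: set_lebesgue_integral_eq_integral Henstock_Kurzweil_Integration.integral_combine)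
qed

text \<open>
  The smoothing of a Lipschitz function with a prescribed accuracy.
\<close>

lemma periodic_C11_dense:
  assumes g: "periodic_lipschitz L g" and e: "e > 0"
  shows "\<exists>G G' L'. periodic_C11 L L' G G' \<and> (\<forall>u. \<bar>G u - g u\<bar> \<le> e) \<and> (\<forall>u. \<exists>v. G u = g v)"
proof -
  have L: "0 \<le> L" using periodic_lipschitz_nonneg[OF g] .
  define h where "h = e / (L + 1)"
  have h: "h > 0" using e L by (simp add: h_def)
  have Lh: "L * h \<le> e"
  proof -
    have "L * h \<le> (L + 1) * h" using h by (intro mult_right_mono) auto
    also have "\<dots> = e" using L by (simp add: h_def)
    finally show ?thesis .
  qed
  obtain G G' where G: "periodic_C11 L (2 * L / h) G G'" "\<And>u. \<exists>v\<in>{u..u + h}. G u = g v"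
    using periodic_lipschitz_smoothing[OF g h] by blast
  have "\<bar>G u - g u\<bar> \<le> e" for u
  proof -
    obtain v where v: "v \<in> {u..u + h}" "G u = g v" using G(2) by blast
    have "\<bar>g v - g u\<bar> \<le> L * \<bar>v - u\<bar>" using g by (simp add: periodic_lipschitz_def)
    also have "\<dots> \<le> L * h" using v L by (intro mult_left_mono) auto
    finally show ?thesis using v Lh by simp
  qed
  then show ?thesis using G by blast
qed

lemma dist_cis_le: "dist (cis u) (cis v) \<le> \<bar>u - v\<bar>"
proof -
  have "cis u - cis v = cis v * (exp (\<i> * of_real (u - v)) - 1)"
    using cis_mult[of v "u - v"] by (simp only: cis_conv_exp[symmetric]) (simp add: right_diff_distrib)
  then have "dist (cis u) (cis v) = norm (exp (\<i> * of_real (u - v)) - 1)"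
    by (simp add: dist_norm norm_mult)
  also have "\<dots> = 2 * \<bar>sin ((u - v) / 2)\<bar>" by (rule dist_exp_i_1)
  also have "\<dots> \<le> 2 * \<bar>(u - v) / 2\<bar>" by (intro mult_left_mono abs_sin_x_le_abs_x) simp
  finally show ?thesis by simp
qed

lemma cis_inj_on_circ: "inj_on cis circ"
proof (rule inj_onI)
  fix u v assume uv: "u \<in> circ" "v \<in> circ" "cis u = cis v"
  then have "cos u = cos v" "sin u = sin v" by (auto simp: complex_eq_iff)
  then obtain n :: int where n: "u = v + 2 * pi * n" using sin_cos_eq_iff[of u v] by auto
  have "\<bar>u - v\<bar> < 2 * pi" using uv by (auto simp: circ_def)
  then have "2 * pi * \<bar>real_of_int n\<bar> < 2 * pi * 1" using n by (simp add: abs_mult)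
  then have "\<bar>real_of_int n\<bar> < 1" using pi_gt_zero by (simp only: mult_less_cancel_left_pos mult_pos_pos zero_less_numeral)
  then show "u = v" using n by simp
qed

text \<open>
  Approximates the indicator of \<open>C\<close> from above by periodic Lipschitz functions; the distance is taken in the
  plane, where periodicity is automatic.
\<close>

definition bump :: "real set \<Rightarrow> nat \<Rightarrow> real \<Rightarrow> real" where
  "bump C k u = max 0 (1 - real k * infdist (cis u) (cis ` C))"

lemma bump_lipschitz: "periodic_lipschitz (real k) (bump C k)"
  unfolding periodic_lipschitz_def
proof (intro conjI allI)
  fix u v
  show "bump C k (u + 2 * pi) = bump C k u" by (simp add: bump_def cis.code)
  have "\<bar>infdist (cis u) (cis ` C) - infdist (cis v) (cis ` C)\<bar> \<le> \<bar>u - v\<bar>"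
    using infdist_triangle_abs[of "cis u" "cis ` C" "cis v"] dist_cis_le[of u v] by linarith
  then have "\<bar>real k * infdist (cis u) (cis ` C) - real k * infdist (cis v) (cis ` C)\<bar> \<le> real k * \<bar>u - v\<bar>"
    by (simp add: right_diff_distrib[symmetric] abs_mult mult_left_mono)
  then show "\<bar>bump C k u - bump C k v\<bar> \<le> real k * \<bar>u - v\<bar>" unfolding bump_def by linarith
qed

lemma bump_range: "0 \<le> bump C k u" "bump C k u \<le> 1"
  by (auto simp: bump_def infdist_nonneg)

lemma bump_tendsto:
  assumes C: "compact C" "C \<noteq> {}" "C \<subseteq> circ" and u: "u \<in> circ"
  shows "(\<lambda>k. bump C k u) \<longlonglongrightarrow> indicator C u"
proof (cases "u \<in> C")
  case True
  then show ?thesis by (simp add: bump_def)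
next
  case False
  have "compact (cis ` C)" using C(1) by (intro compact_continuous_image continuous_intros)
  then have cl: "closed (cis ` C)" by (rule compact_imp_closed)
  have "cis u \<notin> cis ` C" using False u C(3) cis_inj_on_circ by (auto dest: inj_onD)
  then have d: "infdist (cis u) (cis ` C) > 0"
    using in_closed_iff_infdist_zero[OF cl, of "cis u"] C(2) infdist_nonneg[of "cis u" "cis ` C"] by auto
  obtain k0 :: nat where k0: "real k0 > 1 / infdist (cis u) (cis ` C)" using reals_Archimedean2 by blast
  have "bump C k u = indicator C u" if "k \<ge> k0" for k
  proof -
    have "1 / infdist (cis u) (cis ` C) < real k" using k0 that by linarith
    then have "1 < real k * infdist (cis u) (cis ` C)" using d by (simp add: field_simps)
    then show ?thesis using False by (simp add: bump_def)
  qed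
  then show ?thesis by (intro tendsto_eventually) (auto simp: eventually_sequentially)
qed

text \<open>
  Every compact subset \<open>C\<close> of \<open>{q < 0}\<close> is null, because the integral of \<open>q\<close> over \<open>C\<close> is a limit of integrals
  against bumps and hence nonnegative.  Inner regularity of Lebesgue measure does the rest.
\<close>

theorem nonneg_if_nonneg_on_lipschitz:
  assumes q: "integrable (lebesgue_on circ) q"
    and nn: "\<And>f L. periodic_lipschitz L f \<Longrightarrow> (\<And>u. 0 \<le> f u) \<Longrightarrow> 0 \<le> (LINT u|lebesgue_on circ. q u * f u)"
  shows "AE u in lebesgue_on circ. 0 \<le> q u"
proof -
  have circL: "circ \<in> sets lebesgue" by (simp add: circ_def)
  define A where "A = {u \<in> circ. q u < 0}"
  have A: "A \<in> sets lebesgue"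
  proof -
    have "q \<in> borel_measurable (lebesgue_on circ)" using q by simp
    then have "{u \<in> space (lebesgue_on circ). q u < 0} \<in> sets (lebesgue_on circ)" by measurable
    then show ?thesis using circL by (auto simp: A_def space_restrict_space sets_restrict_space_iff)
  qed
  have null: "emeasure lebesgue C = 0" if C: "closed C" "C \<subseteq> A" for C
  proof (cases "C = {}")
    case False
    have Cc: "C \<subseteq> circ" using C by (auto simp: A_def)
    have "bounded circ" by (rule bounded_subset[OF bounded_closed_interval[of 0 "2 * pi"]]) (auto simp: circ_def)
    then have "bounded C" using Cc by (rule bounded_subset)
    then have K: "compact C" using C(1) compact_eq_bounded_closed by blast
    have CL: "C \<in> sets lebesgue" using C(1) by simp
    have indm: "indicator C \<in> borel_measurable (lebesgue_on circ)"
      using CL by (intro measurable_restrict_space1 borel_measurable_indicator)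
    have qI: "integrable (lebesgue_on circ) (\<lambda>u. q u * indicator C u)"
      by (rule integrable_mult_bounded[OF q indm, of 1]) (simp add: indicator_def)
    have "(\<lambda>k. LINT u|lebesgue_on circ. q u * bump C k u) \<longlonglongrightarrow> (LINT u|lebesgue_on circ. q u * indicator C u)"
    proof (rule integral_dominated_convergence[where w = "\<lambda>u. \<bar>q u\<bar>"])
      show "(\<lambda>u. q u * indicator C u) \<in> borel_measurable (lebesgue_on circ)" using qI by simp
      show "(\<lambda>u. q u * bump C k u) \<in> borel_measurable (lebesgue_on circ)" for k
        using integrable_mult_circ_continuous[OF q periodic_lipschitz_circ_continuous[OF bump_lipschitz]] by simp
      show "integrable (lebesgue_on circ) (\<lambda>u. \<bar>q u\<bar>)" using q by simp
      show "AE u in lebesgue_on circ. (\<lambda>k. q u * bump C k u) \<longlonglongrightarrow> q u * indicator C u"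
        using bump_tendsto[OF K False Cc] by (intro AE_I2 tendsto_intros) (simp add: space_restrict_space)
      show "AE u in lebesgue_on circ. norm (q u * bump C k u) \<le> \<bar>q u\<bar>" for k
        using bump_range[of C k] by (intro AE_I2) (simp add: abs_mult mult_left_le)
    qed
    then have ge: "0 \<le> (LINT u|lebesgue_on circ. q u * indicator C u)"
      by (rule LIMSEQ_le_const) (auto intro!: nn[OF bump_lipschitz] bump_range)
    have le: "q u * indicator C u \<le> 0" for u using C(2) by (auto simp: A_def indicator_def)
    have "(LINT u|lebesgue_on circ. - (q u * indicator C u)) = 0"
    proof -
      have "0 \<le> (LINT u|lebesgue_on circ. - (q u * indicator C u))" using le by (intro integral_nonneg_AE AE_I2) simp
      then show ?thesis using ge by simp
    qed
    then have "AE u in lebesgue_on circ. - (q u * indicator C u) = 0"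
      using qI le by (subst (asm) integral_nonneg_eq_0_iff_AE) auto
    then have "AE u in lebesgue_on circ. u \<notin> C"
    proof eventually_elim
      case (elim u)
      then show ?case using C(2) by (auto simp: A_def indicator_def)
    qed
    then have "AE u in lebesgue. u \<in> circ \<longrightarrow> u \<notin> C" using circL by (subst (asm) AE_restrict_space_iff) auto
    then have "AE u in lebesgue. u \<notin> C" by eventually_elim (use Cc in auto)
    then show ?thesis using CL by (subst (asm) AE_iff_measurable[where N = C]) auto
  qed simp
  have "emeasure lebesgue A \<le> ennreal e" if e: "e > 0" for e :: real
  proof -
    obtain C where C: "closed C" "C \<subseteq> A" "A - C \<in> lmeasurable" "emeasure lebesgue (A - C) < ennreal e"
      using sets_lebesgue_inner_closed[OF A e] by blast
    have "A = C \<union> (A - C)" using C by auto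
    then have "emeasure lebesgue A \<le> emeasure lebesgue C + emeasure lebesgue (A - C)"
      using C A emeasure_subadditive[of C lebesgue "A - C"] by auto
    then show ?thesis using null[OF C(1,2)] C(4) by simp
  qed
  then have "emeasure lebesgue A = 0"
    by (metis ennreal_0 ennreal_le_epsilon le_zero_eq add.left_neutral)
  then have "A \<in> null_sets lebesgue" using A by auto
  then have "AE u in lebesgue. u \<notin> A" by (rule AE_not_in)
  then have "AE u in lebesgue. u \<in> circ \<longrightarrow> 0 \<le> q u" by eventually_elim (auto simp: A_def)
  then show ?thesis using circL by (subst AE_restrict_space_iff) auto
qed

context mean_field
begin

text \<open>
  The expectation of the observable \<open>g\<close> at time \<open>t\<close> and position \<open>x\<close>.
\<close>

definition obs :: "real \<Rightarrow> real \<Rightarrow> (real \<Rightarrow> real) \<Rightarrow> real" where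
  "obs x t g = (LINT u|lebesgue_on circ. \<rho> t u x * g u)"

text \<open>
  The positions at which the weak formulation, with the version \<open>V\<close> of the velocity, and all measurability
  properties are available simultaneously.
\<close>

definition good :: "real \<Rightarrow> bool" where
  "good x \<longleftrightarrow> x \<in> {0..1} \<and> (\<forall>t\<in>{0..T}. integrable (lebesgue_on circ) (\<lambda>u. \<rho> t u x)) \<and>
    (\<forall>f. circ_continuous f \<longrightarrow> continuous_on {0..T} (\<lambda>t. LINT u|lebesgue_on circ. \<rho> t u x * f u)) \<and>
    (\<forall>w wt wu. test_function T w wt wu \<longrightarrow>
      (LINT t|lebesgue_on {0..T}. LINT u|lebesgue_on circ.
         \<rho> t u x * (wt t u + velocity W D \<rho> t u x * wu t u))
      + (LINT u|lebesgue_on circ. w 0 u * \<rho>0 u x) = 0) \<and>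
    (AE t in lborel. t \<in> {0..T} \<longrightarrow> (\<forall>u. velocity W D \<rho> t u x = V t u x)) \<and>
    (AE t in lborel. AE u in lborel. (t, u, x) \<in> spacetime \<longrightarrow> \<rho> t u x = p t u x)"

lemma good_AE: "AE x in lborel. x \<in> {0..1} \<longrightarrow> good x"
proof -
  have "AE x in lebesgue_on {0..1}. 
        (\<forall>t\<in>{0..T}. integrable (lebesgue_on circ) (\<lambda>u. \<rho> t u x)) \<and>
        (\<forall>f. circ_continuous f \<longrightarrow>
           continuous_on {0..T} (\<lambda>t. LINT u|lebesgue_on circ. \<rho> t u x * f u)) \<and>
        (\<forall>w wt wu. test_function T w wt wu \<longrightarrow>
           (LINT t|lebesgue_on {0..T}. LINT u|lebesgue_on circ.
              \<rho> t u x * (wt t u + velocity W D \<rho> t u x * wu t u))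
           + (LINT u|lebesgue_on circ. w 0 u * \<rho>0 u x) = 0)"
    using \<rho>_solution unfolding weak_solution_def by blast
  then have "AE x in lborel. x \<in> {0..1} \<longrightarrow>
        (\<forall>t\<in>{0..T}. integrable (lebesgue_on circ) (\<lambda>u. \<rho> t u x)) \<and>
        (\<forall>f. circ_continuous f \<longrightarrow>
           continuous_on {0..T} (\<lambda>t. LINT u|lebesgue_on circ. \<rho> t u x * f u)) \<and>
        (\<forall>w wt wu. test_function T w wt wu \<longrightarrow>
           (LINT t|lebesgue_on {0..T}. LINT u|lebesgue_on circ.
              \<rho> t u x * (wt t u + velocity W D \<rho> t u x * wu t u))
           + (LINT u|lebesgue_on circ. w 0 u * \<rho>0 u x) = 0)"
    by (subst (asm) AE_restrict_space_iff) (simp_all add: AE_completion_iff)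
  moreover have "AE x in lborel. AE t in lborel. AE u in lborel. (t, u, x) \<in> spacetime \<longrightarrow> \<rho> t u x = p t u x"
    using AE_lborel_triple(2)[of "\<lambda>t u x. (t, u, x) \<in> spacetime \<longrightarrow> \<rho> t u x = p t u x"] p_spec(3) by simp
  ultimately show ?thesis
    using velocity_eq_V
  proof eventually_elim
    case (elim x)
    then show ?case unfolding good_def by blast
  qed
qed

lemma goodD:
  assumes "good x"
  shows "x \<in> {0..1}" "t \<in> {0..T} \<Longrightarrow> integrable (lebesgue_on circ) (\<lambda>u. \<rho> t u x)"
    "circ_continuous f \<Longrightarrow> continuous_on {0..T} (\<lambda>t. LINT u|lebesgue_on circ. \<rho> t u x * f u)"
    "test_function T \<phi> wt wu \<Longrightarrow>
      (LINT t|lebesgue_on {0..T}. LINT u|lebesgue_on circ.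
         \<rho> t u x * (wt t u + velocity W D \<rho> t u x * wu t u))
      + (LINT u|lebesgue_on circ. \<phi> 0 u * \<rho>0 u x) = 0"
    "AE t in lborel. t \<in> {0..T} \<longrightarrow> (\<forall>u. velocity W D \<rho> t u x = V t u x)"
    "AE t in lborel. AE u in lborel. (t, u, x) \<in> spacetime \<longrightarrow> \<rho> t u x = p t u x"
  using assms unfolding good_def by blast+

text \<open>
  Measurability in time comes from the Borel representative of \<open>\<rho>\<close>, integrability from the bounds on
  the pairing and on the field.
\<close>

lemma flux_integrable:
  assumes x: "good x" and vf: "velocity_field T R' V'"
    and B: "\<And>s g c. s \<in> {0..T} \<Longrightarrow> circ_continuous g \<Longrightarrow> (\<And>u. \<bar>g u\<bar> \<le> c) \<Longrightarrow>
      \<bar>LINT u|lebesgue_on circ. \<rho> s u x * g u\<bar> \<le> B * c"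
    and g: "periodic_C11 L L' g g'"
  shows "set_integrable lebesgue {0..T} (\<lambda>s. LINT u|lebesgue_on circ. \<rho> s u x * (V' s u * g' u))"
proof -
  interpret velocity_field T R' V' by fact
  define F where "F = (\<lambda>s. LINT u|lebesgue_on circ. \<rho> s u x * (V' s u * g' u))"
  define G where "G = (\<lambda>s. LINT u|lborel. p s u x * (V' s u * g' u))"
  have g'c: "circ_continuous g'"
    using g periodic_C11_deriv_lipschitz periodic_lipschitz_circ_continuous by blast
  have g'm [measurable]: "g' \<in> borel_measurable borel" by (rule circ_continuous_measurable[OF g'c])
  have V'm [measurable]: "(\<lambda>(s, u). V' s u) \<in> borel_measurable (borel \<Otimes>\<^sub>M borel)" by (rule V_measurable)
  have Gm: "G \<in> borel_measurable borel" unfolding G_def by measurable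
  have ae: "AE s in lborel. s \<in> {0..T} \<longrightarrow> F s = G s"
    using goodD(6)[OF x]
  proof eventually_elim
    case (elim s)
    show ?case
    proof
      assume s: "s \<in> {0..T}"
      show "F s = G s" unfolding F_def G_def
      proof (rule LINT_lebesgue_on_borel(1))
        show "(\<lambda>u. p s u x * (V' s u * g' u)) \<in> borel_measurable borel"
          using measurable_compose[OF measurable_Pair1'[of s borel borel] V'm] by simp
        show "p s u x * (V' s u * g' u) = 0" if "u \<notin> circ" for u using p_spec(2) that by simp
        show "AE u in lborel. u \<in> circ \<longrightarrow> \<rho> s u x * (V' s u * g' u) = p s u x * (V' s u * g' u)"
          using elim by eventually_elim (use s goodD(1)[OF x] in auto)
      qed (simp add: circ_def)
    qed
  qed
  have T_L: "{0..T} \<in> sets lebesgue" by simp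
  have GL: "G \<in> borel_measurable (lebesgue_on {0..T})"
    using Gm by (intro measurable_restrict_space1 measurable_completion) simp
  have "AE s in lebesgue_on {0..T}. F s = G s"
    using AE_completion[OF ae] by (subst AE_restrict_space_iff) auto
  then have Fm: "F \<in> borel_measurable (lebesgue_on {0..T})"
    by (rule lebesgue_on_cong_AE(1)[OF T_L GL])
  have R1: "integrable (lebesgue_on {0..T}) (\<lambda>s. B * (R' s * L))"
    using set_integrable_lebesgue(1)[OF R_integrable] by (simp add: LINT_lebesgue_on_eq(2))
  have "integrable (lebesgue_on {0..T}) F"
  proof (rule Bochner_Integration.integrable_bound[OF R1 Fm], rule AE_I2)
    fix s assume "s \<in> space (lebesgue_on {0..T})"
    then have s: "s \<in> {0..T}" by (simp add: space_restrict_space)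
    have "\<bar>V' s u * g' u\<bar> \<le> R' s * L" for u
      unfolding abs_mult using V_bound[OF s] g R_nonneg[OF s] by (intro mult_mono) (auto simp: periodic_C11_def)
    then have "\<bar>F s\<bar> \<le> B * (R' s * L)"
      unfolding F_def
      by (intro B s circ_continuous_mult periodic_lipschitz_circ_continuous[OF V_lipschitz[OF s]] g'c)
    then show "norm (F s) \<le> norm (B * (R' s * L))" by simp
  qed
  then show ?thesis by (simp add: F_def LINT_lebesgue_on_eq(2))
qed

lemma good_evolution:
  assumes x: "good x" and vf: "velocity_field T R' V'"
    and V': "AE t in lborel. t \<in> {0..T} \<longrightarrow> (\<forall>u. V t u x = V' t u)"
    and B: "\<And>s g c. s \<in> {0..T} \<Longrightarrow> circ_continuous g \<Longrightarrow> (\<And>u. \<bar>g u\<bar> \<le> c) \<Longrightarrow>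
      \<bar>LINT u|lebesgue_on circ. \<rho> s u x * g u\<bar> \<le> B * c"
    and g: "periodic_C11 L L' g g'" and b: "b \<in> {0..T}"
  shows "(LINT u|lebesgue_on circ. \<rho> b u x * g u) = (LINT u|lebesgue_on circ. g u * \<rho>0 u x)
    + (LINT s:{0..b}|lebesgue. LINT u|lebesgue_on circ. \<rho> s u x * (V' s u * g' u))"
proof -
  interpret velocity_field T R' V' by fact
  have "AE t in lborel. t \<in> {0..T} \<longrightarrow> (\<forall>u. velocity W D \<rho> t u x = V' t u)"
    using V' goodD(5)[OF x] by eventually_elim auto
  then have ae: "AE t in lebesgue_on {0..T}. \<forall>u. velocity W D \<rho> t u x = V' t u"
    by (subst AE_restrict_space_iff) (auto intro: AE_completion)
  show ?thesis
  proof (rule weak_form_evolution[where vel = "\<lambda>t u. velocity W D \<rho> t u x" and T = T, OF T_pos _ _ _ ae _ g _ b])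
    show "set_integrable lebesgue {0..T} (\<lambda>s. LINT u|lebesgue_on circ. \<rho> s u x * (V' s u * g' u))"
      by (rule flux_integrable[OF x vf B g])
    show "circ_continuous (V' s)" if "s \<in> {0..T}" for s
      using V_lipschitz[OF that] by (rule periodic_lipschitz_circ_continuous)
  qed (use goodD[OF x] in blast)+
qed

text \<open>
  At a good position the weak solution is transported by every field that agrees with \<open>V\<close> at almost
  all times; this freedom is used to pass from \<open>V\<close> to \<open>drift\<close>.
\<close>

lemma good_transported:
  assumes x: "good x" and vf: "velocity_field T R' V'"
    and V': "AE t in lborel. t \<in> {0..T} \<longrightarrow> (\<forall>u. V t u x = V' t u)"
    and B: "\<And>s g c. s \<in> {0..T} \<Longrightarrow> circ_continuous g \<Longrightarrow> (\<And>u. \<bar>g u\<bar> \<le> c) \<Longrightarrow>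
      \<bar>LINT u|lebesgue_on circ. \<rho> s u x * g u\<bar> \<le> B * c"
  shows "transported_curve T R' V' (\<lambda>s u. \<rho> s u x) B"
proof -
  interpret velocity_field T R' V' by fact
  show ?thesis
  proof unfold_locales
    fix a b L L' g g' assume ab: "0 \<le> a" "a \<le> b" "b \<le> T" and g: "periodic_C11 L L' g g'"
    have I: "set_integrable lebesgue {0..b} (\<lambda>s. LINT u|lebesgue_on circ. \<rho> s u x * (V' s u * g' u))"
      using flux_integrable[OF x vf B g] by (rule set_integrable_subset) (use ab in auto)
    show "(LINT u|lebesgue_on circ. \<rho> b u x * g u) - (LINT u|lebesgue_on circ. \<rho> a u x * g u)
      = (LINT s:{a..b}|lebesgue. LINT u|lebesgue_on circ. \<rho> s u x * (V' s u * g' u))"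
    proof -
      have "(LINT u|lebesgue_on circ. \<rho> c u x * g u) = (LINT u|lebesgue_on circ. g u * \<rho>0 u x)
        + (LINT s:{0..c}|lebesgue. LINT u|lebesgue_on circ. \<rho> s u x * (V' s u * g' u))" if "c \<in> {0..T}" for c
        by (rule good_evolution[OF x vf V' B g that])
      from this[of a] this[of b] show ?thesis
        unfolding LINT_interval_combine_lebesgue[OF I ab(1,2)] using ab by simp
    qed
  qed (use goodD(2)[OF x] B flux_integrable[OF x vf B] in blast)+
qed

lemma field_V: "velocity_field T R (\<lambda>t u. V t u x)"
proof
  show "set_integrable lborel {0..T} R" 
    using integrable_mult_indicator[OF _ R_integrable, of "{0..T}"] by (simp add: set_integrable_def)
qed (use T_pos V_measurable V_bound V_lipschitz in auto)

text \<open>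
  The evolution at \<open>b = 0\<close> for smooth functions, and approximation for Lipschitz functions.
\<close>

lemma good_initial:
  assumes x: "good x" and g: "periodic_lipschitz L g"
  shows "obs x 0 g = (LINT u|lebesgue_on circ. g u * \<rho>0 u x)"
proof -
  have "\<exists>B. \<forall>s\<in>{0..T}. \<forall>g c. circ_continuous g \<longrightarrow> (\<forall>u. \<bar>g u\<bar> \<le> c) \<longrightarrow>
    \<bar>LINT u|lebesgue_on circ. \<rho> s u x * g u\<bar> \<le> B * c"
    using goodD(2,3)[OF x] by (intro weakly_continuous_imp_bounded) auto
  then obtain B where B: "\<And>s g c. s \<in> {0..T} \<Longrightarrow> circ_continuous g \<Longrightarrow> (\<And>u. \<bar>g u\<bar> \<le> c) \<Longrightarrow>
      \<bar>LINT u|lebesgue_on circ. \<rho> s u x * g u\<bar> \<le> B * c" by blast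
  have T0: "0 \<in> {0..T}" using T_pos by simp
  have B0: "0 \<le> B" using B[OF T0, of "\<lambda>_. 0" 1] by (simp add: circ_continuous_def)
  have \<rho>0: "integrable (lebesgue_on circ) (\<lambda>u. \<rho>0 u x)" "AE u in lebesgue_on circ. 0 \<le> \<rho>0 u x"
    "(LINT u|lebesgue_on circ. \<rho>0 u x) = 1"
    using \<rho>0_density goodD(1)[OF x] by auto
  have i0: "integrable (lebesgue_on circ) (\<lambda>u. g u * \<rho>0 u x)" if "circ_continuous g" for g
    using integrable_mult_circ_continuous[OF \<rho>0(1) that] by (simp add: mult.commute)
  have c11: "obs x 0 g = (LINT u|lebesgue_on circ. g u * \<rho>0 u x)" if g: "periodic_C11 L L' g g'" for L L' g g'
  proof -
    have I: "set_integrable lebesgue {0..0} (\<lambda>s. LINT u|lebesgue_on circ. \<rho> s u x * (V s u x * g' u))"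
      using flux_integrable[OF x field_V B g] by (rule set_integrable_subset) (use T_pos in auto)
    have "obs x 0 g = (LINT u|lebesgue_on circ. g u * \<rho>0 u x)
        + (LINT s:{0..0}|lebesgue. LINT u|lebesgue_on circ. \<rho> s u x * (V s u x * g' u))"
      unfolding obs_def by (rule good_evolution[OF x field_V _ B g T0]) simp
    moreover have "(LINT s:{0..0}|lebesgue. LINT u|lebesgue_on circ. \<rho> s u x * (V s u x * g' u)) = 0"
      using LINT_interval_combine_lebesgue[OF I order_refl order_refl] by linarith
    ultimately show ?thesis by simp
  qed
  have "\<bar>obs x 0 g - (LINT u|lebesgue_on circ. g u * \<rho>0 u x)\<bar> \<le> 0 + e" if e: "e > 0" for e
  proof -
    define d where "d = e / (B + 1)"
    have d: "d > 0" using e B0 by (simp add: d_def)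
    obtain G G' L' where G: "periodic_C11 L L' G G'" "\<And>u. \<bar>G u - g u\<bar> \<le> d"
      using periodic_C11_dense[OF g d] by blast
    have cc: "circ_continuous g" "circ_continuous G"
      using g G periodic_C11_lipschitz periodic_lipschitz_circ_continuous by blast+
    have "obs x 0 G - obs x 0 g = (LINT u|lebesgue_on circ. \<rho> 0 u x * (G u - g u))"
      unfolding obs_def using integrable_mult_circ_continuous[OF goodD(2)[OF x T0]] cc by (simp add: right_diff_distrib)
    then have 1: "\<bar>obs x 0 G - obs x 0 g\<bar> \<le> B * d"
      using B[OF T0 circ_continuous_diff[OF cc(2,1)] G(2)] by simp
    have "(LINT u|lebesgue_on circ. G u * \<rho>0 u x) - (LINT u|lebesgue_on circ. g u * \<rho>0 u x)
      = (LINT u|lebesgue_on circ. (G u - g u) * \<rho>0 u x)"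
      using i0 cc by (simp add: left_diff_distrib)
    moreover have "norm (LINT u|lebesgue_on circ. (G u - g u) * \<rho>0 u x) \<le> (LINT u|lebesgue_on circ. d * \<rho>0 u x)"
    proof (rule integral_norm_bound_integral_AE)
      show "AE u in lebesgue_on circ. norm ((G u - g u) * \<rho>0 u x) \<le> d * \<rho>0 u x"
        using \<rho>0(2) by eventually_elim (simp add: abs_mult G(2) mult_right_mono)
    qed (use \<rho>0(1) i0[OF circ_continuous_diff[OF cc(2,1)]] in auto)
    ultimately have 2: "\<bar>(LINT u|lebesgue_on circ. G u * \<rho>0 u x) - (LINT u|lebesgue_on circ. g u * \<rho>0 u x)\<bar> \<le> d"
      using \<rho>0(3) by simp
    have "\<bar>obs x 0 g - (LINT u|lebesgue_on circ. g u * \<rho>0 u x)\<bar> \<le> B * d + d"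
      using 1 2 c11[OF G(1)] by linarith
    also have "\<dots> = (B + 1) * d" by (simp add: distrib_right)
    also have "\<dots> = e" using B0 by (simp add: d_def)
    finally show ?thesis by simp
  qed
  then have "\<bar>obs x 0 g - (LINT u|lebesgue_on circ. g u * \<rho>0 u x)\<bar> \<le> 0" by (rule field_le_epsilon)
  then show ?thesis by simp
qed

text \<open>
  Positivity: by duality the pairing with \<open>f \<ge> 0\<close> at time \<open>t\<close> is close to a pairing of \<open>\<rho>0\<close> with a nonnegative
  function.  Total mass: the constant function \<open>1\<close> has no flux.
\<close>

theorem good_density:
  assumes x: "good x" and t: "t \<in> {0..T}"
  shows "AE u in lebesgue_on circ. 0 \<le> \<rho> t u x" "(LINT u|lebesgue_on circ. \<rho> t u x) = 1"
proof -
  have "\<exists>B. \<forall>s\<in>{0..T}. \<forall>g c. circ_continuous g \<longrightarrow> (\<forall>u. \<bar>g u\<bar> \<le> c) \<longrightarrow>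
    \<bar>LINT u|lebesgue_on circ. \<rho> s u x * g u\<bar> \<le> B * c"
    using goodD(2,3)[OF x] by (intro weakly_continuous_imp_bounded) auto
  then obtain B where B: "\<And>s g c. s \<in> {0..T} \<Longrightarrow> circ_continuous g \<Longrightarrow> (\<And>u. \<bar>g u\<bar> \<le> c) \<Longrightarrow>
      \<bar>LINT u|lebesgue_on circ. \<rho> s u x * g u\<bar> \<le> B * c" by blast
  interpret C: transported_curve T R "\<lambda>t u. V t u x" "\<lambda>t u. \<rho> t u x" B
    by (rule good_transported[OF x field_V _ B]) auto
  have pair: "C.pair s g = obs x s g" for s g by (simp add: C.pair_def obs_def)
  have \<rho>0: "integrable (lebesgue_on circ) (\<lambda>u. \<rho>0 u x)" "AE u in lebesgue_on circ. 0 \<le> \<rho>0 u x"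
    "(LINT u|lebesgue_on circ. \<rho>0 u x) = 1"
    using \<rho>0_density goodD(1)[OF x] by auto
  \<comment> \<open>Positivity is shown for smooth, then for Lipschitz observables.\<close>
  have smooth: "0 \<le> obs x t f" if f: "periodic_C11 L L' f f'" "\<And>u. 0 \<le> f u" for L L' f f'
  proof -
    have "0 \<le> obs x t f + e" if e: "e > 0" for e
    proof -
      obtain g where g: "periodic_lipschitz (L * exp (C.budget t)) g" "\<And>u. \<exists>v. g u = f v"
        "\<bar>obs x t f - obs x 0 g\<bar> \<le> e"
        using C.transport_duality[OF f(1) t e] unfolding pair by blast
      have "0 \<le> g u" for u using g(2)[of u] f(2) by metis
      then have "0 \<le> (LINT u|lebesgue_on circ. g u * \<rho>0 u x)"
        using \<rho>0(2) by (intro integral_nonneg_AE) (auto elim!: eventually_mono)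
      then show ?thesis using g(3) good_initial[OF x g(1)] by linarith
    qed
    then show ?thesis by (rule field_le_epsilon)
  qed
  have lip: "0 \<le> obs x t f" if f: "periodic_lipschitz L f" "\<And>u. 0 \<le> f u" for L f
  proof -
    have "0 \<le> obs x t f + e" if e: "e > 0" for e
    proof -
      define d where "d = e / (B + 1)"
      have d: "d > 0" using e C.B_nonneg by (simp add: d_def)
      have "B * d \<le> (B + 1) * d" using d by (intro mult_right_mono) auto
      then have Bd: "B * d \<le> e" using C.B_nonneg by (simp add: d_def)
      obtain G G' L' where G: "periodic_C11 L L' G G'" "\<And>u. \<bar>G u - f u\<bar> \<le> d" "\<And>u. \<exists>v. G u = f v"
        using periodic_C11_dense[OF f(1) d] by blast
      have "0 \<le> G u" for u using G(3)[of u] f(2) by metis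
      then have "0 \<le> obs x t G" by (rule smooth[OF G(1)])
      moreover have cc: "circ_continuous f" "circ_continuous G"
        using f G periodic_C11_lipschitz periodic_lipschitz_circ_continuous by blast+
      have "\<bar>obs x t G - obs x t f\<bar> \<le> B * d"
        using C.q_bound[OF t circ_continuous_diff[OF cc(2,1)] G(2)] C.pair_diff[OF t cc(2,1)]
        unfolding pair by (simp add: obs_def)
      ultimately show ?thesis using Bd by linarith
    qed
    then show ?thesis by (rule field_le_epsilon)
  qed
  show "AE u in lebesgue_on circ. 0 \<le> \<rho> t u x"
    using lip unfolding obs_def by (rule nonneg_if_nonneg_on_lipschitz[OF goodD(2)[OF x t]])
  have one: "periodic_C11 0 0 (\<lambda>_. 1) (\<lambda>_. 0)" by (simp add: periodic_C11_def)
  have "obs x t (\<lambda>_. 1) - obs x 0 (\<lambda>_. 1) = 0"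
    using C.evolution[OF _ _ _ one, of 0 t] t by (simp add: obs_def)
  then show "(LINT u|lebesgue_on circ. \<rho> t u x) = 1"
    using good_initial[OF x periodic_C11_lipschitz[OF one]] \<rho>0(3) by (simp add: obs_def)
qed

lemma good_bound:
  assumes x: "good x" and t: "t \<in> {0..T}" and g: "circ_continuous g" "\<And>u. \<bar>g u\<bar> \<le> c"
  shows "\<bar>LINT u|lebesgue_on circ. \<rho> t u x * g u\<bar> \<le> 1 * c"
proof -
  have "norm (LINT u|lebesgue_on circ. \<rho> t u x * g u) \<le> (LINT u|lebesgue_on circ. \<rho> t u x * c)"
  proof (rule integral_norm_bound_integral_AE)
    show "AE u in lebesgue_on circ. norm (\<rho> t u x * g u) \<le> \<rho> t u x * c"
      using good_density(1)[OF x t] by eventually_elim (simp add: abs_mult g(2) mult_left_mono)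
  qed (use goodD(2)[OF x t] integrable_mult_circ_continuous[OF goodD(2)[OF x t] g(1)] in auto)
  then show ?thesis using good_density(2)[OF x t] by simp
qed

text \<open>
  The slices at a fixed time, as seen from almost every position.  Since they are probability densities,
  the mass at almost every time is at most \<open>1\<close>.
\<close>

lemma slice_AE:
  "AE t in lborel. t \<in> {0..T} \<longrightarrow> mass t < \<infinity> \<and> R t \<le> 1 \<and>
     (AE y in lborel. y \<in> {0..1} \<longrightarrow> good y \<and> (\<forall>u. force t u y = obs y t (\<lambda>v. D (v - u))))"
proof -
  have "AE t in lborel. AE y in lborel. AE v in lborel. (t, v, y) \<in> spacetime \<longrightarrow> \<rho> t v y = p t v y"
    using AE_lborel_triple(1)[of "\<lambda>t v y. (t, v, y) \<in> spacetime \<longrightarrow> \<rho> t v y = p t v y"] p_spec(3) by simp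
  then show ?thesis using mass_finite_AE
  proof eventually_elim
    case (elim t)
    show ?case
    proof
      assume t: "t \<in> {0..T}"
      have p0: "p t v y = 0" if "v \<notin> circ \<or> y \<notin> {0..1}" for v y using that p_spec(2) by auto
      have G: "AE y in lborel. y \<in> {0..1} \<longrightarrow> good y \<and> layer_mass t y = 1 \<and> (\<forall>u. force t u y = obs y t (\<lambda>v. D (v - u)))"
        using elim(1) good_AE
      proof eventually_elim
        case (elim y)
        show ?case
        proof
          assume y: "y \<in> {0..1}"
          then have gy: "good y" using elim by simp
          have ae: "AE v in lborel. v \<in> circ \<longrightarrow> \<rho> t v y = p t v y"
            using elim(1) by eventually_elim (use t y in auto)
          have "layer_mass t y = (LINT v|lebesgue_on circ. \<bar>\<rho> t v y\<bar>)"
            unfolding layer_mass_def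
          proof (rule LINT_lebesgue_on_borel(1)[symmetric])
            show "AE v in lborel. v \<in> circ \<longrightarrow> \<bar>\<rho> t v y\<bar> = \<bar>p t v y\<bar>" using ae by eventually_elim auto
          qed (use p0 in \<open>auto simp: circ_def\<close>)
          also have "\<dots> = (LINT v|lebesgue_on circ. \<rho> t v y)"
            using good_density(1)[OF gy t] goodD(2)[OF gy t] by (intro integral_cong_AE) auto
          finally have "layer_mass t y = 1" using good_density(2)[OF gy t] by simp
          moreover have "force t u y = obs y t (\<lambda>v. D (v - u))" for u
            unfolding force_def obs_def
          proof (rule LINT_lebesgue_on_borel(1)[symmetric])
            show "AE v in lborel. v \<in> circ \<longrightarrow> \<rho> t v y * D (v - u) = D (v - u) * p t v y" using ae by eventually_elim auto
          qed (use p0 in \<open>auto simp: circ_def\<close>)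
          ultimately show "good y \<and> layer_mass t y = 1 \<and> (\<forall>u. force t u y = obs y t (\<lambda>v. D (v - u)))"
            using gy by blast
        qed
      qed
      have "R t = (LINT y|lborel. layer_mass t y)" using layer_mass(3)[OF elim(2)] by simp
      also have "\<dots> \<le> (LINT y|lborel. indicator {0..1::real} y)"
      proof (rule integral_mono_AE)
        show "integrable lborel (layer_mass t)" by (rule layer_mass(2)[OF elim(2)])
        show "AE y in lborel. layer_mass t y \<le> indicator {0..1} y"
          using G by eventually_elim (auto simp: indicator_def layer_mass_def p0)
      qed simp
      also have "\<dots> = 1" by simp
      finally show "mass t < \<infinity> \<and> R t \<le> 1 \<and>
        (AE y in lborel. y \<in> {0..1} \<longrightarrow> good y \<and> (\<forall>u. force t u y = obs y t (\<lambda>v. D (v - u))))"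
        using elim(2) G by (auto elim: eventually_mono)
    qed
  qed
qed

text \<open>
  The velocity with the bound \<open>1\<close> at all times instead of almost all times.
\<close>

definition drift :: "real \<Rightarrow> real \<Rightarrow> real \<Rightarrow> real" where
  "drift t u x = (if R t \<le> 1 then V t u x else 0)"

lemma field_drift: "velocity_field T (\<lambda>_. 1) (\<lambda>t u. drift t u x)"
proof
  show "(\<lambda>(s, u). drift s u x) \<in> borel_measurable (borel \<Otimes>\<^sub>M borel)"
    unfolding drift_def using V_measurable[of x] by (simp add: case_prod_beta') measurable
  show "\<bar>drift s u x\<bar> \<le> 1" for s u using V_bound[of s u x] by (auto simp: drift_def)
  show "periodic_lipschitz 1 (\<lambda>u. drift s u x)" for s
  proof (cases "R s \<le> 1")
    case True
    then show ?thesis using periodic_lipschitz_mono[OF V_lipschitz[of s x], of 1] by (simp add: drift_def)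
  qed (simp add: drift_def periodic_lipschitz_def)
qed (use T_pos in \<open>auto simp: set_integrable_def\<close>)

text \<open>
  The conclusion of \<open>transport_duality\<close> with \<open>R = 1\<close> and \<open>B = 1\<close>, for observables that are only Lipschitz.
\<close>

lemma good_duality:
  assumes x: "good x" and f: "periodic_lipschitz 1 f" and t: "t \<in> {0..T}" and \<eta>: "\<eta> > 0"
  shows "\<exists>g. periodic_lipschitz (exp T) g \<and> \<bar>obs x t f - obs x 0 g\<bar> \<le> \<eta> \<and>
    (\<forall>\<theta> U. velocity_field.path T \<theta> U \<longrightarrow>
      \<bar>f (\<theta> t) - g (\<theta> 0)\<bar> \<le> exp T * (LINT s:{0..t}|lborel. \<bar>U s - drift s (\<theta> s) x\<bar>) + \<eta>)"
proof -
  have "AE t in lborel. t \<in> {0..T} \<longrightarrow> (\<forall>u. V t u x = drift t u x)"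
    using slice_AE by eventually_elim (auto simp: drift_def)
  then interpret C: transported_curve T "\<lambda>_. 1" "\<lambda>t u. drift t u x" "\<lambda>t u. \<rho> t u x" 1
    by (intro good_transported[OF x field_drift] good_bound[OF x])
  have pair: "C.pair s g = obs x s g" for s g by (simp add: C.pair_def obs_def)
  have budget: "C.budget s = s" if "0 \<le> s" for s
    using that by (simp add: C.budget_def set_lebesgue_integral_def)
  have e3: "\<eta> / 3 > 0" using \<eta> by simp
  obtain F F' L' where F: "periodic_C11 1 L' F F'" "\<And>u. \<bar>F u - f u\<bar> \<le> \<eta> / 3"
    using periodic_C11_dense[OF f e3] by blast
  obtain g where g: "periodic_lipschitz (1 * exp (C.budget t)) g" "\<bar>obs x t F - obs x 0 g\<bar> \<le> \<eta> / 3"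
    "\<And>\<theta> U. C.path \<theta> U \<Longrightarrow> \<bar>F (\<theta> t) - g (\<theta> 0)\<bar> \<le> 1 * exp (C.budget T) * C.slip \<theta> U 0 t + \<eta> / 3"
    using C.transport_duality[OF F(1) t e3] unfolding pair by blast
  have cc: "circ_continuous f" "circ_continuous F"
    using f F periodic_C11_lipschitz periodic_lipschitz_circ_continuous by blast+
  have "\<bar>obs x t F - obs x t f\<bar> \<le> 1 * (\<eta> / 3)"
    using C.q_bound[OF t circ_continuous_diff[OF cc(2,1)] F(2)] C.pair_diff[OF t cc(2,1)]
    unfolding pair by (simp add: obs_def)
  then have 1: "\<bar>obs x t f - obs x 0 g\<bar> \<le> \<eta>" using g(2) \<eta> by linarith
  have 2: "\<bar>f (\<theta> t) - g (\<theta> 0)\<bar> \<le> exp T * (LINT s:{0..t}|lborel. \<bar>U s - drift s (\<theta> s) x\<bar>) + \<eta>"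
    if "C.path \<theta> U" for \<theta> U
  proof -
    have "\<bar>F (\<theta> t) - g (\<theta> 0)\<bar> \<le> exp T * (LINT s:{0..t}|lborel. \<bar>U s - drift s (\<theta> s) x\<bar>) + \<eta> / 3"
      using g(3)[OF that] T_pos by (simp add: budget C.slip_def)
    then show ?thesis using F(2)[of "\<theta> t"] \<eta> by linarith
  qed
  have "periodic_lipschitz (exp T) g"
    by (rule periodic_lipschitz_mono[OF g(1)]) (use t in \<open>simp add: budget\<close>)
  then show ?thesis using 1 2 by blast
qed

end

section \<open>Discretization of the coupling kernel\<close>

lemma cell_eq: "i \<ge> 1 \<Longrightarrow> cell n i = {real (i - 1) / real n..<real i / real n}"
  by (simp add: cell_def of_nat_diff)

lemma cell_subset: "i \<in> {1..n} \<Longrightarrow> cell n i \<subseteq> {0..<1}"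
proof
  fix x assume i: "i \<in> {1..n}" and x: "x \<in> cell n i"
  have "0 \<le> (real i - 1) / real n" "real i / real n \<le> 1" using i by auto
  then show "x \<in> {0..<1}" using x by (auto simp: cell_def)
qed

lemma cell_exists:
  assumes "n \<ge> 1" "x \<in> {0..<1}"
  shows "\<exists>i\<in>{1..n}. x \<in> cell n i"
proof -
  define i where "i = nat \<lfloor>real n * x\<rfloor> + 1"
  have x: "0 \<le> real n * x" "real n * x < real n" using assms by auto
  then have "real i = real_of_int \<lfloor>real n * x\<rfloor> + 1" by (simp add: i_def)
  then have i: "real i - 1 \<le> real n * x" "real n * x < real i" by linarith+
  have "i \<in> {1..n}" using x by (auto simp: i_def) linarith
  moreover have "x \<in> cell n i" using i assms by (simp add: cell_def field_simps)
  ultimately show ?thesis by blast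
qed

lemma cell_floor:
  assumes "n \<ge> 1" "x \<in> cell n i"
  shows "\<lfloor>real n * x\<rfloor> = int i - 1"
proof -
  have "real i - 1 \<le> real n * x" "real n * x < real i" using assms by (auto simp: cell_def field_simps)
  then show ?thesis by linarith
qed

lemma cell_unique: "n \<ge> 1 \<Longrightarrow> x \<in> cell n i \<Longrightarrow> x \<in> cell n j \<Longrightarrow> i = j"
  using cell_floor[of n x i] cell_floor[of n x j] by linarith

lemma set_integrable_bounded:
  fixes f :: "'a::euclidean_space \<Rightarrow> real"
  assumes "f \<in> borel_measurable borel" "\<And>x. \<bar>f x\<bar> \<le> c" "A \<in> sets borel" "emeasure lborel A < \<infinity>"
  shows "set_integrable lborel A f"
proof -
  have "set_integrable lborel A (\<lambda>_. c)" using assms by (simp add: set_integrable_def)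
  then show ?thesis
    unfolding set_integrable_def
  proof (rule Bochner_Integration.integrable_bound)
    have "0 \<le> c" using assms(2) abs_ge_zero order_trans by blast
    then show "AE x in lborel. norm (indicator A x *\<^sub>R f x) \<le> norm (indicator A x *\<^sub>R c)"
      using assms(2) by (intro AE_I2) (auto simp: indicator_def)
  qed (use assms in simp)
qed

lemma set_integrable_sum:
  fixes f :: "'i \<Rightarrow> 'a \<Rightarrow> real"
  assumes "finite I" "\<And>i. i \<in> I \<Longrightarrow> set_integrable M A (f i)"
  shows "set_integrable M A (\<lambda>x. \<Sum>i\<in>I. f i x)"
    and "(LINT x:A|M. \<Sum>i\<in>I. f i x) = (\<Sum>i\<in>I. LINT x:A|M. f i x)"
  unfolding set_integrable_def set_lebesgue_integral_def scaleR_sum_right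
proof -
  show "integrable M (\<lambda>x. \<Sum>i\<in>I. indicat_real A x *\<^sub>R f i x)"
    using assms unfolding set_integrable_def by (intro Bochner_Integration.integrable_sum)
  show "(LINT x|M. (\<Sum>i\<in>I. indicat_real A x *\<^sub>R f i x)) = (\<Sum>i\<in>I. LINT x|M. indicat_real A x *\<^sub>R f i x)"
    using assms unfolding set_integrable_def by (intro Bochner_Integration.integral_sum)
qed

lemma LINT_mesh:
  fixes t :: "nat \<Rightarrow> real" and f :: "real \<Rightarrow> real"
  assumes "\<And>j. t j \<le> t (Suc j)" "set_integrable lborel {t 0..<t p} f"
  shows "(LINT x:{t 0..<t p}|lborel. f x) = (\<Sum>j = 1..p. LINT x:{t (j - 1)..<t j}|lborel. f x)"
  using assms(2)
proof (induction p)
  case 0 then show ?case by (simp add: set_lebesgue_integral_def)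
next
  case (Suc p)
  have m: "t 0 \<le> t p" using lift_Suc_mono_le[of t 0 p] assms(1) by auto
  then have u: "{t 0..<t (Suc p)} = {t 0..<t p} \<union> {t p..<t (Suc p)}" using assms(1)[of p] by auto
  have i: "set_integrable lborel {t 0..<t p} f" "set_integrable lborel {t p..<t (Suc p)} f"
    using Suc.prems m assms(1)[of p] by (auto intro: set_integrable_subset)
  show ?case unfolding u using i Suc.IH by (subst set_integral_Un) auto
qed

text \<open>
  The cells cover \<open>{0..1}\<close> except for the point \<open>1\<close>.
\<close>

lemma LINT_cells:
  fixes f :: "real \<Rightarrow> real"
  assumes n: "n \<ge> 1" and f: "set_integrable lborel {0..1} f"
  shows "(LINT x:{0..1}|lborel. f x) = (\<Sum>i = 1..n. LINT x:cell n i|lborel. f x)"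
proof -
  have f': "set_integrable lborel {0..<1} f" using f by (rule set_integrable_subset) auto
  have "(LINT x:{0..1}|lborel. f x) = (LINT x:{0..<1}|lborel. f x)"
  proof -
    have "AE x in lborel. x \<noteq> (1::real)" by (rule AE_lborel_singleton)
    then show ?thesis
      using f f' unfolding set_lebesgue_integral_def set_integrable_def
      by (intro integral_cong_AE) (auto simp: indicator_def)
  qed
  also have "\<dots> = (\<Sum>i = 1..n. LINT x:{real (i - 1) / real n..<real i / real n}|lborel. f x)"
    using LINT_mesh[of "\<lambda>j. real j / real n" n f] n f' by (simp add: divide_right_mono)
  also have "\<dots> = (\<Sum>i = 1..n. LINT x:cell n i|lborel. f x)"
    by (intro sum.cong) (auto simp: cell_eq)
  finally show ?thesis .
qed

lemma subcell_bounds: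
  assumes "m \<ge> 1" "i \<ge> 1"
  shows "real ((i - 1) * m + m) / real (n * m) = real i / real n" "real ((i - 1) * m) / real (n * m) = real (i - 1) / real n"
proof -
  have "(i - 1) * m + m = i * m" using assms by (cases i) auto
  then show "real ((i - 1) * m + m) / real (n * m) = real i / real n"
    using assms by (simp only: of_nat_mult) simp
  show "real ((i - 1) * m) / real (n * m) = real (i - 1) / real n"
    using assms by (simp only: of_nat_mult) simp
qed

lemma LINT_subcells:
  fixes f :: "real \<Rightarrow> real"
  assumes m: "m \<ge> 1" and i: "i \<in> {1..n}" and f: "set_integrable lborel {0..1} f"
  shows "(LINT x:cell n i|lborel. f x) = (\<Sum>r = 1..m. LINT x:cell (n * m) ((i - 1) * m + r)|lborel. f x)"
proof -
  define t where "t = (\<lambda>r. real ((i - 1) * m + r) / real (n * m))"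
  have t: "{t 0..<t m} = cell n i" using subcell_bounds[OF m, of i n] i by (simp add: t_def cell_eq)
  have f': "set_integrable lborel {t 0..<t m} f"
    unfolding t using f by (rule set_integrable_subset) (use cell_subset[OF i] in \<open>auto simp: cell_def\<close>)
  have "(LINT x:cell n i|lborel. f x) = (\<Sum>r = 1..m. LINT x:{t (r - 1)..<t r}|lborel. f x)"
    unfolding t[symmetric] by (rule LINT_mesh[OF _ f']) (simp add: t_def divide_right_mono)
  also have "\<dots> = (\<Sum>r = 1..m. LINT x:cell (n * m) ((i - 1) * m + r)|lborel. f x)"
  proof (rule sum.cong[OF refl])
    fix r assume r: "r \<in> {1..m}"
    then have "(i - 1) * m + (r - 1) = (i - 1) * m + r - 1" by simp
    then have "{t (r - 1)..<t r} = cell (n * m) ((i - 1) * m + r)"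
      using r by (simp only: t_def cell_eq[of "(i - 1) * m + r"]) (simp add: cell_eq)
    then show "(LINT x:{t (r - 1)..<t r}|lborel. f x) = (LINT x:cell (n * m) ((i - 1) * m + r)|lborel. f x)"
      by simp
  qed
  finally show ?thesis .
qed

lemma subcell_subset:
  assumes m: "m \<ge> 1" and i: "i \<ge> 1" and r: "r \<in> {1..m}"
  shows "cell (n * m) ((i - 1) * m + r) \<subseteq> cell n i"
proof -
  have "real ((i - 1) * m) / real (n * m) \<le> real ((i - 1) * m + r - 1) / real (n * m)"
    "real ((i - 1) * m + r) / real (n * m) \<le> real ((i - 1) * m + m) / real (n * m)"
  proof -
    have "a \<le> a + r - 1" "a + r \<le> a + m" for a :: nat using r by auto
    from this[of "(i - 1) * m"]
    show "real ((i - 1) * m) / real (n * m) \<le> real ((i - 1) * m + r - 1) / real (n * m)"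
      "real ((i - 1) * m + r) / real (n * m) \<le> real ((i - 1) * m + m) / real (n * m)"
      by (simp_all only: divide_right_mono of_nat_mono of_nat_0_le_iff)
  qed
  then show ?thesis using subcell_bounds[OF m i, of n] i r by (auto simp: cell_eq)
qed

lemma measure_cell: "n \<ge> 1 \<Longrightarrow> measure lborel (cell n i) = 1 / real n"
  by (simp add: cell_def divide_right_mono diff_divide_distrib[symmetric])

lemma LINT_cell_const: "n \<ge> 1 \<Longrightarrow> (LINT x:cell n i|lborel. c) = c / real n" for c :: real
  using measure_cell[of n i] by (simp add: set_lebesgue_integral_def cell_def)

text \<open>
  The left end of the cell that contains \<open>x\<close>, so that \<open>h (corner n x, corner n y)\<close> is constant on products of
  cells.
\<close>

definition corner :: "nat \<Rightarrow> real \<Rightarrow> real" where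
  "corner n x = real_of_int \<lfloor>real n * x\<rfloor> / real n"

lemma corner_measurable [measurable]: "corner n \<in> borel_measurable borel"
  unfolding corner_def by measurable

lemma corner_cell: "n \<ge> 1 \<Longrightarrow> x \<in> cell n i \<Longrightarrow> corner n x = (real i - 1) / real n"
  by (simp add: corner_def cell_floor)

lemma corner_close: "n \<ge> 1 \<Longrightarrow> \<bar>x - corner n x\<bar> \<le> 1 / real n"
proof -
  assume n: "n \<ge> 1"
  have "\<bar>real n * x - real_of_int \<lfloor>real n * x\<rfloor>\<bar> \<le> 1" by linarith
  moreover have "x - corner n x = (real n * x - real_of_int \<lfloor>real n * x\<rfloor>) / real n"
    using n by (simp add: corner_def field_simps)
  ultimately show ?thesis using n by (simp add: abs_divide divide_right_mono)
qed

lemma corner_range: "n \<ge> 1 \<Longrightarrow> x \<in> {0..1} \<Longrightarrow> corner n x \<in> {0..1}"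
proof -
  assume n: "n \<ge> 1" and x: "x \<in> {0..1}"
  then have "0 \<le> real n * x" "real n * x \<le> real n" by (auto simp: mult_left_le)
  then have "0 \<le> \<lfloor>real n * x\<rfloor>" "\<lfloor>real n * x\<rfloor> \<le> int n" by linarith+
  then show ?thesis using n by (simp add: corner_def)
qed

text \<open>
  A measurable kernel is an almost everywhere limit of continuous kernels, which after truncation converge
  in \<open>L\<^sup>1\<close>.  A continuous kernel is uniformly close to its values at the corners.
\<close>

lemma block_constant_approximation:
  fixes w :: "real \<Rightarrow> real \<Rightarrow> real"
  assumes w: "(\<lambda>z. w (fst z) (snd z)) \<in> borel_measurable borel" "\<And>x y. \<bar>w x y\<bar> \<le> 1" and \<tau>: "\<tau> > 0"
  shows "\<exists>n0\<ge>1. \<exists>h::real \<times> real \<Rightarrow> real. h \<in> borel_measurable borel \<and> (\<forall>z. \<bar>h z\<bar> \<le> 1) \<and>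
    (\<forall>n\<ge>n0. (LINT x:{0..1}|lborel. LINT y:{0..1}|lborel. \<bar>w x y - h (corner n x, corner n y)\<bar>) \<le> \<tau>)"
proof -
  define f where "f = (\<lambda>z. w (fst z) (snd z))"
  define Q where "Q = {0..1::real} \<times> {0..1::real}"
  have Qc: "compact Q" unfolding Q_def by (intro compact_Times) auto
  have Qb: "Q \<in> sets borel" using Qc by (simp add: borel_compact)
  have Qm: "emeasure lborel Q = 1"
    unfolding Q_def lborel_prod[symmetric] by (subst lborel.emeasure_pair_measure_Times) auto
  have fm: "f \<in> borel_measurable borel" using w(1) by (simp add: f_def)
  have "f \<in> borel_measurable (lebesgue_on UNIV)"
    using fm by (intro measurable_restrict_space1 measurable_completion) simp
  then have "f measurable_on UNIV"
    by (simp add: lebesgue_measurable_imp_measurable_on)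
  then obtain N g where N: "negligible N" and g: "\<And>n. continuous_on UNIV (g n)"
    and lim: "\<And>z. z \<notin> N \<Longrightarrow> (\<lambda>n. g n z) \<longlonglongrightarrow> f z"
    unfolding measurable_on_def by auto
  define h where "h = (\<lambda>n z. max (- 1) (min 1 (g n z)))"
  have hc: "continuous_on UNIV (h n)" for n
    unfolding h_def by (intro continuous_intros g)
  have hm: "h n \<in> borel_measurable borel" for n by (rule borel_measurable_continuous_onI[OF hc])
  have hb: "\<bar>h n z\<bar> \<le> 1" for n z by (auto simp: h_def)
  have fb: "\<bar>f z\<bar> \<le> 1" for z using w(2) by (simp add: f_def)
  have hlim: "(\<lambda>n. h n z) \<longlonglongrightarrow> f z" if "z \<notin> N" for z
  proof -
    have "(\<lambda>n. h n z) \<longlonglongrightarrow> max (- 1) (min 1 (f z))" unfolding h_def by (intro tendsto_intros lim that)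
    moreover have "max (- 1) (min 1 (f z)) = f z" using fb[of z] by (auto simp: abs_le_iff)
    ultimately show ?thesis by simp
  qed
  have "(\<lambda>n. LINT z|lborel. indicator Q z * \<bar>f z - h n z\<bar>) \<longlonglongrightarrow> (LINT z|(lborel :: (real \<times> real) measure). 0)"
  proof (rule integral_dominated_convergence)
    show "integrable lborel (\<lambda>z. indicator Q z * (2::real))"
      using Qb Qm by simp
    have "N \<in> null_sets lebesgue" using N by (simp add: negligible_iff_null_sets)
    then have "AE z in lebesgue. z \<notin> N" by (rule AE_not_in)
    then have "AE z in lborel. z \<notin> N" by (simp add: AE_completion_iff)
    then show "AE z in lborel. (\<lambda>n. indicator Q z * \<bar>f z - h n z\<bar>) \<longlonglongrightarrow> 0"
    proof eventually_elim
      case (elim z)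
      have "(\<lambda>n. indicator Q z * \<bar>f z - h n z\<bar>) \<longlonglongrightarrow> indicator Q z * \<bar>f z - f z\<bar>"
        by (intro tendsto_intros hlim elim)
      then show ?case by simp
    qed
    show "AE z in lborel. norm (indicator Q z * \<bar>f z - h n z\<bar>) \<le> indicator Q z * 2" for n
    proof (intro AE_I2)
      fix z
      have "\<bar>f z - h n z\<bar> \<le> 2" using fb[of z] hb[of n z] by linarith
      then show "norm (indicator Q z * \<bar>f z - h n z\<bar>) \<le> indicator Q z * 2" by (simp add: indicator_def)
    qed
  qed (use fm hm Qb in auto)
  then have "eventually (\<lambda>n. (LINT z|lborel. indicator Q z * \<bar>f z - h n z\<bar>) < \<tau> / 2) sequentially"
    using \<tau> by (intro order_tendstoD(2)) auto
  then obtain k where k: "(LINT z|lborel. indicator Q z * \<bar>f z - h k z\<bar>) < \<tau> / 2"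
    by (auto simp: eventually_sequentially)
  have "uniformly_continuous_on Q (h k)"
    by (intro compact_uniformly_continuous continuous_on_subset[OF hc] Qc) simp
  then obtain d where d: "d > 0" "\<And>z z'. z \<in> Q \<Longrightarrow> z' \<in> Q \<Longrightarrow> dist z' z < d \<Longrightarrow> dist (h k z') (h k z) < \<tau> / 2"
    using \<tau> unfolding uniformly_continuous_on_def by (metis half_gt_zero)
  obtain n0 :: nat where n0: "real n0 > 2 / d" using reals_Archimedean2 by blast
  show ?thesis
  proof (intro exI[of _ "Suc n0"] exI[of _ "h k"] conjI allI impI hm hb)
    fix n assume n: "n \<ge> Suc n0"
    have n1: "n \<ge> 1" and nd: "2 / real n < d"
    proof -
      show "n \<ge> 1" using n by simp
      have "2 / d < real n" using n n0 by linarith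
      then show "2 / real n < d" using d(1) n by (simp add: field_simps)
    qed
    have close: "\<bar>h k (x, y) - h k (corner n x, corner n y)\<bar> \<le> \<tau> / 2" if "(x, y) \<in> Q" for x y
    proof -
      have c: "(corner n x, corner n y) \<in> Q" using that corner_range[OF n1] by (auto simp: Q_def)
      have "dist (x, y) (corner n x, corner n y) \<le> \<bar>x - corner n x\<bar> + \<bar>y - corner n y\<bar>"
        unfolding dist_Pair_Pair dist_real_def
        by (metis abs_ge_zero abs_idempotent sqrt_sum_squares_le_sum_abs power2_abs)
      also have "\<dots> \<le> 1 / real n + 1 / real n" by (intro add_mono corner_close n1)
      also have "\<dots> < d" using nd by simp
      finally show ?thesis using d(2)[OF c that] by (simp add: dist_real_def)
    qed
    define e where "e = (\<lambda>z. \<bar>f z - h k (corner n (fst z), corner n (snd z))\<bar>)"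
    have em: "e \<in> borel_measurable borel"
    proof -
      have "(\<lambda>z::real \<times> real. (corner n (fst z), corner n (snd z))) \<in> borel \<rightarrow>\<^sub>M borel \<Otimes>\<^sub>M borel"
        by (intro measurable_Pair measurable_compose[OF _ corner_measurable];
            rule borel_measurable_continuous_onI; intro continuous_intros)
      then have "(\<lambda>z::real \<times> real. h k (corner n (fst z), corner n (snd z))) \<in> borel_measurable borel"
        using hm[of k] by (auto simp: borel_prod intro: measurable_compose)
      then show ?thesis using fm by (auto simp: e_def)
    qed
    have eb: "\<bar>e z\<bar> \<le> 2" for z
    proof -
      have "\<bar>f z\<bar> \<le> 1" "\<bar>h k (corner n (fst z), corner n (snd z))\<bar> \<le> 1" using fb hb by auto
      then show ?thesis unfolding e_def by linarith
    qed
    have eI: "integrable lborel (\<lambda>z. indicator Q z * e z)"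
      using set_integrable_bounded[OF em eb Qb] Qm by (simp add: set_integrable_def)
    have gI: "integrable lborel (\<lambda>z. indicator Q z * \<bar>f z - h k z\<bar>)"
    proof -
      have "\<bar>\<bar>f z - h k z\<bar>\<bar> \<le> 2" for z using fb[of z] hb[of k z] by linarith
      from set_integrable_bounded[OF _ this Qb] show ?thesis
        using Qm fm hm[of k] by (simp add: set_integrable_def)
    qed
    have "(LINT x:{0..1}|lborel. LINT y:{0..1}|lborel. \<bar>w x y - h k (corner n x, corner n y)\<bar>)
      = (LINT x|lborel. LINT y|lborel. indicator Q (x, y) * e (x, y))"
      unfolding set_lebesgue_integral_def
      by (intro Bochner_Integration.integral_cong refl)
         (auto simp: Q_def e_def f_def indicator_def intro!: Bochner_Integration.integral_cong)
    also have "\<dots> = (LINT z|lborel. indicator Q z * e z)"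
      using lborel_pair.integral_fst'[of "\<lambda>z. indicator Q z * e z"] eI by (simp add: lborel_prod)
    also have "\<dots> \<le> (LINT z|lborel. indicator Q z * \<bar>f z - h k z\<bar> + indicator Q z * (\<tau> / 2))"
    proof (rule integral_mono[OF eI])
      show "integrable lborel (\<lambda>z. indicator Q z * \<bar>f z - h k z\<bar> + indicator Q z * (\<tau> / 2))"
        using gI Qb Qm by simp
      fix z :: "real \<times> real"
      obtain x y where z: "z = (x, y)" by fastforce
      show "indicator Q z * e z \<le> indicator Q z * \<bar>f z - h k z\<bar> + indicator Q z * (\<tau> / 2)"
      proof (cases "(x, y) \<in> Q")
        case True
        have "\<bar>f (x, y) - h k (corner n x, corner n y)\<bar>
          \<le> \<bar>f (x, y) - h k (x, y)\<bar> + \<bar>h k (x, y) - h k (corner n x, corner n y)\<bar>" by linarith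
        then show ?thesis using close[OF True] True unfolding z e_def by simp
      qed (simp add: z)
    qed
    also have "\<dots> = (LINT z|lborel. indicator Q z * \<bar>f z - h k z\<bar>) + \<tau> / 2"
      using gI Qb Qm by (simp add: measure_def)
    finally show "(LINT x:{0..1}|lborel. LINT y:{0..1}|lborel. \<bar>w x y - h k (corner n x, corner n y)\<bar>) \<le> \<tau>"
      using k by simp
  qed simp
qed

text \<open>
  Both kernels that are compared, the averages over the cells of width \<open>1 / (n m)\<close> in both variables and
  the averages over the cells of width \<open>1 / n\<close> in \<open>y\<close> alone, reproduce a kernel that is constant on
  products of cells of width \<open>1 / n\<close>.  Averages are contractions in \<open>L\<^sup>1\<close>, so each of them contributes the
  distance of \<open>w\<close> to such a kernel, which is at most \<open>\<tau>\<close> once \<open>n\<close> is large, whatever \<open>m\<close> is.  The function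
  \<open>H\<close> collects the two contributions at \<open>x\<close>.
\<close>

theorem kernel_discretization_error:
  fixes w :: "real \<Rightarrow> real \<Rightarrow> real"
  assumes w: "(\<lambda>z. w (fst z) (snd z)) \<in> borel_measurable borel" "\<And>x y. \<bar>w x y\<bar> \<le> 1" and \<tau>: "\<tau> > 0"
  shows "\<exists>n0\<ge>1. \<forall>n\<ge>n0. \<forall>m\<ge>1. \<exists>H. set_integrable lborel {0..1} H \<and> (\<forall>x. 0 \<le> H x) \<and>
    (LINT x:{0..1}|lborel. H x) \<le> 2 * \<tau> \<and>
    (\<forall>i\<in>{1..n}. \<forall>x\<in>cell n i. (\<Sum>r = 1..m. \<Sum>i' = 1..n. \<Sum>r' = 1..m.
       \<bar>(real (n * m))\<^sup>2 * (LINT x:cell (n * m) ((i - 1) * m + r)|lborel. LINT y:cell (n * m) ((i' - 1) * m + r')|lborel. w x y)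
         - real n * (LINT y:cell n i'|lborel. w x y)\<bar>) / (real m * real (n * m)) \<le> H x)"
proof -
  obtain n0 h where n0: "n0 \<ge> 1" and h: "h \<in> borel_measurable borel" "\<And>z. \<bar>h z\<bar> \<le> (1::real)"
    and hI: "\<And>n. n \<ge> n0 \<Longrightarrow> (LINT x:{0..1}|lborel. LINT y:{0..1}|lborel. \<bar>w x y - h (corner n x, corner n y)\<bar>) \<le> \<tau>"
    using block_constant_approximation[OF w \<tau>] by blast
  show ?thesis
  proof (intro exI[of _ n0] conjI allI impI n0)
    fix n m assume n: "n \<ge> n0" and m: "m \<ge> (1::nat)"
    have n1: "n \<ge> 1" using n n0 by simp
    define N where "N = n * m"
    have N1: "N \<ge> 1" using n1 m by (simp add: N_def)
    define e where "e = (\<lambda>x y. \<bar>w x y - h (corner n x, corner n y)\<bar>)"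
    have wm [measurable (raw)]: "(\<lambda>z. w (f z) (g z)) \<in> borel_measurable M"
      if "f \<in> borel_measurable M" "g \<in> borel_measurable M" for f g and M :: "'z measure"
    proof -
      have "(\<lambda>z. (f z, g z)) \<in> M \<rightarrow>\<^sub>M borel" using measurable_Pair[OF that] by (simp add: borel_prod)
      from measurable_compose[OF this w(1)] show ?thesis by simp
    qed
    have hm [measurable (raw)]: "(\<lambda>z. h (f z, g z)) \<in> borel_measurable M"
      if "f \<in> borel_measurable M" "g \<in> borel_measurable M" for f g and M :: "'z measure"
    proof -
      have "(\<lambda>z. (f z, g z)) \<in> M \<rightarrow>\<^sub>M borel" using measurable_Pair[OF that] by (simp add: borel_prod)
      from measurable_compose[OF this h(1)] show ?thesis by simp
    qed
    have em [measurable (raw)]: "(\<lambda>z. e (f z) (g z)) \<in> borel_measurable M"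
      if [measurable]: "f \<in> borel_measurable M" "g \<in> borel_measurable M" for f g and M :: "'z measure"
      unfolding e_def by measurable
    have e0: "0 \<le> e x y" for x y by (simp add: e_def)
    have eb: "\<bar>e x y\<bar> \<le> 2" for x y
    proof -
      have "\<bar>w x y\<bar> \<le> 1" "\<bar>h (corner n x, corner n y)\<bar> \<le> 1" using w(2) h(2) by auto
      then show ?thesis unfolding e_def by linarith
    qed
    have cellb [measurable]: "cell p i \<in> sets borel" for p i by (simp add: cell_def)
    have cellf: "emeasure lborel (cell p i) < \<infinity>" if "p \<ge> 1" for p i
      using that by (simp add: cell_def divide_right_mono)
    have eI: "set_integrable lborel A (e x)" if "A \<in> sets borel" "emeasure lborel A < \<infinity>" for A x
      using that by (intro set_integrable_bounded[of _ 2] eb) auto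
    have wI: "set_integrable lborel A (w x)" if "A \<in> sets borel" "emeasure lborel A < \<infinity>" for A x
      using that w(2) by (intro set_integrable_bounded[of _ 1]) auto
    have bound_int: "\<bar>LINT y:A|lborel. g y\<bar> \<le> 2" if g: "g \<in> borel_measurable borel" "\<And>y. \<bar>g y\<bar> \<le> (2::real)"
      and A: "A \<in> sets borel" "emeasure lborel A \<le> 1" for g A
    proof -
      have A': "emeasure lborel A < \<infinity>" using A(2) by (rule order_le_less_trans) simp
      have m1: "measure lborel A \<le> 1" using A(2) by (metis enn2real_1 enn2real_mono ennreal_one_less_top measure_def)
      have "\<bar>LINT y:A|lborel. g y\<bar> \<le> (LINT y:A|lborel. norm (g y))"
        using set_integral_norm_bound[OF set_integrable_bounded[OF g A(1) A']] by simp
      also have "\<dots> \<le> (LINT y:A|lborel. 2)"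
        using set_integrable_bounded[OF g A(1) A'] g(2) A A'
        by (intro set_integral_mono set_integrable_norm) (auto simp: set_integrable_def)
      also have "\<dots> = 2 * measure lborel A" using A(1) A' by (simp add: set_lebesgue_integral_def)
      finally show ?thesis using m1 by linarith
    qed
    have emc: "emeasure lborel (cell p i) \<le> 1" if "p \<ge> 1" for p i
      using that by (simp add: cell_def divide_right_mono diff_divide_distrib[symmetric])
    define F where "F = (\<lambda>A x. LINT y:A|lborel. e x y)"
    define E where "E = F {0..1}"
    have Fm: "F A \<in> borel_measurable borel" if [measurable]: "A \<in> sets borel" for A
      unfolding F_def set_lebesgue_integral_def by measurable
    have Fb: "\<bar>F A x\<bar> \<le> 2" if "A \<in> sets borel" "emeasure lborel A \<le> 1" for A x
      unfolding F_def using eb that by (intro bound_int) auto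
    have F0: "0 \<le> F A x" for A x unfolding F_def by (intro LINT_set_nonneg e0)
    have FI: "set_integrable lborel B (F A)" if "A \<in> sets borel" "emeasure lborel A \<le> 1" "B \<in> sets borel" "emeasure lborel B < \<infinity>" for A B
      using that by (intro set_integrable_bounded[of _ 2] Fm Fb)
    have E_int: "set_integrable lborel {0..1} E" unfolding E_def by (intro FI) auto
    have ET: "(LINT x:{0..1}|lborel. E x) \<le> \<tau>" unfolding E_def F_def e_def using hI[OF n] .
    have Esum: "E x = (\<Sum>i = 1..n. F (cell n i) x)" for x
      unfolding E_def F_def by (rule LINT_cells[OF n1]) (rule eI, auto)
    have Esum': "E x = (\<Sum>i' = 1..n. \<Sum>r' = 1..m. F (cell N ((i' - 1) * m + r')) x)" for x
      unfolding Esum unfolding F_def N_def by (intro sum.cong refl LINT_subcells m) (auto intro: eI)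
    define H where "H = (\<lambda>x. (\<Sum>i = 1..n. indicator (cell n i) x * (real n * (LINT z:cell n i|lborel. E z))) + E x)"
    have HI: "set_integrable lborel {0..1} H"
      unfolding H_def
    proof (intro set_integral_add E_int set_integrable_sum(1))
      fix i assume "i \<in> {1..n}"
      show "set_integrable lborel {0..1} (\<lambda>x. indicator (cell n i) x * (real n * (LINT z:cell n i|lborel. E z)))"
        by (intro set_integrable_bounded[of _ "\<bar>real n * (LINT z:cell n i|lborel. E z)\<bar>"])
           (auto simp: indicator_def)
    qed simp
    have H0: "0 \<le> H x" for x
      unfolding H_def E_def by (intro add_nonneg_nonneg sum_nonneg mult_nonneg_nonneg LINT_set_nonneg F0) auto
    have Hc: "H x = real n * (LINT z:cell n i|lborel. E z) + E x" if "i \<in> {1..n}" "x \<in> cell n i" for i x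
    proof -
      have "(\<Sum>j = 1..n. indicator (cell n j) x * (real n * (LINT z:cell n j|lborel. E z)))
        = (\<Sum>j = 1..n. if j = i then real n * (LINT z:cell n j|lborel. E z) else 0)"
        using that cell_unique[OF n1, of x] by (intro sum.cong) (auto simp: indicator_def)
      then show ?thesis using that by (simp add: H_def)
    qed
    have HT: "(LINT x:{0..1}|lborel. H x) \<le> 2 * \<tau>"
    proof -
      have "(LINT x:{0..1}|lborel. H x) = (\<Sum>i = 1..n. LINT x:cell n i|lborel. H x)"
        by (rule LINT_cells[OF n1 HI])
      also have "\<dots> = (\<Sum>i = 1..n. 2 * (LINT x:cell n i|lborel. E x))"
      proof (rule sum.cong[OF refl])
        fix i assume i: "i \<in> {1..n}"
        have EI: "set_integrable lborel (cell n i) E" unfolding E_def using cellf[OF n1] by (intro FI) auto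
        have "(LINT x:cell n i|lborel. H x) = (LINT x:cell n i|lborel. real n * (LINT z:cell n i|lborel. E z) + E x)"
          using Hc[OF i] by (intro set_lebesgue_integral_cong) auto
        also have "\<dots> = (LINT x:cell n i|lborel. real n * (LINT z:cell n i|lborel. E z)) + (LINT x:cell n i|lborel. E x)"
          using EI cellf[OF n1, of i] by (intro set_integral_add) (auto simp: set_integrable_def)
        also have "\<dots> = 2 * (LINT x:cell n i|lborel. E x)"
          using LINT_cell_const[OF n1] n1 by simp
        finally show "(LINT x:cell n i|lborel. H x) = 2 * (LINT x:cell n i|lborel. E x)" .
      qed
      also have "\<dots> = 2 * (LINT x:{0..1}|lborel. E x)"
        unfolding LINT_cells[OF n1 E_int] by (simp add: sum_distrib_left)
      finally show ?thesis using ET by simp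
    qed
    have main: "(\<Sum>r = 1..m. \<Sum>i' = 1..n. \<Sum>r' = 1..m.
       \<bar>(real N)\<^sup>2 * (LINT x:cell N ((i - 1) * m + r)|lborel. LINT y:cell N ((i' - 1) * m + r')|lborel. w x y)
         - real n * (LINT y:cell n i'|lborel. w x y)\<bar>) / (real m * real N) \<le> H x"
      if i: "i \<in> {1..n}" and x: "x \<in> cell n i" for i x
    proof -
      have one: "\<bar>(real N)\<^sup>2 * (LINT x:cell N ((i - 1) * m + r)|lborel. LINT y:cell N ((i' - 1) * m + r')|lborel. w x y)
         - real n * (LINT y:cell n i'|lborel. w x y)\<bar>
        \<le> (real N)\<^sup>2 * (LINT x:cell N ((i - 1) * m + r)|lborel. F (cell N ((i' - 1) * m + r')) x) + real n * F (cell n i') x"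
        if r: "r \<in> {1..m}" and i': "i' \<in> {1..n}" and r': "r' \<in> {1..m}" for r i' r'
      proof -
        define c where "c = h ((real i - 1) / real n, (real i' - 1) / real n)"
        define A where "A = cell N ((i - 1) * m + r)"
        define B where "B = cell N ((i' - 1) * m + r')"
        have AB [measurable]: "A \<in> sets borel" "B \<in> sets borel" by (auto simp: A_def B_def)
        have ABf: "emeasure lborel A < \<infinity>" "emeasure lborel B < \<infinity>" "emeasure lborel A \<le> 1" "emeasure lborel B \<le> 1"
          using cellf[OF N1] emc[OF N1] by (auto simp: A_def B_def)
        have Asub: "A \<subseteq> cell n i" and Bsub: "B \<subseteq> cell n i'"
          unfolding A_def B_def N_def
          using subcell_subset[OF m _ r, of i n] subcell_subset[OF m _ r', of i' n] i i' by auto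
        have ec: "e x y = \<bar>w x y - c\<bar>" if "x \<in> cell n i" "y \<in> cell n i'" for x y
          using that corner_cell[OF n1] by (simp add: e_def c_def)
        define g where "g = (\<lambda>x. LINT y:B|lborel. w x y)"
        have gm: "g \<in> borel_measurable borel" unfolding g_def set_lebesgue_integral_def by measurable
        have gb: "\<bar>g x\<bar> \<le> 2" for x
          unfolding g_def using ABf AB w(2) by (intro bound_int) (auto intro: order_trans[OF w(2)])
        have gI: "set_integrable lborel A g" using ABf AB by (intro set_integrable_bounded[of _ 2] gm gb)
        have gc: "\<bar>g x - c / real N\<bar> \<le> F B x" if "x \<in> A" for x
        proof -
          have "g x - c / real N = (LINT y:B|lborel. w x y - c)"
            unfolding g_def using wI[OF AB(2) ABf(2)] ABf AB LINT_cell_const[OF N1] 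
            by (subst set_integral_diff) (auto simp: set_integrable_def B_def)
          also have "\<bar>\<dots>\<bar> \<le> (LINT y:B|lborel. norm (w x y - c))"
            using set_integral_norm_bound[OF set_integral_diff(1)[OF wI[OF AB(2) ABf(2)], of "\<lambda>_. c"]] ABf AB
            by (simp add: set_integrable_def)
          also have "\<dots> = F B x"
            unfolding F_def using that Asub Bsub ec by (intro set_lebesgue_integral_cong) (auto simp: subset_iff)
          finally show ?thesis .
        qed
        have 1: "\<bar>(real N)\<^sup>2 * (LINT x:A|lborel. g x) - c\<bar> \<le> (real N)\<^sup>2 * (LINT x:A|lborel. F B x)"
        proof -
          have cI: "set_integrable lborel A (\<lambda>_. c / real N)" using ABf AB by (simp add: set_integrable_def)
          have "(LINT x:A|lborel. g x) - c / (real N)\<^sup>2 = (LINT x:A|lborel. g x - c / real N)"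
            using LINT_cell_const[OF N1, of "(i - 1) * m + r" "c / real N"] gI cI
            by (subst set_integral_diff) (auto simp: A_def power2_eq_square)
          also have "\<bar>\<dots>\<bar> \<le> (LINT x:A|lborel. norm (g x - c / real N))"
            using set_integral_norm_bound[OF set_integral_diff(1)[OF gI cI]] by simp
          also have "\<dots> \<le> (LINT x:A|lborel. F B x)"
            using gI cI gc FI[OF AB(2) ABf(4) AB(1) ABf(1)]
            by (intro set_integral_mono set_integrable_norm set_integral_diff) auto
          finally have "(real N)\<^sup>2 * \<bar>(LINT x:A|lborel. g x) - c / (real N)\<^sup>2\<bar> \<le> (real N)\<^sup>2 * (LINT x:A|lborel. F B x)"
            by (intro mult_left_mono) auto
          moreover have "(real N)\<^sup>2 * (LINT x:A|lborel. g x) - c = (real N)\<^sup>2 * ((LINT x:A|lborel. g x) - c / (real N)\<^sup>2)"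
            using N1 by (simp add: right_diff_distrib)
          ultimately show ?thesis by (simp add: abs_mult)
        qed
        have 2: "\<bar>real n * (LINT y:cell n i'|lborel. w x y) - c\<bar> \<le> real n * F (cell n i') x"
        proof -
          note wI' = wI[OF cellb cellf[OF n1], of i' x]
          have cI: "set_integrable lborel (cell n i') (\<lambda>_. c)" using cellf[OF n1] by (simp add: set_integrable_def)
          have "(LINT y:cell n i'|lborel. w x y) - c / real n = (LINT y:cell n i'|lborel. w x y - c)"
            using LINT_cell_const[OF n1] wI' cI by (subst set_integral_diff) auto
          also have "\<bar>\<dots>\<bar> \<le> (LINT y:cell n i'|lborel. norm (w x y - c))"
            using set_integral_norm_bound[OF set_integral_diff(1)[OF wI' cI]] by simp
          also have "\<dots> = F (cell n i') x"
            unfolding F_def using x ec by (intro set_lebesgue_integral_cong) auto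
          finally have "real n * \<bar>(LINT y:cell n i'|lborel. w x y) - c / real n\<bar> \<le> real n * F (cell n i') x"
            by (intro mult_left_mono) auto
          moreover have "real n * (LINT y:cell n i'|lborel. w x y) - c = real n * ((LINT y:cell n i'|lborel. w x y) - c / real n)"
            using n1 by (simp add: right_diff_distrib)
          ultimately show ?thesis by (simp add: abs_mult)
        qed
        show ?thesis using 1 2 unfolding g_def A_def B_def by linarith
      qed
      have "(\<Sum>r = 1..m. \<Sum>i' = 1..n. \<Sum>r' = 1..m.
         \<bar>(real N)\<^sup>2 * (LINT x:cell N ((i - 1) * m + r)|lborel. LINT y:cell N ((i' - 1) * m + r')|lborel. w x y)
           - real n * (LINT y:cell n i'|lborel. w x y)\<bar>)
        \<le> (\<Sum>r = 1..m. \<Sum>i' = 1..n. \<Sum>r' = 1..m.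
            (real N)\<^sup>2 * (LINT x:cell N ((i - 1) * m + r)|lborel. F (cell N ((i' - 1) * m + r')) x) + real n * F (cell n i') x)"
        using one by (intro sum_mono) auto
      also have "\<dots> = (real N)\<^sup>2 * (\<Sum>r = 1..m. \<Sum>i' = 1..n. \<Sum>r' = 1..m. LINT x:cell N ((i - 1) * m + r)|lborel. F (cell N ((i' - 1) * m + r')) x)
          + real m * (real m * (real n * E x))"
        by (simp add: sum.distrib sum_distrib_left Esum mult_ac)
      also have "(\<Sum>r = 1..m. \<Sum>i' = 1..n. \<Sum>r' = 1..m. LINT x:cell N ((i - 1) * m + r)|lborel. F (cell N ((i' - 1) * m + r')) x)
        = (\<Sum>r = 1..m. LINT x:cell N ((i - 1) * m + r)|lborel. E x)"
      proof (rule sum.cong[OF refl])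
        fix r
        have FI': "set_integrable lborel (cell N ((i - 1) * m + r)) (F (cell N j))" for j
          using cellf[OF N1] emc[OF N1] by (intro FI) auto
        show "(\<Sum>i' = 1..n. \<Sum>r' = 1..m. LINT x:cell N ((i - 1) * m + r)|lborel. F (cell N ((i' - 1) * m + r')) x)
          = (LINT x:cell N ((i - 1) * m + r)|lborel. E x)"
          unfolding Esum' using FI' 
          by (simp add: set_integrable_sum)
      qed
      also have "(\<Sum>r = 1..m. LINT x:cell N ((i - 1) * m + r)|lborel. E x) = (LINT x:cell n i|lborel. E x)"
        unfolding N_def by (rule LINT_subcells[OF m i E_int, symmetric])
      finally have "(\<Sum>r = 1..m. \<Sum>i' = 1..n. \<Sum>r' = 1..m.
         \<bar>(real N)\<^sup>2 * (LINT x:cell N ((i - 1) * m + r)|lborel. LINT y:cell N ((i' - 1) * m + r')|lborel. w x y)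
           - real n * (LINT y:cell n i'|lborel. w x y)\<bar>) / (real m * real N)
        \<le> ((real N)\<^sup>2 * (LINT x:cell n i|lborel. E x) + real m * (real m * (real n * E x))) / (real m * real N)"
        by (rule divide_right_mono) simp
      also have "\<dots> = real n * (LINT x:cell n i|lborel. E x) + E x"
        using n1 m by (simp add: N_def field_simps power2_eq_square)
      also have "\<dots> = H x" using Hc[OF i x] by simp
      finally show ?thesis .
    qed
    show "\<exists>H. set_integrable lborel {0..1} H \<and> (\<forall>x. 0 \<le> H x) \<and>
    (LINT x:{0..1}|lborel. H x) \<le> 2 * \<tau> \<and>
    (\<forall>i\<in>{1..n}. \<forall>x\<in>cell n i. (\<Sum>r = 1..m. \<Sum>i' = 1..n. \<Sum>r' = 1..m.
       \<bar>(real (n * m))\<^sup>2 * (LINT x:cell (n * m) ((i - 1) * m + r)|lborel. LINT y:cell (n * m) ((i' - 1) * m + r')|lborel. w x y)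
         - real n * (LINT y:cell n i'|lborel. w x y)\<bar>) / (real m * real (n * m)) \<le> H x)"
      using HI H0 HT main unfolding N_def by blast
  qed
qed

section \<open>Riemann integrability on cells\<close>

lemma cell_tagged_division:
  assumes n: "n \<ge> 1" and a: "\<And>i. i \<in> {1..n} \<Longrightarrow> a i \<in> {(real i - 1) / real n..real i / real n}"
  shows "(\<lambda>i. (a i, {(real i - 1) / real n..real i / real n})) ` {1..n} tagged_division_of {0..1::real}"
proof (rule tagged_division_ofI)
  define K where "K = (\<lambda>i. {(real i - 1) / real n..real i / real n})"
  show "finite ((\<lambda>i. (a i, {(real i - 1) / real n..real i / real n})) ` {1..n})" by simp
  fix x k assume "(x, k) \<in> (\<lambda>i. (a i, {(real i - 1) / real n..real i / real n})) ` {1..n}"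
  then obtain i where i: "i \<in> {1..n}" "x = a i" "k = K i" unfolding K_def by blast
  show "x \<in> k" using a i by (simp add: K_def)
  show "k \<subseteq> {0..1}" 
  proof -
    have "0 \<le> (real i - 1) / real n" "real i / real n \<le> 1" using i n by auto
    then show ?thesis unfolding i K_def by (meson atLeastatMost_subset_iff)
  qed
  show "\<exists>a b. k = cbox a b" using i by (auto simp: K_def)
  fix y l assume "(y, l) \<in> (\<lambda>i. (a i, {(real i - 1) / real n..real i / real n})) ` {1..n}" and ne: "(x, k) \<noteq> (y, l)"
  then obtain j where j: "j \<in> {1..n}" "y = a j" "l = K j" unfolding K_def by blast
  have "i \<noteq> j" using ne i j by auto
  then have "real i \<le> real j - 1 \<or> real j \<le> real i - 1" by linarith
  then have "real i / real n \<le> (real j - 1) / real n \<or> real j / real n \<le> (real i - 1) / real n"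
    using n by (auto simp: divide_le_cancel)
  then show "interior k \<inter> interior l = {}" unfolding i j K_def by (auto simp: interior_atLeastAtMost_real)
next
  show "\<Union>{K. \<exists>x. (x, K) \<in> (\<lambda>i. (a i, {(real i - 1) / real n..real i / real n})) ` {1..n}} = {0..1}"
  proof
    show "\<Union>{K. \<exists>x. (x, K) \<in> (\<lambda>i. (a i, {(real i - 1) / real n..real i / real n})) ` {1..n}} \<subseteq> {0..1}"
    proof clarify
      fix x i assume i: "i \<in> {1..n}" and x: "x \<in> {(real i - 1) / real n..real i / real n}"
      have "0 \<le> (real i - 1) / real n" "real i / real n \<le> 1" using i n by auto
      then show "x \<in> {0..1}" using x by (meson atLeastAtMost_iff order_trans)
    qed
    show "{0..1} \<subseteq> \<Union>{K. \<exists>x. (x, K) \<in> (\<lambda>i. (a i, {(real i - 1) / real n..real i / real n})) ` {1..n}}"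
    proof
      fix x :: real assume x: "x \<in> {0..1}"
      define i where "i = (if x = 0 then 1 else nat \<lceil>x * real n\<rceil>)"
      have "i \<in> {1..n} \<and> x \<in> {(real i - 1) / real n..real i / real n}"
      proof (cases "x = 0")
        case True then show ?thesis using n by (simp add: i_def)
      next
        case False
        then have xp: "0 < x * real n" "x * real n \<le> real n" using x n by (auto simp: mult_left_le_one_le)
        then have "real i = of_int \<lceil>x * real n\<rceil>" using False by (simp add: i_def)
        then have "real i - 1 \<le> x * real n" "x * real n \<le> real i" "real i < x * real n + 1"  by linarith+
        moreover have "1 \<le> i" "i \<le> n" using xp False by (auto simp: i_def nat_le_iff ceiling_le_iff) linarith
        ultimately show ?thesis using n by (auto simp: field_simps)
      qed
      then show "x \<in> \<Union>{K. \<exists>x. (x, K) \<in> (\<lambda>i. (a i, {(real i - 1) / real n..real i / real n})) ` {1..n}}" by blast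
    qed
  qed
qed

text \<open>
  Choose in every cell two tags at which \<open>H\<close> nearly attains its largest difference.  Both Riemann sums are
  close to the integral, so the mean of these differences is small.
\<close>

theorem riemann_integrable_oscillation:
  fixes H :: "real \<Rightarrow> real"
  assumes H: "riemann_integrable_on H 0 1" and b: "\<And>x. x \<in> {0..1} \<Longrightarrow> \<bar>H x\<bar> \<le> c" and \<eta>: "\<eta> > 0"
  shows "\<exists>n0\<ge>1. \<forall>n\<ge>n0. \<exists>w. (\<forall>i\<in>{1..n}. \<forall>x\<in>{(real i - 1) / real n..real i / real n}.
      \<forall>y\<in>{(real i - 1) / real n..real i / real n}. \<bar>H x - H y\<bar> \<le> w i) \<and> (\<Sum>i = 1..n. w i) / real n \<le> \<eta>"
proof -
  obtain J where J: "\<And>\<epsilon>. \<epsilon> > 0 \<Longrightarrow> \<exists>\<delta>>0. \<forall>p. p tagged_division_of {0..1} \<and> (\<forall>(x, K)\<in>p. diameter K < \<delta>) \<longrightarrow>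
        \<bar>(\<Sum>(x, K)\<in>p. measure lborel K * H x) - J\<bar> < \<epsilon>"
    using H unfolding riemann_integrable_on_def by blast
  obtain \<delta> where \<delta>: "\<delta> > 0" "\<And>p. p tagged_division_of {0..1} \<Longrightarrow> (\<forall>(x, K)\<in>p. diameter K < \<delta>) \<Longrightarrow>
        \<bar>(\<Sum>(x, K)\<in>p. measure lborel K * H x) - J\<bar> < \<eta> / 4"
    using J[of "\<eta> / 4"] \<eta> by auto
  obtain n0 :: nat where n0: "real n0 > 1 / \<delta>" "n0 \<ge> 1"
    by (metis One_nat_def Suc_leI divide_pos_pos less_trans of_nat_0_less_iff reals_Archimedean2 zero_less_one \<delta>(1))
  show ?thesis
  proof (intro exI[of _ n0] conjI allI impI)
    fix n assume n: "n \<ge> n0"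
    have n1: "n \<ge> 1" using n n0 by simp
    define K where "K = (\<lambda>i. {(real i - 1) / real n..real i / real n})"
    have Ksub: "K i \<subseteq> {0..1}" if i: "i \<in> {1..n}" for i
    proof -
      have "0 \<le> (real i - 1) / real n" "real i / real n \<le> 1" using i n1 by auto
      then show ?thesis unfolding K_def by (meson atLeastatMost_subset_iff)
    qed
    have Kne: "K i \<noteq> {}" for i using n1 by (auto simp: K_def divide_le_cancel)
    define w where "w = (\<lambda>i. SUP z\<in>K i \<times> K i. H (fst z) - H (snd z))"
    have bdd: "bdd_above ((\<lambda>z. H (fst z) - H (snd z)) ` (K i \<times> K i))" if "i \<in> {1..n}" for i
    proof (rule bdd_aboveI2)
      fix z assume "z \<in> K i \<times> K i"
      then have "fst z \<in> {0..1}" "snd z \<in> {0..1}" using Ksub[OF that] by auto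
      then show "H (fst z) - H (snd z) \<le> 2 * c" using b[of "fst z"] b[of "snd z"] by linarith
    qed
    have "\<exists>z. z \<in> K i \<times> K i \<and> w i - \<eta> / 2 < H (fst z) - H (snd z)" if "i \<in> {1..n}" for i
    proof -
      have "w i - \<eta> / 2 < (SUP z\<in>K i \<times> K i. H (fst z) - H (snd z))" using \<eta> by (simp add: w_def)
      then show ?thesis using bdd[OF that] Kne[of i] by (subst (asm) less_cSUP_iff) auto
    qed
    then obtain z where z: "\<And>i. i \<in> {1..n} \<Longrightarrow> z i \<in> K i \<times> K i"
      "\<And>i. i \<in> {1..n} \<Longrightarrow> w i - \<eta> / 2 < H (fst (z i)) - H (snd (z i))" by metis
    have RS: "\<bar>(\<Sum>i = 1..n. H (a i)) / real n - J\<bar> < \<eta> / 4" if a: "\<And>i. i \<in> {1..n} \<Longrightarrow> a i \<in> K i" for a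
    proof -
      define p where "p = (\<lambda>i. (a i, K i)) ` {1..n}"
      have td: "p tagged_division_of {0..1}"
        unfolding p_def K_def using a by (intro cell_tagged_division n1) (auto simp: K_def)
      have Kw: "real i / real n - (real i - 1) / real n = 1 / real n" for i
        by (simp add: diff_divide_distrib[symmetric])
      have le: "(real i - 1) / real n \<le> real i / real n" for i using n1 by (simp add: divide_le_cancel)
      have "1 / real n \<le> 1 / real n0" using n n0 by (intro divide_left_mono) auto
      also have "\<dots> < \<delta>" using n0 \<delta>(1) by (simp add: field_simps)
      finally have "diameter (K i) < \<delta>" for i
        unfolding K_def using Kw[of i] le[of i] by (simp add: diameter_closed_interval)
      then have fine: "\<forall>(x, K)\<in>p. diameter K < \<delta>" by (auto simp: p_def)
      have inj: "inj_on (\<lambda>i. (a i, K i)) {1..n}"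
      proof (rule inj_onI)
        fix i j assume "(a i, K i) = (a j, K j)"
        then have "real i / real n = real j / real n"
          using le[of i] le[of j] by (simp add: K_def Icc_eq_Icc)
        then show "i = j" using n1 by simp
      qed
      have "(\<Sum>(x, K)\<in>p. measure lborel K * H x) = (\<Sum>i\<in>{1..n}. measure lborel (K i) * H (a i))"
        unfolding p_def by (subst sum.reindex[OF inj]) simp
      also have "\<dots> = (\<Sum>i = 1..n. H (a i)) / real n"
        unfolding K_def using Kw le by (simp add: sum_divide_distrib)
      finally show ?thesis using \<delta>(2)[OF td fine] by simp
    qed
    have "\<bar>(\<Sum>i = 1..n. H (fst (z i))) / real n - J\<bar> < \<eta> / 4" "\<bar>(\<Sum>i = 1..n. H (snd (z i))) / real n - J\<bar> < \<eta> / 4"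
      using z(1) by (intro RS; force simp: mem_Times_iff)+
    then have "(\<Sum>i = 1..n. H (fst (z i))) / real n - (\<Sum>i = 1..n. H (snd (z i))) / real n < \<eta> / 2" by linarith
    then have small: "(\<Sum>i = 1..n. H (fst (z i)) - H (snd (z i))) / real n < \<eta> / 2"
      by (simp add: sum_subtractf diff_divide_distrib)
    have "(\<Sum>i = 1..n. w i) \<le> (\<Sum>i = 1..n. (H (fst (z i)) - H (snd (z i))) + \<eta> / 2)"
      using z(2) by (intro sum_mono) force
    also have "\<dots> = (\<Sum>i = 1..n. H (fst (z i)) - H (snd (z i))) + real n * (\<eta> / 2)"
      by (simp add: sum.distrib)
    finally have "(\<Sum>i = 1..n. w i) / real n \<le> ((\<Sum>i = 1..n. H (fst (z i)) - H (snd (z i))) + real n * (\<eta> / 2)) / real n"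
      by (rule divide_right_mono) simp
    also have "\<dots> = (\<Sum>i = 1..n. H (fst (z i)) - H (snd (z i))) / real n + \<eta> / 2"
      using n1 by (simp add: add_divide_distrib)
    finally have sm: "(\<Sum>i = 1..n. w i) / real n \<le> \<eta>" using small by linarith
    have osc: "\<bar>H x - H y\<bar> \<le> w i" if "i \<in> {1..n}" "x \<in> K i" "y \<in> K i" for i x y
    proof -
      have "H x - H y \<le> w i" "H y - H x \<le> w i"
        unfolding w_def using cSUP_upper[OF _ bdd[OF that(1)], of "(x, y)"] cSUP_upper[OF _ bdd[OF that(1)], of "(y, x)"] that by auto
      then show ?thesis by linarith
    qed
    show "\<exists>w. (\<forall>i\<in>{1..n}. \<forall>x\<in>{(real i - 1) / real n..real i / real n}.
      \<forall>y\<in>{(real i - 1) / real n..real i / real n}. \<bar>H x - H y\<bar> \<le> w i) \<and> (\<Sum>i = 1..n. w i) / real n \<le> \<eta>"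
      using osc sm unfolding K_def by blast
  qed (rule n0(2))
qed

section \<open>Concentration of block averages\<close>

lemma sum_blocks:
  fixes f :: "nat \<Rightarrow> 'a::comm_monoid_add"
  shows "(\<Sum>k = 1..n * m. f k) = (\<Sum>i = 1..n. \<Sum>r = 1..m. f ((i - 1) * m + r))"
proof (induction n)
  case (Suc n)
  have "(\<Sum>k = 1..Suc n * m. f k) = (\<Sum>k = 1..n * m + m. f k)" by (simp add: add.commute)
  also have "\<dots> = (\<Sum>k = 1..n * m. f k) + (\<Sum>k = n * m + 1..n * m + m. f k)"
    by (rule sum.ub_add_nat) simp
  also have "(\<Sum>k = n * m + 1..n * m + m. f k) = (\<Sum>r = 1..m. f (n * m + r))"
    using sum.shift_bounds_cl_nat_ivl[of f 1 "n * m" m] by (simp add: add.commute)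
  finally show ?case using Suc by simp
qed simp

lemma block_index:
  fixes i r m :: nat
  assumes "r \<in> {1..m}" "1 \<le> i"
  shows "((i - 1) * m + r - 1) div m + 1 = i"
proof -
  have "(i - 1) * m + r - 1 = (r - 1) + (i - 1) * m" using assms by simp
  moreover have "(r - 1) div m = 0" "m \<noteq> 0" using assms by auto
  moreover from this have "((r - 1) + (i - 1) * m) div m = i - 1"
    by (subst div_mult_self1) simp_all
  ultimately have "((i - 1) * m + r - 1) div m = i - 1" by (simp only:)
  then show ?thesis using assms(2) by (simp only: le_add_diff_inverse2)
qed

text \<open>
  A sum of \<open>n\<close> absolute values is the largest of the \<open>2\<^sup>n\<close> sums with signs \<open>\<plusminus>1\<close>.  For fixed signs, constant on
  each block, Hoeffding's inequality applies to all \<open>n * m\<close> variables together.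
\<close>

lemma (in prob_space) block_deviation_prob:
  fixes X :: "nat \<Rightarrow> 'a \<Rightarrow> 'b" and f :: "'b \<Rightarrow> real"
  assumes indep: "indep_vars (\<lambda>_. K) X {1..n * m}"
    and f: "f \<in> borel_measurable K" "\<And>x. \<bar>f x\<bar> \<le> c" and c: "c > 0" and n: "n \<ge> 1" and m: "m \<ge> 1" and \<eta>: "\<eta> \<ge> 0"
  defines "bad \<equiv> {\<omega> \<in> space M. \<eta> * real (n * m) \<le>
     (\<Sum>i = 1..n. \<bar>\<Sum>r = 1..m. f (X ((i - 1) * m + r) \<omega>) - expectation (\<lambda>\<omega>. f (X ((i - 1) * m + r) \<omega>))\<bar>)}"
  shows "bad \<in> events" "prob bad \<le> 2 ^ n * exp (- (\<eta>\<^sup>2 / (2 * c\<^sup>2)) * real (n * m))"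
proof -
  define Y where "Y = (\<lambda>k \<omega>. f (X k \<omega>))"
  have Yi: "indep_vars (\<lambda>_. borel) Y {1..n * m}"
    unfolding Y_def by (rule indep_vars_compose2[OF indep]) (rule f)
  have Ym: "random_variable borel (Y k)" if "k \<in> {1..n * m}" for k
    using Yi that by (simp add: indep_vars_def)
  have blk: "(i - 1) * m + r \<in> {1..n * m}" if "i \<in> {1..n}" "r \<in> {1..m}" for i r
  proof -
    have "(i - 1) * m + r \<le> (i - 1) * m + m" using that by simp
    also have "\<dots> = i * m" using that by (cases i) auto
    also have "\<dots> \<le> n * m" using that by simp
    finally show ?thesis using that by auto
  qed
  have Yb: "integrable M (Y k)" if "k \<in> {1..n * m}" for k
    using Ym[OF that] f(2) by (intro integrable_const_bound[of _ c]) (auto simp: Y_def)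
  have Ym': "Y ((i - 1) * m + r) \<in> borel_measurable M" if "i \<in> {1..n}" "r \<in> {1..m}" for i r
    using Ym[OF blk[OF that]] .
  show ev: "bad \<in> events"
  proof -
    have "(\<lambda>\<omega>. \<Sum>i = 1..n. \<bar>\<Sum>r = 1..m. f (X ((i - 1) * m + r) \<omega>) - expectation (\<lambda>\<omega>. f (X ((i - 1) * m + r) \<omega>))\<bar>) \<in> borel_measurable M"
      using Ym' by (intro borel_measurable_sum borel_measurable_abs borel_measurable_diff) (auto simp: Y_def)
    then show ?thesis unfolding bad_def by measurable
  qed
  \<comment> \<open>The sign of particle \<open>k\<close> depends on its block \<open>(k - 1) div m + 1\<close> only.\<close>
  define s where "s = (\<lambda>(S :: nat set) k. if (k - 1) div m + 1 \<in> S then 1 else - 1 :: real)"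
  define E where "E = (\<lambda>S. {\<omega> \<in> space M. (\<Sum>k\<in>{1..n * m}. s S k * Y k \<omega>)
      \<ge> (\<Sum>k\<in>{1..n * m}. expectation (\<lambda>\<omega>. s S k * Y k \<omega>)) + \<eta> * real (n * m)})"
  have E: "E S \<in> events" "prob (E S) \<le> exp (- (\<eta>\<^sup>2 / (2 * c\<^sup>2)) * real (n * m))" for S
  proof -
    have Zi: "indep_vars (\<lambda>_. borel) (\<lambda>k \<omega>. s S k * Y k \<omega>) {1..n * m}"
      by (rule indep_vars_compose2[OF Yi]) simp
    have Zb: "\<bar>s S k * Y k \<omega>\<bar> \<le> c" for k \<omega> using f(2) by (simp add: s_def Y_def)
    interpret H: Hoeffding_ineq M "{1..n * m}" "\<lambda>k \<omega>. s S k * Y k \<omega>" "\<lambda>_. - c" "\<lambda>_. c"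
      "\<Sum>k\<in>{1..n * m}. expectation (\<lambda>\<omega>. s S k * Y k \<omega>)"
      by unfold_locales (use Zi Zb in \<open>auto simp: abs_le_iff minus_le_iff\<close>)
    show "E S \<in> events"
    proof -
      have "(\<lambda>\<omega>. \<Sum>k\<in>{1..n * m}. s S k * Y k \<omega>) \<in> borel_measurable M"
        using Ym by (intro borel_measurable_sum borel_measurable_times) auto
      then show ?thesis unfolding E_def by measurable
    qed
    have card: "(\<Sum>k\<in>{1..n * m}. (c - - c)\<^sup>2) = real (n * m) * (4 * c\<^sup>2)"
      by (simp add: power2_eq_square)
    have pos: "real (n * m) * (4 * c\<^sup>2) > 0" using n m c by simp
    have "prob (E S) \<le> exp (- 2 * (\<eta> * real (n * m))\<^sup>2 / (\<Sum>k\<in>{1..n * m}. (c - - c)\<^sup>2))"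
      unfolding E_def using \<eta> pos card by (intro H.Hoeffding_ineq_ge) auto
    also have "- 2 * (\<eta> * real (n * m))\<^sup>2 / (\<Sum>k\<in>{1..n * m}. (c - - c)\<^sup>2)
      = - (\<eta>\<^sup>2 / (2 * c\<^sup>2)) * real (n * m)"
      unfolding card using n m c by (simp add: power2_eq_square field_simps)
    finally show "prob (E S) \<le> exp (- (\<eta>\<^sup>2 / (2 * c\<^sup>2)) * real (n * m))" .
  qed
  have sub: "bad \<subseteq> (\<Union>S\<in>Pow {1..n}. E S)"
  proof
    fix \<omega> assume w: "\<omega> \<in> bad"
    define D where "D = (\<lambda>i. \<Sum>r = 1..m. Y ((i - 1) * m + r) \<omega> - expectation (Y ((i - 1) * m + r)))"
    define S where "S = {i \<in> {1..n}. 0 \<le> D i}"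
    have "(\<Sum>k\<in>{1..n * m}. s S k * Y k \<omega>) - (\<Sum>k\<in>{1..n * m}. expectation (\<lambda>\<omega>. s S k * Y k \<omega>))
      = (\<Sum>k = 1..n * m. s S k * (Y k \<omega> - expectation (Y k)))"
      by (simp add: sum_subtractf right_diff_distrib)
    also have "\<dots> = (\<Sum>i = 1..n. \<Sum>r = 1..m. s S ((i - 1) * m + r) * (Y ((i - 1) * m + r) \<omega> - expectation (Y ((i - 1) * m + r))))"
      by (rule sum_blocks)
    also have "\<dots> = (\<Sum>i = 1..n. \<bar>D i\<bar>)"
    proof (rule sum.cong[OF refl])
      fix i assume i: "i \<in> {1..n}"
      have "(\<Sum>r = 1..m. s S ((i - 1) * m + r) * (Y ((i - 1) * m + r) \<omega> - expectation (Y ((i - 1) * m + r))))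
        = (\<Sum>r = 1..m. (if i \<in> S then 1 else - 1) * (Y ((i - 1) * m + r) \<omega> - expectation (Y ((i - 1) * m + r))))"
        using i block_index[of _ m i] by (intro sum.cong) (auto simp: s_def)
      also have "\<dots> = (if i \<in> S then 1 else - 1) * D i" unfolding D_def by (rule sum_distrib_left[symmetric])
      also have "\<dots> = \<bar>D i\<bar>" using i by (auto simp: S_def)
      finally show "(\<Sum>r = 1..m. s S ((i - 1) * m + r) * (Y ((i - 1) * m + r) \<omega> - expectation (Y ((i - 1) * m + r)))) = \<bar>D i\<bar>" .
    qed
    also have "\<dots> \<ge> \<eta> * real (n * m)" using w by (simp add: bad_def D_def Y_def)
    finally have "\<omega> \<in> E S" using w by (simp add: E_def bad_def)
    then show "\<omega> \<in> (\<Union>S\<in>Pow {1..n}. E S)" by (auto simp: S_def)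
  qed
  have "prob bad \<le> prob (\<Union>S\<in>Pow {1..n}. E S)"
    using E(1) sub by (intro finite_measure_mono sets.finite_UN) auto
  also have "\<dots> \<le> (\<Sum>S\<in>Pow {1..n}. prob (E S))"
    using E(1) by (intro finite_measure_subadditive_finite) auto
  also have "\<dots> \<le> (\<Sum>S\<in>Pow {1..n}. exp (- (\<eta>\<^sup>2 / (2 * c\<^sup>2)) * real (n * m)))"
    by (intro sum_mono E(2))
  also have "\<dots> = 2 ^ n * exp (- (\<eta>\<^sup>2 / (2 * c\<^sup>2)) * real (n * m))" by (simp add: card_Pow)
  finally show "prob bad \<le> 2 ^ n * exp (- (\<eta>\<^sup>2 / (2 * c\<^sup>2)) * real (n * m))" .
qed

text \<open>
  For large \<open>m\<close> the factor \<open>2\<^sup>n\<close> is absorbed and the bound depends on \<open>N = n * m\<close> only.  A number \<open>N\<close> has at most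
  \<open>N\<close> factorizations, so the events can be collected by \<open>N\<close> and are still summable.  Finally
  \<open>m \<ge> N0\<close> implies \<open>n * m \<ge> N0\<close> for all \<open>n \<ge> 1\<close>.
\<close>

lemma (in prob_space) borel_cantelli_rectangles:
  assumes ev: "\<And>n m. n \<ge> 1 \<Longrightarrow> m \<ge> 1 \<Longrightarrow> bad n m \<in> events"
    and p: "\<And>n m. n \<ge> 1 \<Longrightarrow> m \<ge> 1 \<Longrightarrow> prob (bad n m) \<le> 2 ^ n * exp (- a * real (n * m))"
    and a: "a > 0"
  shows "AE \<omega> in M. \<exists>m1\<ge>1. \<forall>n\<ge>1. \<forall>m\<ge>m1. \<omega> \<notin> bad n m"
proof -
  obtain k :: nat where "2 * ln 2 / a \<le> real k" using real_arch_simple by blast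
  then obtain m0 :: nat where m0: "real m0 \<ge> 2 * ln 2 / a" "m0 \<ge> 1"
    using that[of "Suc k"] by simp
  have p2: "prob (bad n m) \<le> exp (- (a / 2) * real (n * m))" if nm: "n \<ge> 1" "m \<ge> m0" for n m
  proof -
    have "2 * ln 2 / a \<le> real m" using m0 nm by linarith
    then have "ln 2 \<le> (a / 2) * real m" using a by (simp add: field_simps)
    then have "2 \<le> exp ((a / 2) * real m)" by (metis exp_le_cancel_iff exp_ln zero_less_numeral)
    then have "2 ^ n \<le> exp ((a / 2) * real m) ^ n" by (intro power_mono) auto
    also have "\<dots> = exp ((a / 2) * real (n * m))" by (simp add: exp_of_nat_mult[symmetric] mult_ac)
    finally have "2 ^ n * exp (- a * real (n * m)) \<le> exp ((a / 2) * real (n * m)) * exp (- a * real (n * m))"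
      by (intro mult_right_mono) auto
    also have "\<dots> = exp (- (a / 2) * real (n * m))" by (simp add: exp_add[symmetric] algebra_simps)
    finally show ?thesis using p[of n m] nm m0 by linarith
  qed
  define B where "B = (\<lambda>N. \<Union>n\<in>{1..N}. if n dvd N \<and> m0 \<le> N div n then bad n (N div n) else {})"
  have Bev: "B N \<in> events" for N
    unfolding B_def using ev m0 by (intro sets.finite_UN) auto
  have PB: "prob (B N) \<le> real N * exp (- (a / 2) * real N)" for N
  proof -
    have "prob (B N) \<le> (\<Sum>n\<in>{1..N}. prob (if n dvd N \<and> m0 \<le> N div n then bad n (N div n) else {}))"
      unfolding B_def using ev m0 by (intro finite_measure_subadditive_finite) auto
    also have "\<dots> \<le> (\<Sum>n\<in>{1..N}. exp (- (a / 2) * real N))"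
    proof (rule sum_mono)
      fix n assume n: "n \<in> {1..N}"
      show "prob (if n dvd N \<and> m0 \<le> N div n then bad n (N div n) else {}) \<le> exp (- (a / 2) * real N)"
        using p2[of n "N div n"] n by auto
    qed
    finally show ?thesis by simp
  qed
  have "summable (\<lambda>N. prob (B N))"
  proof (rule summable_comparison_test')
    have "summable (\<lambda>N. exp (- a / 4) ^ N)" using a by (intro summable_geometric) simp
    then show "summable (\<lambda>N. (4 / a) * exp (- a / 4) ^ N)" by (rule summable_mult)
    fix N :: nat assume "N \<ge> 0"
    have "(a / 4) * real N \<le> exp ((a / 4) * real N)" using exp_ge_add_one_self[of "(a / 4) * real N"] by linarith
    then have "real N \<le> (4 / a) * exp ((a / 4) * real N)" using a by (simp add: field_simps)
    then have "real N * exp (- (a / 2) * real N) \<le> ((4 / a) * exp ((a / 4) * real N)) * exp (- (a / 2) * real N)"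
      by (intro mult_right_mono) auto
    also have "\<dots> = (4 / a) * exp (- a / 4) ^ N"
      by (simp add: exp_of_nat_mult[symmetric] exp_add[symmetric] algebra_simps)
    finally show "norm (prob (B N)) \<le> (4 / a) * exp (- a / 4) ^ N" using PB[of N] by simp
  qed
  then have "AE \<omega> in M. eventually (\<lambda>N. \<omega> \<in> space M - B N) sequentially"
    using Bev by (intro borel_cantelli_AE1) (auto simp: emeasure_eq_measure)
  then show ?thesis
  proof eventually_elim
    case (elim \<omega>)
    then obtain N0 where N0: "\<And>N. N \<ge> N0 \<Longrightarrow> \<omega> \<notin> B N" by (auto simp: eventually_sequentially)
    have "\<omega> \<notin> bad n m" if nm: "n \<ge> 1" "m \<ge> max m0 N0" for n m
    proof -
      have "m \<le> n * m" using nm by simp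
      then have "N0 \<le> n * m" using nm by (meson max.boundedE order_trans)
      then have "\<omega> \<notin> B (n * m)" by (rule N0)
      moreover have "n \<in> {1..n * m}" using nm m0 by auto
      ultimately show ?thesis using nm unfolding B_def by force
    qed
    then show ?case using m0 by (intro exI[of _ "max m0 N0"]) auto
  qed
qed

section \<open>Propagation of the error\<close>

lemma rmod_measurable_circle: "(\<lambda>j. \<theta> j rmod (2 * pi)) \<in> uniform_count_measure {1..m} \<rightarrow>\<^sub>M circle_borel"
  using rmod_in_circ
  by (auto simp: measurable_def sets_uniform_count_measure space_uniform_count_measure space_circle_borel)

lemma empirical_prob:
  assumes m: "m \<ge> 1"
  shows "prob_space (empirical m \<theta>)" "sets (empirical m \<theta>) = sets circle_borel"
    and "periodic_lipschitz L f \<Longrightarrow> (LINT x|empirical m \<theta>. f x) = (\<Sum>j = 1..m. f (\<theta> j)) / real m"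
proof -
  show "prob_space (empirical m \<theta>)"
    unfolding empirical_def using m
    by (intro prob_space.prob_space_distr prob_space_uniform_count_measure rmod_measurable_circle) auto
  show "sets (empirical m \<theta>) = sets circle_borel" by (simp add: empirical_def)
  assume f: "periodic_lipschitz L f"
  have "f \<in> borel_measurable borel"
    using f periodic_lipschitz_circ_continuous circ_continuous_measurable by blast
  then have "f \<in> borel_measurable circle_borel" unfolding circle_borel_def by (rule measurable_restrict_space1)
  then have "(LINT x|empirical m \<theta>. f x) = (LINT j|uniform_count_measure {1..m}. f (\<theta> j rmod (2 * pi)))"
    unfolding empirical_def by (rule integral_distr[OF rmod_measurable_circle])
  also have "\<dots> = (LINT j|uniform_count_measure {1..m}. f (\<theta> j))"
    using f by (simp add: periodic_rmod periodic_lipschitz_def)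
  also have "\<dots> = (\<Sum>j = 1..m. f (\<theta> j)) / real m"
    unfolding uniform_count_measure_def by (subst lebesgue_integral_point_measure_finite) (auto simp: sum_divide_distrib)
  finally show "(LINT x|empirical m \<theta>. f x) = (\<Sum>j = 1..m. f (\<theta> j)) / real m" .
qed

lemma circ_density_prob:
  assumes g: "integrable (lebesgue_on circ) g" "AE u in lebesgue_on circ. 0 \<le> g u" "(LINT u|lebesgue_on circ. g u) = 1"
  shows "prob_space (circ_density g)" "sets (circ_density g) = sets circle_borel"
    and "f \<in> borel_measurable borel \<Longrightarrow> (LINT u|circ_density g. f u) = (LINT u|lebesgue_on circ. g u * f u)"
proof -
  have gm: "g \<in> borel_measurable (lebesgue_on circ)" using g(1) by simp
  have id: "(\<lambda>u. u) \<in> lebesgue_on circ \<rightarrow>\<^sub>M circle_borel"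
  proof (rule measurableI)
    fix B assume "B \<in> sets circle_borel"
    then show "(\<lambda>u. u) -` B \<inter> space (lebesgue_on circ) \<in> sets (lebesgue_on circ)"
      by (auto simp: circle_borel_def sets_restrict_space_iff circ_def space_restrict_space)
  qed (simp add: circle_borel_def space_restrict_space)
  then have id': "(\<lambda>u. u) \<in> density (lebesgue_on circ) (\<lambda>u. ennreal (g u)) \<rightarrow>\<^sub>M circle_borel" by simp
  have "prob_space (density (lebesgue_on circ) (\<lambda>u. ennreal (g u)))"
  proof
    have "(\<integral>\<^sup>+u. ennreal (g u) \<partial>lebesgue_on circ) = 1"
      using nn_integral_eq_integral[OF g(1,2)] g(3) by simp
    then show "emeasure (density (lebesgue_on circ) (\<lambda>u. ennreal (g u))) (space (density (lebesgue_on circ) (\<lambda>u. ennreal (g u)))) = 1"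
      using emeasure_density[of "\<lambda>u. ennreal (g u)" "lebesgue_on circ" "space (lebesgue_on circ)"] gm
        nn_integral_cong[of "lebesgue_on circ" "\<lambda>u. ennreal (g u) * indicator (space (lebesgue_on circ)) u" "\<lambda>u. ennreal (g u)"]
      by (simp only: space_density sets.top) (simp del: space_restrict_space)
  qed
  then show "prob_space (circ_density g)"
    unfolding circ_density_def using id' by (rule prob_space.prob_space_distr)
  show "sets (circ_density g) = sets circle_borel" by (simp add: circ_density_def)
  assume f: "f \<in> borel_measurable borel"
  have fc: "f \<in> borel_measurable circle_borel" using f unfolding circle_borel_def by (rule measurable_restrict_space1)
  have fL: "f \<in> borel_measurable (lebesgue_on circ)"
    using f by (intro measurable_restrict_space1 measurable_completion) simp
  have "(LINT u|circ_density g. f u) = (LINT u|density (lebesgue_on circ) (\<lambda>u. ennreal (g u)). f u)"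
    unfolding circ_density_def by (rule integral_distr[OF id' fc])
  also have "\<dots> = (LINT u|lebesgue_on circ. g u *\<^sub>R f u)"
    by (rule integral_density[OF fL gm g(2)])
  finally show "(LINT u|circ_density g. f u) = (LINT u|lebesgue_on circ. g u * f u)" by simp
qed

lemma emp_family_cell:
  assumes "n \<ge> 1" "i \<in> {1..n}" "x \<in> cell n i"
  shows "emp_family n m \<theta> x = empirical m (\<lambda>j. \<theta> ((i - 1) * m + j))"
proof -
  have "(THE i. i \<in> {1..n} \<and> x \<in> cell n i) = i"
    using assms cell_unique[OF assms(1), of x] by (intro the_equality) auto
  then show ?thesis by (simp add: emp_family_def)
qed

lemma double_LINT_bound:
  fixes w :: "real \<Rightarrow> real \<Rightarrow> real"
  assumes w: "\<And>x. w x \<in> borel_measurable borel" "\<And>x y. \<bar>w x y\<bar> \<le> 1" and N: "N \<ge> 1"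
  shows "\<bar>(real N)\<^sup>2 * (LINT x:cell N k|lborel. LINT y:cell N j|lborel. w x y)\<bar> \<le> 1"
proof -
  have one: "\<bar>LINT y:cell N j|lborel. f y\<bar> \<le> c / real N" if "\<And>y. \<bar>f y\<bar> \<le> c" for f :: "real \<Rightarrow> real" and c j
  proof -
    have "norm (LINT y|lborel. indicator (cell N j) y *\<^sub>R f y) \<le> (LINT y|lborel. indicator (cell N j) y * c)"
    proof (cases "integrable lborel (\<lambda>y. indicator (cell N j) y *\<^sub>R f y)")
      case True
      show ?thesis
      proof (rule Bochner_Integration.integral_norm_bound_integral[OF True])
        show "integrable lborel (\<lambda>y. indicator (cell N j) y * c)"
          using N by (simp add: cell_def divide_right_mono)
        show "norm (indicator (cell N j) y *\<^sub>R f y) \<le> indicator (cell N j) y * c" for y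
          using that[of y] by (simp add: indicator_def)
      qed
    next
      case False
      have "0 \<le> c" using that[of 0] by linarith
      then have "0 \<le> (LINT y|lborel. indicator (cell N j) y * c)" by (intro integral_nonneg_AE) auto
      then show ?thesis using False by (simp add: not_integrable_integral_eq)
    qed
    also have "\<dots> = c / real N" using LINT_cell_const[OF N, of j c] by (simp add: set_lebesgue_integral_def)
    finally show ?thesis by (simp add: set_lebesgue_integral_def)
  qed
  have "\<bar>LINT x:cell N k|lborel. LINT y:cell N j|lborel. w x y\<bar> \<le> (1 / real N) / real N"
    by (intro one w(2))
  then have "(real N)\<^sup>2 * \<bar>LINT x:cell N k|lborel. LINT y:cell N j|lborel. w x y\<bar> \<le> (real N)\<^sup>2 * ((1 / real N) / real N)"
    by (rule mult_left_mono) simp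
  also have "\<dots> = 1" using N by (simp add: power2_eq_square)
  finally show ?thesis by (simp add: abs_mult)
qed

text \<open>
  The upper bound holds for arbitrary \<open>f\<close>, because the integral of a function that is not integrable is \<open>0\<close>.
  It will be applied to \<open>meas_dist\<close> as a function of the position.
\<close>

lemma LINT_le_if_AE_le:
  fixes f g :: "real \<Rightarrow> real"
  assumes A: "A \<in> sets borel" and g: "set_integrable lborel A g" "0 \<le> (LINT x:A|lborel. g x)"
    and ae: "AE x in lborel. x \<in> A \<longrightarrow> f x \<le> g x"
  shows "(LINT x|lebesgue_on A. f x) \<le> (LINT x:A|lborel. g x)"
proof (cases "integrable (lebesgue_on A) f")
  case True
  have AL: "A \<in> sets lebesgue" using A by simp
  have gI: "integrable (lebesgue_on A) g"
    using set_integrable_lebesgue(1)[OF g(1)] AL by (simp add: LINT_lebesgue_on_eq(2))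
  have "AE x in lebesgue_on A. f x \<le> g x"
    using AE_completion[OF ae] AL by (subst AE_restrict_space_iff) auto
  then have "(LINT x|lebesgue_on A. f x) \<le> (LINT x|lebesgue_on A. g x)"
    by (rule integral_mono_AE[OF True gI])
  then show ?thesis using set_integrable_lebesgue(2)[OF g(1)] by (simp add: LINT_lebesgue_on_eq(1)[OF AL])
next
  case False
  then show ?thesis using g(2) by (simp add: not_integrable_integral_eq)
qed

lemma AE_cells:
  assumes "n \<ge> 1"
  shows "AE x in lborel. x \<in> {0..1} \<longrightarrow> (\<exists>i\<in>{1..n}. x \<in> cell n i)"
proof -
  have "AE x in lborel. x \<noteq> (1::real)" by (rule AE_lborel_singleton)
  then show ?thesis by eventually_elim (use cell_exists[OF assms] in auto)
qed

context mean_field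
begin

lemma W_avg_eq:
  assumes k: "k \<in> {1..N}" and j: "j \<in> {1..N}"
  shows "W_avg W N k j = (real N)\<^sup>2 * (LINT x:cell N k|lborel. LINT y:cell N j|lborel. w x y)"
proof -
  have N: "N \<ge> 1" using k by simp
  define Q where "Q = cell N k \<times> cell N j"
  have Qb: "Q \<in> sets borel" unfolding Q_def by (intro borel_Times) (auto simp: cell_def)
  have Qs: "Q \<subseteq> {0..1} \<times> {0..1}" using cell_subset[OF k] cell_subset[OF j] by (force simp: Q_def)
  have Qf: "emeasure lborel Q < \<infinity>"
  proof -
    have "emeasure lborel Q \<le> emeasure lborel ({0..1::real} \<times> {0..1::real})" using Qs by (intro emeasure_mono) (auto simp: borel_Times)
    also have "\<dots> < \<infinity>" unfolding lborel_prod[symmetric] by (subst lborel.emeasure_pair_measure_Times) auto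
    finally show ?thesis .
  qed
  have I: "integrable lborel (\<lambda>z. indicator Q z * w (fst z) (snd z))"
    using set_integrable_bounded[OF w_spec(1) w_spec(2) Qb Qf] by (simp add: set_integrable_def)
  have "(LINT (x, y)|lebesgue_on (cell N k \<times> cell N j). W x y) = (LINT z|lborel. indicator Q z * w (fst z) (snd z))"
    unfolding Q_def[symmetric]
  proof (rule LINT_lebesgue_on_borel(1)[OF Qb])
    show "(\<lambda>z. indicator Q z * w (fst z) (snd z)) \<in> borel_measurable borel" using w_spec(1) Qb by simp
    show "AE z in lborel. z \<in> Q \<longrightarrow> (case z of (x, y) \<Rightarrow> W x y) = indicator Q z * w (fst z) (snd z)"
      using w_spec(3) by eventually_elim (use Qs in \<open>auto simp: case_prod_beta'\<close>)
  qed simp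
  also have "\<dots> = (LINT x|lborel. LINT y|lborel. indicator Q (x, y) * w x y)"
    using lborel_pair.integral_fst'[of "\<lambda>z. indicator Q z * w (fst z) (snd z)"] I by (simp add: lborel_prod)
  also have "\<dots> = (LINT x:cell N k|lborel. LINT y:cell N j|lborel. w x y)"
    unfolding set_lebesgue_integral_def
    by (intro Bochner_Integration.integral_cong refl)
       (auto simp: Q_def indicator_def intro!: Bochner_Integration.integral_cong)
  finally show ?thesis by (simp add: W_avg_def)
qed

text \<open>
  The deterministic part: \<open>d0\<close> bounds the initial error in each block, and \<open>H\<close> the error of the kernel.
  
  The particle \<open>k\<close> in block \<open>i\<close> moves with velocity \<open>U k\<close>.  For \<open>x\<close> in cell \<open>i\<close> it is compared with \<open>VE\<close>, the
  velocity at \<open>x\<close> that the empirical measures generate through the exact kernel; the difference is at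
  most \<open>\<delta> k x\<close>.  In turn \<open>VE\<close> is compared with \<open>drift\<close>.  Their difference \<open>gap\<close> is an average over \<open>y\<close> of
  differences between empirical and continuous expectations of the \<open>1\<close>-Lipschitz observable
  \<open>v \<mapsto> D (v - u)\<close>, the very quantity to be estimated.
\<close>

theorem error_propagation:
  fixes \<theta> :: "nat \<Rightarrow> real \<Rightarrow> real" and d0 :: "nat \<Rightarrow> real" and H :: "real \<Rightarrow> real"
  assumes n: "n \<ge> 1" and m: "m \<ge> 1"
    and sol: "discrete_solution T W D (n * m) \<theta>0 \<theta>"
    and init: "\<And>i x g. i \<in> {1..n} \<Longrightarrow> x \<in> cell n i \<Longrightarrow> good x \<Longrightarrow> periodic_lipschitz 1 g \<Longrightarrow> g 0 = 0 \<Longrightarrow>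
      \<bar>obs x 0 g - (\<Sum>r = 1..m. g (\<theta>0 ((i - 1) * m + r))) / real m\<bar> \<le> d0 i"
    and d0: "\<And>i. 0 \<le> d0 i" "(\<Sum>i = 1..n. d0 i) / real n \<le> a"
    and H: "set_integrable lborel {0..1} H" "\<And>x. 0 \<le> H x" "(LINT x:{0..1}|lborel. H x) \<le> h"
    and HW: "\<And>i x. i \<in> {1..n} \<Longrightarrow> x \<in> cell n i \<Longrightarrow> (\<Sum>r = 1..m. \<Sum>i' = 1..n. \<Sum>r' = 1..m.
       \<bar>(real (n * m))\<^sup>2 * (LINT x:cell (n * m) ((i - 1) * m + r)|lborel. LINT y:cell (n * m) ((i' - 1) * m + r')|lborel. w x y)
         - real n * (LINT y:cell n i'|lborel. w x y)\<bar>) / (real m * real (n * m)) \<le> H x"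
    and t: "t \<in> {0..T}"
  shows "fam_dist (emp_family n m (\<lambda>k. \<theta> k t)) (\<lambda>x. circ_density (\<lambda>v. \<rho> t v x))
    \<le> 2 * exp T * exp (2 * exp T * T) * (a + T * h)"
proof -
  define N where "N = n * m"
  have N: "N \<ge> 1" using n m by (simp add: N_def)
  define idx where "idx = (\<lambda>i r. (i - 1) * m + r)"
  have idx: "idx i r \<in> {1..N}" if "i \<in> {1..n}" "r \<in> {1..m}" for i r
  proof -
    have "(i - 1) * m + r \<le> (i - 1) * m + m" using that by simp
    also have "\<dots> = i * m" using that by (cases i) auto
    also have "\<dots> \<le> n * m" using that by simp
    finally show ?thesis using that by (auto simp: N_def idx_def)
  qed
  have sumN: "(\<Sum>k = 1..N. f k) = (\<Sum>i = 1..n. \<Sum>r = 1..m. f (idx i r))" for f :: "nat \<Rightarrow> real"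
    unfolding N_def idx_def by (rule sum_blocks)
  define C where "C = exp T"
  have C: "C \<ge> 1" using T_pos by (simp add: C_def)
  define WA where "WA = (\<lambda>k j. (real N)\<^sup>2 * (LINT x:cell N k|lborel. LINT y:cell N j|lborel. w x y))"
  have wm: "w x \<in> borel_measurable borel" for x by measurable
  have WA1: "\<bar>WA k j\<bar> \<le> 1" for k j
    unfolding WA_def by (rule double_LINT_bound[OF wm w_spec(2) N])
  define U where "U = (\<lambda>k s. (\<Sum>j = 1..N. WA k j * D (\<theta> j s - \<theta> k s)) / real N)"
  have \<theta>: "\<theta> k 0 = \<theta>0 k" "\<And>s. s \<in> {0..T} \<Longrightarrow> (\<theta> k has_real_derivative U k s) (at s within {0..T})"
    if k: "k \<in> {1..N}" for k
  proof -
    show "\<theta> k 0 = \<theta>0 k" using sol k unfolding discrete_solution_def N_def by blast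
    fix s assume s: "s \<in> {0..T}"
    have "(\<theta> k has_real_derivative (\<Sum>j = 1..N. W_avg W N k j * D (\<theta> j s - \<theta> k s)) / real N) (at s within {0..T})"
      using sol k s unfolding discrete_solution_def N_def by blast
    then show "(\<theta> k has_real_derivative U k s) (at s within {0..T})"
      unfolding U_def WA_def using W_avg_eq[OF k] by simp
  qed
  have \<theta>c: "continuous_on {0..T} (\<theta> k)" if "k \<in> {1..N}" for k
    using \<theta>(2)[OF that] by (meson DERIV_continuous continuous_on_eq_continuous_within)
  have Dc: "continuous_on UNIV D" using periodic_lipschitz_continuous[OF D_shift(2)[of 0], of UNIV] by simp
  have U1: "\<bar>U k s\<bar> \<le> 1" for k s
  proof -
    have "\<bar>\<Sum>j = 1..N. WA k j * D (\<theta> j s - \<theta> k s)\<bar> \<le> (\<Sum>j = 1..N. \<bar>WA k j * D (\<theta> j s - \<theta> k s)\<bar>)" by (rule sum_abs)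
    also have "\<dots> \<le> (\<Sum>j = 1..N. 1)"
      unfolding abs_mult using WA1 D_bound by (intro sum_mono mult_le_one) auto
    finally show ?thesis using N by (simp add: U_def abs_divide)
  qed
  have Uc: "continuous_on {0..T} (U k)" if "k \<in> {1..N}" for k
    unfolding U_def
    by (intro continuous_intros continuous_on_compose2[OF Dc] \<theta>c that) (use N in auto)
  have path: "velocity_field.path T (\<theta> k) (U k)" if "k \<in> {1..N}" for k
    unfolding velocity_field.path_def[OF field_drift] using Uc[OF that] U1 \<theta>(2)[OF that] by blast
  define E where "E = (\<lambda>s i f. (\<Sum>r = 1..m. f (\<theta> (idx i r) s)) / real m)"
  define VE where "VE = (\<lambda>s u x. \<Sum>i' = 1..n. (LINT y:cell n i'|lborel. w x y) * E s i' (\<lambda>v. D (v - u)))"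
  define \<delta> where "\<delta> = (\<lambda>k x. (\<Sum>i' = 1..n. \<Sum>r' = 1..m. \<bar>WA k (idx i' r') - real n * (LINT y:cell n i'|lborel. w x y)\<bar>) / real N)"
  have E1: "\<bar>E s i f\<bar> \<le> c" if "\<And>u. \<bar>f u\<bar> \<le> c" for s i f c
  proof -
    have "\<bar>\<Sum>r = 1..m. f (\<theta> (idx i r) s)\<bar> \<le> (\<Sum>r = 1..m. \<bar>f (\<theta> (idx i r) s)\<bar>)" by (rule sum_abs)
    also have "\<dots> \<le> (\<Sum>r = 1..m. c)" by (intro sum_mono that)
    finally show ?thesis using m by (simp add: E_def abs_divide field_simps)
  qed
  have cellw: "set_integrable lborel (cell n i) (w x)" and unitw: "set_integrable lborel {0..1} (w x)" for i x
    using n by (auto intro!: set_integrable_bounded[OF wm w_spec(2)] simp: cell_def divide_right_mono)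
  have UVE: "\<bar>U k s - VE s (\<theta> k s) x\<bar> \<le> \<delta> k x" for k s x
  proof -
    have "U k s - VE s (\<theta> k s) x
      = (\<Sum>i' = 1..n. \<Sum>r' = 1..m. (WA k (idx i' r') - real n * (LINT y:cell n i'|lborel. w x y)) * D (\<theta> (idx i' r') s - \<theta> k s)) / real N"
    proof -
      have "VE s (\<theta> k s) x = (\<Sum>i' = 1..n. \<Sum>r' = 1..m. (real n * (LINT y:cell n i'|lborel. w x y)) * D (\<theta> (idx i' r') s - \<theta> k s)) / real N"
        unfolding VE_def E_def N_def using n m by (simp add: sum_distrib_left sum_divide_distrib)
      then show ?thesis
        unfolding U_def sumN by (simp add: left_diff_distrib sum_subtractf diff_divide_distrib)
    qed
    also have "\<bar>\<dots>\<bar> \<le> \<delta> k x"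
    proof -
      have "\<bar>\<Sum>i' = 1..n. \<Sum>r' = 1..m. (WA k (idx i' r') - real n * (LINT y:cell n i'|lborel. w x y)) * D (\<theta> (idx i' r') s - \<theta> k s)\<bar>
        \<le> (\<Sum>i' = 1..n. \<Sum>r' = 1..m. \<bar>(WA k (idx i' r') - real n * (LINT y:cell n i'|lborel. w x y)) * D (\<theta> (idx i' r') s - \<theta> k s)\<bar>)"
        by (intro order_trans[OF sum_abs] sum_mono sum_abs)
      also have "\<dots> \<le> (\<Sum>i' = 1..n. \<Sum>r' = 1..m. \<bar>WA k (idx i' r') - real n * (LINT y:cell n i'|lborel. w x y)\<bar>)"
        unfolding abs_mult using D_bound by (intro sum_mono mult_left_le) auto
      finally show ?thesis by (simp add: \<delta>_def abs_divide divide_right_mono)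
    qed
    finally show ?thesis .
  qed
  have \<delta>0: "0 \<le> \<delta> k x" for k x unfolding \<delta>_def by (intro divide_nonneg_nonneg sum_nonneg) auto
  have \<delta>H: "(\<Sum>r = 1..m. \<delta> (idx i r) x) / real m \<le> H x" if "i \<in> {1..n}" "x \<in> cell n i" for i x
  proof -
    have "(\<Sum>r = 1..m. \<delta> (idx i r) x) / real m = (\<Sum>r = 1..m. \<Sum>i' = 1..n. \<Sum>r' = 1..m.
       \<bar>(real N)\<^sup>2 * (LINT x:cell N ((i - 1) * m + r)|lborel. LINT y:cell N ((i' - 1) * m + r')|lborel. w x y)
         - real n * (LINT y:cell n i'|lborel. w x y)\<bar>) / (real m * real N)"
      unfolding \<delta>_def WA_def idx_def sum_divide_distrib[symmetric] by (simp add: mult.commute)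
    then show ?thesis using HW[OF that] by (simp only: N_def)
  qed
  define G where "G = {s \<in> {0..T}. mass s < \<infinity> \<and> R s \<le> 1 \<and>
     (AE y in lborel. y \<in> {0..1} \<longrightarrow> good y \<and> (\<forall>u. force s u y = obs y s (\<lambda>v. D (v - u))))}"
  have GAE: "AE s in lborel. s \<in> {0..T} \<longrightarrow> s \<in> G"
    using slice_AE by eventually_elim (auto simp: G_def)
  define gap where "gap = (\<lambda>s u x. \<bar>VE s u x - drift s u x\<bar>)"
  have VE1: "\<bar>VE s u x\<bar> \<le> 1" for s u x
  proof -
    have c: "\<bar>LINT y:cell n i'|lborel. w x y\<bar> \<le> 1 / real n" for i'
    proof -
      have "\<bar>LINT y:cell n i'|lborel. w x y\<bar> \<le> (LINT y:cell n i'|lborel. norm (w x y))"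
        using set_integral_norm_bound[OF cellw] by simp
      also have "\<dots> \<le> (LINT y:cell n i'|lborel. 1)"
        using w_spec(2) n by (intro set_integral_mono set_integrable_norm cellw) (auto simp: set_integrable_def cell_def divide_right_mono)
      also have "\<dots> = 1 / real n" by (rule LINT_cell_const[OF n])
      finally show ?thesis .
    qed
    have "\<bar>VE s u x\<bar> \<le> (\<Sum>i' = 1..n. \<bar>(LINT y:cell n i'|lborel. w x y) * E s i' (\<lambda>v. D (v - u))\<bar>)"
      unfolding VE_def by (rule sum_abs)
    also have "\<dots> \<le> (\<Sum>i' = 1..n. (1 / real n) * 1)"
      unfolding abs_mult using c D_bound by (intro sum_mono mult_mono E1) auto
    finally show ?thesis using n by simp
  qed
  have drift1: "\<bar>drift s u x\<bar> \<le> 1" for s u x using V_bound[of s u x] by (auto simp: drift_def)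
  \<comment> \<open>The largest gap with weight \<open>exp (- 2 C s)\<close>.  A gap of \<open>S exp (2 C s)\<close> contributes, after integration in
     time and multiplication by \<open>C\<close>, only \<open>S exp (2 C t) / 2\<close>, so that \<open>S \<le> A + S / 2\<close> follows below.
     This takes the place of Gronwall's lemma.\<close>
  define Z where "Z = insert 0 ((\<lambda>(s, u, x). exp (- 2 * C * s) * gap s u x) ` (G \<times> UNIV \<times> UNIV))"
  have Zb: "bdd_above Z"
  proof (rule bdd_aboveI)
    fix z assume "z \<in> Z"
    then consider "z = 0" | s u x where "s \<in> G" "z = exp (- 2 * C * s) * gap s u x" by (auto simp: Z_def)
    then show "z \<le> 2"
    proof cases
      case 2
      have "gap s u x \<le> 2" unfolding gap_def using VE1[of s u x] drift1[of s u x] by linarith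
      moreover have "exp (- 2 * C * s) \<le> 1" using 2 C by (auto simp: G_def)
      ultimately have "exp (- 2 * C * s) * gap s u x \<le> 1 * 2" by (intro mult_mono) (auto simp: gap_def)
      then show ?thesis using 2 by simp
    qed simp
  qed
  define S where "S = Sup Z"
  have S0: "0 \<le> S" unfolding S_def by (rule cSup_upper[OF _ Zb]) (simp add: Z_def)
  have Sgap: "gap s u x \<le> S * exp (2 * C * s)" if "s \<in> G" for s u x
  proof -
    have "exp (- 2 * C * s) * gap s u x \<in> Z"
      unfolding Z_def by (rule insertI2, rule image_eqI[of _ _ "(s, u, x)"]) (use that in auto)
    then have "exp (- 2 * C * s) * gap s u x \<le> S"
      unfolding S_def by (rule cSup_upper[OF _ Zb])
    then have "exp (- 2 * C * s) * gap s u x * exp (2 * C * s) \<le> S * exp (2 * C * s)" by (rule mult_right_mono) simp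
    moreover have "exp (- 2 * C * s) * gap s u x * exp (2 * C * s) = gap s u x * (exp (- 2 * C * s) * exp (2 * C * s))"
      by (simp only: mult_ac)
    moreover have "exp (- 2 * C * s) * exp (2 * C * s) = 1" by (simp add: exp_add[symmetric])
    ultimately show ?thesis by (simp only: mult_1_right)
  qed
  define Q where "Q = (\<lambda>s i x. C * (d0 i + T * H x) + S * exp (2 * C * s) / 2)"
  have main: "\<bar>obs x s f - E s i f\<bar> \<le> Q s i x"
    if s: "s \<in> {0..T}" and i: "i \<in> {1..n}" and x: "x \<in> cell n i" "good x" and f: "periodic_lipschitz 1 f" for s i x f
  proof (rule field_le_epsilon)
    fix e :: real assume e: "e > 0"
    then have e2: "e / 2 > 0" by simp
    obtain g where g: "periodic_lipschitz (exp T) g" "\<bar>obs x s f - obs x 0 g\<bar> \<le> e / 2"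
      "\<And>\<theta> U. velocity_field.path T \<theta> U \<Longrightarrow>
        \<bar>f (\<theta> s) - g (\<theta> 0)\<bar> \<le> exp T * (LINT s:{0..s}|lborel. \<bar>U s - drift s (\<theta> s) x\<bar>) + e / 2"
      using good_duality[OF x(2) f s e2] by blast
    have 1: "\<bar>obs x 0 g - E 0 i g\<bar> \<le> C * d0 i"
    proof -
      \<comment> \<open>The hypothesis on the initial error concerns \<open>1\<close>-Lipschitz functions that vanish at \<open>0\<close>.\<close>
      define g1 where "g1 = (\<lambda>u. (g u - g 0) / C)"
      have g1: "periodic_lipschitz 1 g1"
        using g(1) C unfolding periodic_lipschitz_def g1_def C_def[symmetric]
        by (auto simp: diff_divide_distrib[symmetric] abs_divide divide_le_eq mult.commute)
      have E0: "E 0 i k = (\<Sum>r = 1..m. k (\<theta>0 ((i - 1) * m + r))) / real m" for k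
        unfolding E_def using \<theta>(1) idx[OF i] by (simp add: idx_def)
      have T0: "0 \<in> {0..T}" using T_pos by simp
      have "obs x 0 g1 = (obs x 0 g - g 0) / C"
      proof -
        have "obs x 0 g1 = (LINT u|lebesgue_on circ. (\<rho> 0 u x * g u - \<rho> 0 u x * g 0) / C)"
          unfolding obs_def g1_def by (simp add: right_diff_distrib)
        also have "\<dots> = (obs x 0 g - g 0) / C"
          using integrable_mult_circ_continuous[OF goodD(2)[OF x(2) T0] periodic_lipschitz_circ_continuous[OF g(1)]]
            goodD(2)[OF x(2) T0] good_density(2)[OF x(2) T0] by (simp add: obs_def)
        finally show ?thesis .
      qed
      moreover have "E 0 i g1 = (E 0 i g - g 0) / C"
        unfolding E_def g1_def using m by (simp add: sum_subtractf diff_divide_distrib sum_divide_distrib[symmetric])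
      moreover have "\<bar>obs x 0 g1 - E 0 i g1\<bar> \<le> d0 i"
        unfolding E0 by (rule init[OF i x g1]) (simp add: g1_def)
      ultimately have "\<bar>obs x 0 g - E 0 i g\<bar> / C \<le> d0 i"
        using C by (simp add: diff_divide_distrib[symmetric] abs_divide)
      then show ?thesis using C by (simp add: divide_le_eq mult.commute)
    qed
    have slipb: "(LINT z:{0..s}|lborel. \<bar>U k z - drift z (\<theta> k z) x\<bar>) \<le> T * \<delta> k x + S * exp (2 * C * s) / (2 * C)"
      if k: "k \<in> {1..N}" for k
    proof -
      interpret vf: velocity_field T "\<lambda>_. 1" "\<lambda>t u. drift t u x" by (rule field_drift)
      have I1: "set_integrable lborel {0..s} (\<lambda>z. \<bar>U k z - drift z (\<theta> k z) x\<bar>)"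
        using set_integrable_norm[OF set_integral_diff(1)[OF vf.path_integrable[OF path[OF k], of 0 s]]] s by simp
      have I2: "set_integrable lborel {0..s} (\<lambda>z. \<delta> k x + S * exp (2 * C * z))"
        by (intro borel_integrable_atLeastAtMost' continuous_intros)
      have "(LINT z:{0..s}|lborel. \<bar>U k z - drift z (\<theta> k z) x\<bar>) \<le> (LINT z:{0..s}|lborel. \<delta> k x + S * exp (2 * C * z))"
      proof (rule set_integral_mono_AE[OF I1 I2])
        show "AE z\<in>{0..s} in lborel. \<bar>U k z - drift z (\<theta> k z) x\<bar> \<le> \<delta> k x + S * exp (2 * C * z)"
          using GAE
        proof eventually_elim
          case (elim z)
          show ?case
          proof
            assume "z \<in> {0..s}"
            then have "z \<in> G" using elim s by auto
            from Sgap[OF this, of "\<theta> k z" x] UVE[of k z x]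
            show "\<bar>U k z - drift z (\<theta> k z) x\<bar> \<le> \<delta> k x + S * exp (2 * C * z)" unfolding gap_def by linarith
          qed
        qed
      qed
      also have "\<dots> = \<delta> k x * s + S * (exp (2 * C * s) - 1) / (2 * C)"
      proof -
        have "((\<lambda>z. \<delta> k x + S * exp (2 * C * z)) has_integral
          (\<delta> k x * s + S * exp (2 * C * s) / (2 * C)) - (\<delta> k x * 0 + S * exp (2 * C * 0) / (2 * C))) {0..s}"
          using s C by (intro fundamental_theorem_of_calculus)
            (auto intro!: derivative_eq_intros simp: has_real_derivative_iff_has_vector_derivative[symmetric])
        then show ?thesis
          using set_borel_integral_eq_integral(2)[OF I2] by (simp add: integral_unique diff_divide_distrib right_diff_distrib)
      qed
      also have "\<dots> \<le> T * \<delta> k x + S * exp (2 * C * s) / (2 * C)"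
        using s \<delta>0[of k x] S0 C by (intro add_mono divide_right_mono mult_left_mono) (auto simp: mult.commute[of T] intro: mult_left_mono)
      finally show ?thesis .
    qed
    have 2: "\<bar>E s i f - E 0 i g\<bar> \<le> C * (T * H x) + S * exp (2 * C * s) / 2 + e / 2"
    proof -
      have "\<bar>E s i f - E 0 i g\<bar> = \<bar>\<Sum>r = 1..m. f (\<theta> (idx i r) s) - g (\<theta> (idx i r) 0)\<bar> / real m"
        unfolding E_def by (simp add: sum_subtractf diff_divide_distrib[symmetric] abs_divide)
      also have "\<dots> \<le> (\<Sum>r = 1..m. \<bar>f (\<theta> (idx i r) s) - g (\<theta> (idx i r) 0)\<bar>) / real m"
        by (intro divide_right_mono sum_abs) simp
      also have "\<dots> \<le> (\<Sum>r = 1..m. C * (T * \<delta> (idx i r) x + S * exp (2 * C * s) / (2 * C)) + e / 2) / real m"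
      proof (intro divide_right_mono sum_mono)
        fix r assume "r \<in> {1..m}"
        then have k: "idx i r \<in> {1..N}" using idx[OF i] by blast
        have "\<bar>f (\<theta> (idx i r) s) - g (\<theta> (idx i r) 0)\<bar>
          \<le> C * (LINT z:{0..s}|lborel. \<bar>U (idx i r) z - drift z (\<theta> (idx i r) z) x\<bar>) + e / 2"
          using g(3)[OF path[OF k]] by (simp add: C_def)
        moreover have "C * (LINT z:{0..s}|lborel. \<bar>U (idx i r) z - drift z (\<theta> (idx i r) z) x\<bar>)
          \<le> C * (T * \<delta> (idx i r) x + S * exp (2 * C * s) / (2 * C))"
          using C by (intro mult_left_mono slipb[OF k]) simp
        ultimately show "\<bar>f (\<theta> (idx i r) s) - g (\<theta> (idx i r) 0)\<bar>
          \<le> C * (T * \<delta> (idx i r) x + S * exp (2 * C * s) / (2 * C)) + e / 2" by linarith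
      qed simp
      also have "\<dots> = C * (T * ((\<Sum>r = 1..m. \<delta> (idx i r) x) / real m)) + S * exp (2 * C * s) / 2 + e / 2"
        using m C by (simp add: sum.distrib sum_distrib_left[symmetric] add_divide_distrib distrib_left)
      also have "\<dots> \<le> C * (T * H x) + S * exp (2 * C * s) / 2 + e / 2"
        using \<delta>H[OF i x(1)] C T_pos by (intro add_mono mult_left_mono) auto
      finally show ?thesis .
    qed
    show "\<bar>obs x s f - E s i f\<bar> \<le> Q s i x + e"
      unfolding Q_def distrib_left using g(2) 1 2 by linarith
  qed
  have cell_borel [measurable]: "cell n i \<in> sets borel" for i by (simp add: cell_def)
  \<comment> \<open>The bounds \<open>Q s i x\<close> for \<open>x\<close> in cell \<open>i\<close> are glued to one integrable function \<open>QX s\<close> on \<open>{0..1}\<close>.\<close>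
  define dx where "dx = (\<lambda>x. \<Sum>i = 1..n. indicator (cell n i) x * d0 i)"
  have dx: "dx x = d0 i" if "i \<in> {1..n}" "x \<in> cell n i" for i x
  proof -
    have "dx x = (\<Sum>j = 1..n. if j = i then d0 j else 0)"
      unfolding dx_def using that cell_unique[OF n, of x] by (intro sum.cong) (auto simp: indicator_def)
    then show ?thesis using that by simp
  qed
  have dxI: "set_integrable lborel {0..1} dx"
  proof (rule set_integrable_bounded[of _ "\<Sum>i = 1..n. d0 i"])
    show "dx \<in> borel_measurable borel" unfolding dx_def by measurable
    show "\<bar>dx x\<bar> \<le> (\<Sum>i = 1..n. d0 i)" for x
      unfolding dx_def using d0(1) by (intro order_trans[OF sum_abs] sum_mono) (auto simp: indicator_def)
  qed auto
  have dxint: "(LINT x:{0..1}|lborel. dx x) = (\<Sum>i = 1..n. d0 i) / real n"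
  proof -
    have "(LINT x:cell n i|lborel. dx x) = d0 i / real n" if i: "i \<in> {1..n}" for i
    proof -
      have "(LINT x:cell n i|lborel. dx x) = (LINT x:cell n i|lborel. d0 i)"
        using dx[OF i] by (intro set_lebesgue_integral_cong) (auto simp: cell_def)
      then show ?thesis using LINT_cell_const[OF n] by simp
    qed
    then show ?thesis unfolding LINT_cells[OF n dxI] by (simp add: sum_divide_distrib)
  qed
  define QX where "QX = (\<lambda>s x. C * (dx x + T * H x) + S * exp (2 * C * s) / 2)"
  have QXi: "QX s x = Q s i x" if "i \<in> {1..n}" "x \<in> cell n i" for s i x
    using dx[OF that] by (simp add: QX_def Q_def)
  have cI: "set_integrable lborel {0..1::real} (\<lambda>x. c)" for c :: real by (simp add: set_integrable_def)
  have QXI: "set_integrable lborel {0..1} (QX s)" for s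
    unfolding QX_def by (intro set_integral_add set_integrable_mult_right dxI H cI)
  have QXint: "(LINT x:{0..1}|lborel. QX s x) \<le> C * (a + T * h) + S * exp (2 * C * s) / 2" for s
  proof -
    have "(LINT x:{0..1}|lborel. QX s x)
      = (LINT x:{0..1}|lborel. C * (dx x + T * H x)) + (LINT x:{0..1::real}|lborel. S * exp (2 * C * s) / 2)"
      unfolding QX_def by (intro set_integral_add set_integrable_mult_right dxI H cI)
    also have "(LINT x:{0..1}|lborel. C * (dx x + T * H x)) = C * ((LINT x:{0..1}|lborel. dx x) + T * (LINT x:{0..1}|lborel. H x))"
      using dxI H(1) by (simp add: set_integral_add)
    also have "(LINT x:{0..1::real}|lborel. S * exp (2 * C * s) / 2) = S * exp (2 * C * s) / 2"
      by (simp add: set_lebesgue_integral_def)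
    finally show ?thesis
      using H(3) d0(2) C T_pos unfolding dxint by (auto intro!: mult_left_mono add_mono)
  qed
  have QX0: "0 \<le> QX s x" for s x
    unfolding QX_def dx_def using C T_pos S0 H(2) d0(1)
    by (intro add_nonneg_nonneg mult_nonneg_nonneg sum_nonneg divide_nonneg_nonneg) auto
  have QXint0: "0 \<le> (LINT x:{0..1}|lborel. QX s x)" for s by (intro LINT_set_nonneg QX0)
  have gapQ: "gap s u x \<le> C * (a + T * h) + S * exp (2 * C * s) / 2" if s: "s \<in> G" for s u x
  proof -
    have sT: "s \<in> {0..T}" and ms: "mass s < \<infinity>" and Rs: "R s \<le> 1"
      and ys: "AE y in lborel. y \<in> {0..1} \<longrightarrow> good y \<and> (\<forall>u. force s u y = obs y s (\<lambda>v. D (v - u)))"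
      using s by (auto simp: G_def)
    define EE where "EE = (\<lambda>y. \<Sum>i = 1..n. indicator (cell n i) y * E s i (\<lambda>v. D (v - u)))"
    have EEc: "EE y = E s i (\<lambda>v. D (v - u))" if "i \<in> {1..n}" "y \<in> cell n i" for i y
    proof -
      have "EE y = (\<Sum>j = 1..n. if j = i then E s j (\<lambda>v. D (v - u)) else 0)"
        unfolding EE_def using that cell_unique[OF n, of y] by (intro sum.cong) (auto simp: indicator_def)
      then show ?thesis using that by simp
    qed
    have EEm [measurable]: "EE \<in> borel_measurable borel" unfolding EE_def by measurable
    have EEb: "\<bar>w x y * EE y\<bar> \<le> real n" for y
    proof -
      have "\<bar>EE y\<bar> \<le> (\<Sum>i = 1..n. 1)"
        unfolding EE_def using E1[of "\<lambda>v. D (v - u)" 1 s] D_bound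
        by (intro order_trans[OF sum_abs] sum_mono) (auto simp: indicator_def)
      then have "\<bar>w x y\<bar> * \<bar>EE y\<bar> \<le> 1 * real n" using w_spec(2) by (intro mult_mono) auto
      then show ?thesis by (simp add: abs_mult)
    qed
    have EI: "set_integrable lborel {0..1} (\<lambda>y. w x y * EE y)"
      by (intro set_integrable_bounded[OF _ EEb]) auto
    have VEeq: "VE s u x = (LINT y:{0..1}|lborel. w x y * EE y)"
    proof -
      have "(LINT y:cell n i|lborel. w x y * EE y) = (LINT y:cell n i|lborel. w x y) * E s i (\<lambda>v. D (v - u))" if i: "i \<in> {1..n}" for i
      proof -
        have "(LINT y:cell n i|lborel. w x y * EE y) = (LINT y:cell n i|lborel. w x y * E s i (\<lambda>v. D (v - u)))"
          using EEc[OF i] by (intro set_lebesgue_integral_cong) (auto simp: cell_def)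
        then show ?thesis by simp
      qed
      then show ?thesis unfolding LINT_cells[OF n EI] VE_def by simp
    qed
    have FI: "set_integrable lborel {0..1} (\<lambda>y. w x y * force s u y)"
      unfolding set_integrable_def using w_force_integrable[OF ms] by (intro integrable_mult_indicator) auto
    have Dr: "drift s u x = (LINT y:{0..1}|lborel. w x y * force s u y)"
    proof -
      have "force s u y = 0" if "y \<notin> {0..1}" for y using that p_spec(2) by (simp add: force_def)
      then have "indicator {0..1} y *\<^sub>R (w x y * force s u y) = w x y * force s u y" for y by (cases "y \<in> {0..1}") auto
      then have eq: "(\<lambda>y. indicator {0..1} y *\<^sub>R (w x y * force s u y)) = (\<lambda>y. w x y * force s u y)" by (rule ext)
      show ?thesis unfolding set_lebesgue_integral_def eq using Rs ms by (simp add: drift_def V_def)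
    qed
    have "gap s u x = \<bar>LINT y:{0..1}|lborel. w x y * EE y - w x y * force s u y\<bar>"
      unfolding gap_def VEeq Dr using EI FI by (simp add: set_integral_diff)
    also have "\<dots> \<le> (LINT y:{0..1}|lborel. norm (w x y * EE y - w x y * force s u y))"
      using set_integral_norm_bound[OF set_integral_diff(1)[OF EI FI]] by simp
    also have "\<dots> \<le> (LINT y:{0..1}|lborel. QX s y)"
    proof (rule set_integral_mono_AE)
      show "set_integrable lborel {0..1} (\<lambda>y. norm (w x y * EE y - w x y * force s u y))"
        using EI FI by (intro set_integrable_norm set_integral_diff)
      show "AE y\<in>{0..1} in lborel. norm (w x y * EE y - w x y * force s u y) \<le> QX s y"
        using ys AE_cells[OF n]
      proof eventually_elim
        case (elim y)
        show ?case
        proof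
          assume y: "y \<in> {0..1}"
          then obtain i where i: "i \<in> {1..n}" "y \<in> cell n i" using elim by blast
          have "\<bar>obs y s (\<lambda>v. D (v - u)) - E s i (\<lambda>v. D (v - u))\<bar> \<le> Q s i y"
            using elim y by (intro main[OF sT i] D_shift) auto
          then have "\<bar>EE y - force s u y\<bar> \<le> QX s y"
            using elim y EEc[OF i] QXi[OF i] by (simp add: abs_minus_commute)
          then have "\<bar>w x y\<bar> * \<bar>EE y - force s u y\<bar> \<le> 1 * QX s y" using w_spec(2) by (intro mult_mono) auto
          then show "norm (w x y * EE y - w x y * force s u y) \<le> QX s y"
            by (simp add: right_diff_distrib[symmetric] abs_mult)
        qed
      qed
    qed (rule QXI)
    finally show ?thesis using QXint[of s] by linarith
  qed
  define A where "A = C * (a + T * h)"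
  have A0: "0 \<le> A"
  proof -
    have "0 \<le> (\<Sum>i = 1..n. d0 i) / real n" using d0(1) by (intro divide_nonneg_nonneg sum_nonneg) auto
    moreover have "0 \<le> (LINT x:{0..1}|lborel. H x)" by (intro LINT_set_nonneg H)
    ultimately show ?thesis using d0(2) H(3) C T_pos by (simp add: A_def)
  qed
  have "S \<le> A + S / 2"
    unfolding S_def
  proof (rule cSup_least)
    show "Z \<noteq> {}" by (simp add: Z_def)
    fix z assume "z \<in> Z"
    then consider "z = 0" | s u x where "s \<in> G" "z = exp (- 2 * C * s) * gap s u x" by (auto simp: Z_def)
    then show "z \<le> A + Sup Z / 2"
    proof cases
      case 1 then show ?thesis using A0 S0 by (simp add: S_def)
    next
      case 2
      have "exp (- 2 * C * s) * gap s u x \<le> exp (- 2 * C * s) * (A + S * exp (2 * C * s) / 2)"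
        unfolding A_def by (intro mult_left_mono gapQ 2) simp
      also have "\<dots> = exp (- 2 * C * s) * A + S * (exp (- 2 * C * s) * exp (2 * C * s)) / 2"
        by (simp add: algebra_simps)
      also have "exp (- 2 * C * s) * exp (2 * C * s) = 1" by (simp add: exp_add[symmetric])
      also have "exp (- 2 * C * s) * A \<le> 1 * A"
        using 2(1) C A0 by (intro mult_right_mono) (auto simp: G_def)
      finally show ?thesis using 2 by (simp add: S_def)
    qed
  qed
  then have S2: "S \<le> 2 * A" by simp
  have "fam_dist (emp_family n m (\<lambda>k. \<theta> k t)) (\<lambda>x. circ_density (\<lambda>v. \<rho> t v x)) \<le> (LINT x:{0..1}|lborel. QX t x)"
    unfolding fam_dist_def
  proof (rule LINT_le_if_AE_le[OF _ QXI QXint0])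
    show "AE x in lborel. x \<in> {0..1} \<longrightarrow> meas_dist (emp_family n m (\<lambda>k. \<theta> k t) x) (circ_density (\<lambda>v. \<rho> t v x)) \<le> QX t x"
      using good_AE AE_cells[OF n]
    proof eventually_elim
      case (elim x)
      show ?case
      proof
        assume "x \<in> {0..1}"
        then obtain i where x: "good x" and i: "i \<in> {1..n}" "x \<in> cell n i" using elim by blast
        note cd = circ_density_prob[OF goodD(2)[OF x t] good_density[OF x t]]
        show "meas_dist (emp_family n m (\<lambda>k. \<theta> k t) x) (circ_density (\<lambda>v. \<rho> t v x)) \<le> QX t x"
          unfolding emp_family_cell[OF n i]
        proof (rule meas_dist_le[OF empirical_prob(1,2)[OF m] cd(1,2)])
          fix f assume f: "periodic_lipschitz 1 f" "f 0 = 0"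
          have fm: "f \<in> borel_measurable borel"
            using f periodic_lipschitz_circ_continuous circ_continuous_measurable by blast
          have "(LINT u|circ_density (\<lambda>v. \<rho> t v x). f u) = obs x t f" unfolding obs_def by (rule cd(3)[OF fm])
          moreover have "(LINT u|empirical m (\<lambda>j. \<theta> ((i - 1) * m + j) t). f u) = E t i f"
            unfolding E_def idx_def by (rule empirical_prob(3)[OF m f(1)])
          ultimately show "\<bar>(LINT u|empirical m (\<lambda>j. \<theta> ((i - 1) * m + j) t). f u) - (LINT u|circ_density (\<lambda>v. \<rho> t v x). f u)\<bar> \<le> QX t x"
            using main[OF t i x f(1)] QXi[OF i] by (simp add: abs_minus_commute)
        qed
      qed
    qed
  qed simp
  also have "\<dots> \<le> A + S * exp (2 * C * t) / 2" using QXint[of t] by (simp add: A_def)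
  also have "\<dots> \<le> A * exp (2 * C * T) + (2 * A) * exp (2 * C * T) / 2"
  proof (intro add_mono divide_right_mono mult_mono S2)
    show "A \<le> A * exp (2 * C * T)" using A0 C T_pos by (simp add: mult_le_cancel_left1)
  qed (use t C A0 in auto)
  also have "\<dots> = 2 * exp T * exp (2 * exp T * T) * (a + T * h)" by (simp add: A_def C_def)
  finally show ?thesis .
qed

end

section \<open>Almost sure convergence\<close>

theorem theorem3p9:
  fixes W :: "real \<Rightarrow> real \<Rightarrow> real"
    and D :: "real \<Rightarrow> real"
    and \<rho>0 :: "real \<Rightarrow> real \<Rightarrow> real"
    and \<rho> :: "real \<Rightarrow> real \<Rightarrow> real \<Rightarrow> real"
    and M :: "'w measure"
    and u0 :: "nat \<Rightarrow> nat \<Rightarrow> 'w \<Rightarrow> real"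
    and u :: "nat \<Rightarrow> 'w \<Rightarrow> nat \<Rightarrow> real \<Rightarrow> real"
    and T \<epsilon> :: real
  assumes W_sym: "\<forall>x\<in>{0..1}. \<forall>y\<in>{0..1}. W x y = W y x"
    and W_meas: "(\<lambda>(x, y). W x y) \<in> borel_measurable (lebesgue_on ({0..1} \<times> {0..1}))"
    and W_bound: "\<forall>x\<in>{0..1}. \<forall>y\<in>{0..1}. \<bar>W x y\<bar> \<le> 1"
    and W_cont: "\<forall>x\<in>{0..1}. ((\<lambda>\<delta>. LINT y|lebesgue_on {0..1}. \<bar>W (x + \<delta>) y - W x y\<bar>) \<longlongrightarrow> 0)
                   (at 0 within {\<delta>. x + \<delta> \<in> {0..1}})"
    and D_periodic: "\<forall>v. D (v + 2 * pi) = D v"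
    and D_bound: "\<forall>v. \<bar>D v\<bar> \<le> 1"
    and D_lipschitz: "\<forall>v v'. \<bar>D v - D v'\<bar> \<le> \<bar>v - v'\<bar>"
    and \<rho>0_L1: "integrable (lebesgue_on (circ \<times> {0..1})) (\<lambda>(v, x). \<rho>0 v x)"
    and \<rho>0_density: "\<forall>x\<in>{0..1}. integrable (lebesgue_on circ) (\<lambda>v. \<rho>0 v x) \<and>
                        (AE v in lebesgue_on circ. 0 \<le> \<rho>0 v x) \<and>
                        (LINT v|lebesgue_on circ. \<rho>0 v x) = 1"
    and \<rho>0_riemann: "\<forall>f. circ_continuous f \<longrightarrow>
                        riemann_integrable_on (\<lambda>x. LINT v|lebesgue_on circ. f v * \<rho>0 v x) 0 1"
    and prob: "prob_space M"
    and u0_indep: "\<forall>N\<ge>1. prob_space.indep_vars M (\<lambda>_. circle_borel) (u0 N) {1..N}"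
    and u0_law: "\<forall>N\<ge>1. \<forall>j\<in>{1..N}.
                   distr M circle_borel (u0 N j) = circ_density (\<lambda>v. \<rho>0 v (real j / real N))"
    and T_pos: "T > 0"
    and u_solution: "\<forall>N\<ge>1. \<forall>\<omega>\<in>space M. discrete_solution T W D N (\<lambda>i. u0 N i \<omega>) (u N \<omega>)"
    and \<rho>_solution: "weak_solution T W D \<rho>0 \<rho>"
    and \<epsilon>_pos: "\<epsilon> > 0"
  shows "AE \<omega> in M. \<exists>n1\<ge>1. \<exists>m1\<ge>1. \<forall>n\<ge>n1. \<forall>m\<ge>m1.
           (SUP t\<in>{0..T}. fam_dist (emp_family n m (\<lambda>k. u (n * m) \<omega> k t))
                                     (\<lambda>x. circ_density (\<lambda>v. \<rho> t v x))) < \<epsilon>"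
proof -
  interpret mean_field W D \<rho>0 \<rho> T
    by unfold_locales (use W_meas W_bound D_periodic D_bound D_lipschitz \<rho>0_density T_pos \<rho>_solution in blast)+
  interpret prob_space M by (rule prob)
  define K where "K = 2 * exp T * exp (2 * exp T * T)"
  have K: "K > 0" by (simp add: K_def)
  \<comment> \<open>The errors of the initial data and of the kernel will be at most \<open>2 * \<tau>\<close> each.\<close>
  define \<tau> where "\<tau> = \<epsilon> / (4 * K * (1 + T))"
  have \<tau>: "\<tau> > 0" using \<epsilon>_pos K T_pos by (simp add: \<tau>_def)
  have K\<tau>: "K * (2 * \<tau> + T * (2 * \<tau>)) = \<epsilon> / 2"
  proof -
    have "4 * K * (1 + T) \<noteq> 0" using K T_pos by simp
    then have "(4 * K * (1 + T)) * \<tau> = \<epsilon>" unfolding \<tau>_def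
      by (metis nonzero_mult_div_cancel_left times_divide_eq_right)
    moreover have "K * (2 * \<tau> + T * (2 * \<tau>)) = (4 * K * (1 + T)) * \<tau> / 2" by (simp add: algebra_simps)
    ultimately show ?thesis by simp
  qed
  have \<tau>2: "\<tau> / 2 > 0" using \<tau> by simp
  obtain F where F: "finite F" "\<And>f. f \<in> F \<Longrightarrow> periodic_lipschitz 1 f" "\<And>f. f \<in> F \<Longrightarrow> f 0 = 0"
    and net: "\<And>g. periodic_lipschitz 1 g \<Longrightarrow> g 0 = 0 \<Longrightarrow> \<exists>f\<in>F. \<forall>u. \<bar>g u - f u\<bar> \<le> \<tau> / 2"
    using finite_net_periodic_lipschitz[OF \<tau>2] by blast
  \<comment> \<open>Each member of the net contributes \<open>\<eta>\<close> by the oscillation of its mean and \<open>\<eta>\<close> by its fluctuation.\<close>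
  define \<eta> where "\<eta> = \<tau> / (2 * (real (card F) + 1))"
  have \<eta>: "\<eta> > 0" using \<tau> by (simp add: \<eta>_def)
  have F\<eta>: "real (card F) * (\<eta> + \<eta>) \<le> \<tau>"
  proof -
    have "real (card F) * (\<eta> + \<eta>) \<le> (real (card F) + 1) * (\<eta> + \<eta>)" using \<eta> by (intro mult_right_mono) auto
    also have "\<dots> = (2 * (real (card F) + 1)) * \<eta>" by (simp add: algebra_simps)
    also have "\<dots> = \<tau>"
    proof -
      have "0 < 2 * (real (card F) + 1)" by (intro mult_pos_pos add_nonneg_pos) simp_all
      then have "2 * (real (card F) + 1) \<noteq> 0" by simp
      then show ?thesis unfolding \<eta>_def by (metis nonzero_mult_div_cancel_left times_divide_eq_right)
    qed
    finally show ?thesis .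
  qed
  define H where "H = (\<lambda>f x. LINT v|lebesgue_on circ. f v * \<rho>0 v x)"
  have Fcc: "circ_continuous f" if "f \<in> F" for f
    using F(2)[OF that] by (rule periodic_lipschitz_circ_continuous)
  have Fm: "f \<in> borel_measurable borel" if "f \<in> F" for f
    using Fcc[OF that] by (rule circ_continuous_measurable)
  have Fmc: "f \<in> borel_measurable circle_borel" if "f \<in> F" for f
    using Fm[OF that] unfolding circle_borel_def by (rule measurable_restrict_space1)
  have Fb: "\<bar>f u\<bar> \<le> 2 * pi" if "f \<in> F" for f u using periodic_lipschitz_bound[OF F(2,3)[OF that]] .
  have Hb: "\<bar>H f x\<bar> \<le> 2 * pi" if f: "f \<in> F" and x: "x \<in> {0..1}" for f x
  proof -
    have \<rho>: "integrable (lebesgue_on circ) (\<lambda>v. \<rho>0 v x)" "AE v in lebesgue_on circ. 0 \<le> \<rho>0 v x"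
      "(LINT v|lebesgue_on circ. \<rho>0 v x) = 1" using \<rho>0_density x by auto
    have "norm (H f x) \<le> (LINT v|lebesgue_on circ. 2 * pi * \<rho>0 v x)"
      unfolding H_def
    proof (rule integral_norm_bound_integral_AE)
      show "integrable (lebesgue_on circ) (\<lambda>v. f v * \<rho>0 v x)"
        using integrable_mult_circ_continuous[OF \<rho>(1) Fcc[OF f]] by (simp add: mult.commute)
      show "AE v in lebesgue_on circ. norm (f v * \<rho>0 v x) \<le> 2 * pi * \<rho>0 v x"
        using \<rho>(2) by eventually_elim (simp add: abs_mult Fb[OF f] mult_right_mono)
    qed (use \<rho>(1) in simp)
    then show ?thesis using \<rho>(3) by simp
  qed
  have "eventually (\<lambda>n. \<forall>f\<in>F. \<exists>w. (\<forall>i\<in>{1..n}. \<forall>x\<in>{(real i - 1) / real n..real i / real n}.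
      \<forall>y\<in>{(real i - 1) / real n..real i / real n}. \<bar>H f x - H f y\<bar> \<le> w i) \<and> (\<Sum>i = 1..n. w i) / real n \<le> \<eta>) sequentially"
  proof (intro eventually_ball_finite[OF F(1)] ballI)
    fix f assume f: "f \<in> F"
    have "riemann_integrable_on (H f) 0 1" unfolding H_def using \<rho>0_riemann Fcc[OF f] by blast
    from riemann_integrable_oscillation[OF this Hb[OF f] \<eta>]
    show "eventually (\<lambda>n. \<exists>w. (\<forall>i\<in>{1..n}. \<forall>x\<in>{(real i - 1) / real n..real i / real n}.
      \<forall>y\<in>{(real i - 1) / real n..real i / real n}. \<bar>H f x - H f y\<bar> \<le> w i) \<and> (\<Sum>i = 1..n. w i) / real n \<le> \<eta>) sequentially"
      unfolding eventually_sequentially by blast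
  qed
  then obtain n2 where n2: "\<And>n f. n \<ge> n2 \<Longrightarrow> f \<in> F \<Longrightarrow> \<exists>w. (\<forall>i\<in>{1..n}. \<forall>x\<in>{(real i - 1) / real n..real i / real n}.
      \<forall>y\<in>{(real i - 1) / real n..real i / real n}. \<bar>H f x - H f y\<bar> \<le> w i) \<and> (\<Sum>i = 1..n. w i) / real n \<le> \<eta>"
    unfolding eventually_sequentially by blast
  obtain n3 where n3: "n3 \<ge> 1" "\<And>n m. n \<ge> n3 \<Longrightarrow> m \<ge> 1 \<Longrightarrow> \<exists>H. set_integrable lborel {0..1} H \<and> (\<forall>x. 0 \<le> H x) \<and>
    (LINT x:{0..1}|lborel. H x) \<le> 2 * \<tau> \<and>
    (\<forall>i\<in>{1..n}. \<forall>x\<in>cell n i. (\<Sum>r = 1..m. \<Sum>i' = 1..n. \<Sum>r' = 1..m.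
       \<bar>(real (n * m))\<^sup>2 * (LINT x:cell (n * m) ((i - 1) * m + r)|lborel. LINT y:cell (n * m) ((i' - 1) * m + r')|lborel. w x y)
         - real n * (LINT y:cell n i'|lborel. w x y)\<bar>) / (real m * real (n * m)) \<le> H x)"
    using kernel_discretization_error[OF w_spec(1,2) \<tau>] by blast
  define bad where "bad = (\<lambda>f n m. {\<omega> \<in> space M. \<eta> * real (n * m) \<le>
     (\<Sum>i = 1..n. \<bar>\<Sum>r = 1..m. f (u0 (n * m) ((i - 1) * m + r) \<omega>)
        - expectation (\<lambda>\<omega>. f (u0 (n * m) ((i - 1) * m + r) \<omega>))\<bar>)})"
  have "AE \<omega> in M. \<forall>f\<in>F. eventually (\<lambda>m. \<forall>n\<ge>1. \<omega> \<notin> bad f n m) sequentially"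
  proof (intro AE_finite_allI[OF F(1)])
    fix f assume f: "f \<in> F"
    have "AE \<omega> in M. \<exists>m1\<ge>1. \<forall>n\<ge>1. \<forall>m\<ge>m1. \<omega> \<notin> bad f n m"
    proof (rule borel_cantelli_rectangles)
      fix n m :: nat assume nm: "n \<ge> 1" "m \<ge> 1"
      then have ind: "indep_vars (\<lambda>_. circle_borel) (u0 (n * m)) {1..n * m}" using u0_indep by simp
      have pos: "2 * pi > 0" "0 \<le> \<eta>" using \<eta> by auto
      note dev = block_deviation_prob[OF ind Fmc[OF f] Fb[OF f] pos(1) nm pos(2)]
      show "bad f n m \<in> events" unfolding bad_def by (rule dev(1))
      show "prob (bad f n m) \<le> 2 ^ n * exp (- (\<eta>\<^sup>2 / (2 * (2 * pi)\<^sup>2)) * real (n * m))"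
        unfolding bad_def by (rule dev(2))
    qed (use \<eta> in simp)
    then show "AE \<omega> in M. eventually (\<lambda>m. \<forall>n\<ge>1. \<omega> \<notin> bad f n m) sequentially"
      by eventually_elim (auto simp: eventually_sequentially)
  qed
  then show ?thesis using AE_space
  proof eventually_elim
    case (elim \<omega>)
    then have "eventually (\<lambda>m. \<forall>f\<in>F. \<forall>n\<ge>1. \<omega> \<notin> bad f n m) sequentially"
      using F(1) by (intro eventually_ball_finite) auto
    then obtain m0 where m0: "\<And>m f n. m \<ge> m0 \<Longrightarrow> f \<in> F \<Longrightarrow> n \<ge> 1 \<Longrightarrow> \<omega> \<notin> bad f n m"
      unfolding eventually_sequentially by blast
    have "(SUP t\<in>{0..T}. fam_dist (emp_family n m (\<lambda>k. u (n * m) \<omega> k t))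
                                     (\<lambda>x. circ_density (\<lambda>v. \<rho> t v x))) < \<epsilon>"
      if n: "n \<ge> max n2 n3" and m: "m \<ge> max 1 m0" for n m
    proof -
      have n1: "n \<ge> 1" and m1: "m \<ge> 1" using n m n3(1) by auto
      define N where "N = n * m"
      have N1: "N \<ge> 1" using n1 m1 by (simp add: N_def)
      have idx: "(i - 1) * m + r \<in> {1..N}" if "i \<in> {1..n}" "r \<in> {1..m}" for i r
      proof -
        have "(i - 1) * m + r \<le> (i - 1) * m + m" using that by simp
        also have "\<dots> = i * m" using that by (cases i) auto
        also have "\<dots> \<le> n * m" using that by simp
        finally show ?thesis using that by (auto simp: N_def)
      qed
      have mean: "expectation (\<lambda>\<omega>. f (u0 N k \<omega>)) = H f (real k / real N)" if f: "f \<in> F" and k: "k \<in> {1..N}" for f k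
      proof -
        have kN: "real k / real N \<in> {0..1}" using k by auto
        have rv: "u0 N k \<in> M \<rightarrow>\<^sub>M circle_borel" using u0_indep N1 k unfolding indep_vars_def by blast
        have "expectation (\<lambda>\<omega>. f (u0 N k \<omega>)) = (LINT x|distr M circle_borel (u0 N k). f x)"
          by (rule integral_distr[OF rv Fmc[OF f], symmetric])
        also have "distr M circle_borel (u0 N k) = circ_density (\<lambda>v. \<rho>0 v (real k / real N))"
          using u0_law N1 k by blast
        also have "(LINT x|circ_density (\<lambda>v. \<rho>0 v (real k / real N)). f x)
          = (LINT v|lebesgue_on circ. \<rho>0 v (real k / real N) * f v)"
          using \<rho>0_density kN by (intro circ_density_prob(3) Fm[OF f]) auto
        finally show ?thesis by (simp add: H_def mult.commute)
      qed
      obtain w' where w': "\<And>f i x y. f \<in> F \<Longrightarrow> i \<in> {1..n} \<Longrightarrow> x \<in> {(real i - 1) / real n..real i / real n} \<Longrightarrow>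
          y \<in> {(real i - 1) / real n..real i / real n} \<Longrightarrow> \<bar>H f x - H f y\<bar> \<le> w' f i"
        "\<And>f. f \<in> F \<Longrightarrow> (\<Sum>i = 1..n. w' f i) / real n \<le> \<eta>"
      proof -
        have "\<forall>f\<in>F. \<exists>w. (\<forall>i\<in>{1..n}. \<forall>x\<in>{(real i - 1) / real n..real i / real n}.
          \<forall>y\<in>{(real i - 1) / real n..real i / real n}. \<bar>H f x - H f y\<bar> \<le> w i) \<and> (\<Sum>i = 1..n. w i) / real n \<le> \<eta>"
          using n2[of n] n by simp
        from bchoice[OF this] show ?thesis using that by blast
      qed
      have w'0: "0 \<le> w' f i" if "f \<in> F" "i \<in> {1..n}" for f i
      proof -
        have "real i / real n \<in> {(real i - 1) / real n..real i / real n}" using n1 by (simp add: divide_right_mono)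
        from w'(1)[OF that this this] show ?thesis by simp
      qed
      define dev where "dev = (\<lambda>(f :: real \<Rightarrow> real) i. \<bar>\<Sum>r = 1..m. f (u0 N ((i - 1) * m + r) \<omega>)
        - expectation (\<lambda>\<omega>. f (u0 N ((i - 1) * m + r) \<omega>))\<bar>)"
      have dev: "(\<Sum>i = 1..n. dev f i) / (real n * real m) \<le> \<eta>" if f: "f \<in> F" for f
      proof -
        have "\<omega> \<notin> bad f n m" using m0 m f n1 by simp
        then have "(\<Sum>i = 1..n. dev f i) < \<eta> * (real n * real m)"
          using elim unfolding bad_def dev_def N_def by simp
        then show ?thesis using n1 m1 by (simp add: divide_le_eq)
      qed
      define d0 where "d0 = (\<lambda>i. \<tau> + (\<Sum>f\<in>F. \<bar>w' f i\<bar> + dev f i / real m))"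
      have d0_nonneg: "0 \<le> d0 i" for i
        unfolding d0_def dev_def using \<tau> by (intro add_nonneg_nonneg sum_nonneg) auto
      have d0_avg: "(\<Sum>i = 1..n. d0 i) / real n \<le> 2 * \<tau>"
      proof -
        have "(\<Sum>i = 1..n. d0 i) / real n
          = \<tau> + (\<Sum>f\<in>F. (\<Sum>i = 1..n. \<bar>w' f i\<bar>) / real n + (\<Sum>i = 1..n. dev f i) / (real n * real m))"
        proof -
          have "(\<Sum>i = 1..n. d0 i) = real n * \<tau> + (\<Sum>f\<in>F. (\<Sum>i = 1..n. \<bar>w' f i\<bar>) + (\<Sum>i = 1..n. dev f i) / real m)"
            unfolding d0_def by (simp add: sum.distrib sum.swap[of _ F] sum_divide_distrib)
          then show ?thesis
            using n1 by (simp add: add_divide_distrib sum_divide_distrib[of _ F] mult.commute)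
        qed
        also have "\<dots> \<le> \<tau> + (\<Sum>f\<in>F. \<eta> + \<eta>)"
        proof (intro add_left_mono sum_mono add_mono dev)
          fix f assume f: "f \<in> F"
          have "(\<Sum>i = 1..n. \<bar>w' f i\<bar>) = (\<Sum>i = 1..n. w' f i)" using w'0[OF f] by (intro sum.cong) auto
          then show "(\<Sum>i = 1..n. \<bar>w' f i\<bar>) / real n \<le> \<eta>" using w'(2)[OF f] by simp
        qed
        also have "\<dots> \<le> 2 * \<tau>" using F\<eta> by simp
        finally show ?thesis .
      qed
      have init: "\<bar>obs x 0 g - (\<Sum>r = 1..m. g (u0 (n * m) ((i - 1) * m + r) \<omega>)) / real m\<bar> \<le> d0 i"
        if i: "i \<in> {1..n}" and x: "x \<in> cell n i" "good x" and g: "periodic_lipschitz 1 g" "g 0 = 0" for i x g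
      proof -
        obtain f where f: "f \<in> F" "\<And>u. \<bar>g u - f u\<bar> \<le> \<tau> / 2" using net[OF g] by blast
        define E where "E = (\<lambda>g::real \<Rightarrow> real. (\<Sum>r = 1..m. g (u0 N ((i - 1) * m + r) \<omega>)) / real m)"
        have T0: "0 \<in> {0..T}" using T_pos by simp
        have cc: "circ_continuous (\<lambda>u. g u - f u)"
          by (intro circ_continuous_diff Fcc f periodic_lipschitz_circ_continuous[OF g(1)])
        have "obs x 0 g - obs x 0 f = (LINT u|lebesgue_on circ. \<rho> 0 u x * (g u - f u))"
          unfolding obs_def using integrable_mult_circ_continuous[OF goodD(2)[OF x(2) T0]] Fcc[OF f(1)]
            periodic_lipschitz_circ_continuous[OF g(1)] by (simp add: right_diff_distrib)
        then have 1: "\<bar>obs x 0 g - obs x 0 f\<bar> \<le> \<tau> / 2" using good_bound[OF x(2) T0 cc f(2)] by simp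
        have 2: "\<bar>E f - E g\<bar> \<le> \<tau> / 2"
        proof -
          have "\<bar>\<Sum>r = 1..m. f (u0 N ((i - 1) * m + r) \<omega>) - g (u0 N ((i - 1) * m + r) \<omega>)\<bar> \<le> (\<Sum>r = 1..m. \<tau> / 2)"
            using f(2) by (intro order_trans[OF sum_abs] sum_mono) (simp add: abs_minus_commute)
          then have "\<bar>\<Sum>r = 1..m. f (u0 N ((i - 1) * m + r) \<omega>) - g (u0 N ((i - 1) * m + r) \<omega>)\<bar> / real m \<le> (real m * (\<tau> / 2)) / real m"
            by (intro divide_right_mono) auto
          then show ?thesis using m1 unfolding E_def by (simp add: sum_subtractf diff_divide_distrib[symmetric] abs_divide)
        qed
        have 3: "\<bar>obs x 0 f - E f\<bar> \<le> \<bar>w' f i\<bar> + dev f i / real m"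
        proof -
          have o: "obs x 0 f = H f x" using good_initial[OF x(2) F(2)[OF f(1)]] by (simp add: H_def)
          have xc: "x \<in> {(real i - 1) / real n..real i / real n}" using x(1) by (auto simp: cell_def)
          have hk: "\<bar>H f x - H f (real ((i - 1) * m + r) / real N)\<bar> \<le> w' f i" if r: "r \<in> {1..m}" for r
          proof (rule w'(1)[OF f(1) i xc])
            have i1: "1 \<le> i" using i by simp
            have b: "real ((i - 1) * m + m) / real N = real i / real n" "real ((i - 1) * m) / real N = real (i - 1) / real n"
              unfolding N_def by (rule subcell_bounds[OF m1 i1])+
            have c: "real (i - 1) = real i - 1" using i1 by (simp add: of_nat_diff)
            have "real ((i - 1) * m) / real N \<le> real ((i - 1) * m + r) / real N"
              "real ((i - 1) * m + r) / real N \<le> real ((i - 1) * m + m) / real N"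
              using r by (auto intro!: divide_right_mono)
            then show "real ((i - 1) * m + r) / real N \<in> {(real i - 1) / real n..real i / real n}"
              unfolding b c atLeastAtMost_iff by blast
          qed
          have "obs x 0 f - E f = (\<Sum>r = 1..m. H f x - H f (real ((i - 1) * m + r) / real N)) / real m
            - (\<Sum>r = 1..m. f (u0 N ((i - 1) * m + r) \<omega>) - expectation (\<lambda>\<omega>. f (u0 N ((i - 1) * m + r) \<omega>))) / real m"
            unfolding o E_def using m1 mean[OF f(1) idx[OF i]]
            by (simp add: sum_subtractf diff_divide_distrib)
          moreover have "\<bar>(\<Sum>r = 1..m. H f x - H f (real ((i - 1) * m + r) / real N)) / real m\<bar> \<le> w' f i"
          proof -
            have "\<bar>\<Sum>r = 1..m. H f x - H f (real ((i - 1) * m + r) / real N)\<bar> \<le> (\<Sum>r = 1..m. w' f i)"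
              using hk by (intro order_trans[OF sum_abs] sum_mono) auto
            then have "\<bar>\<Sum>r = 1..m. H f x - H f (real ((i - 1) * m + r) / real N)\<bar> / real m \<le> (real m * w' f i) / real m"
              by (intro divide_right_mono) auto
            then show ?thesis using m1 by (simp add: abs_divide)
          qed
          moreover have "\<bar>(\<Sum>r = 1..m. f (u0 N ((i - 1) * m + r) \<omega>) - expectation (\<lambda>\<omega>. f (u0 N ((i - 1) * m + r) \<omega>))) / real m\<bar> = dev f i / real m"
            by (simp add: dev_def abs_divide)
          ultimately show ?thesis by linarith
        qed
        have "\<bar>w' f i\<bar> + dev f i / real m \<le> (\<Sum>f\<in>F. \<bar>w' f i\<bar> + dev f i / real m)"
          using f(1) F(1) by (intro member_le_sum) (auto simp: dev_def)
        then have "\<bar>obs x 0 g - E g\<bar> \<le> d0 i" unfolding d0_def using 1 2 3 by linarith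
        then show ?thesis by (simp add: E_def N_def)
      qed
      obtain Hk where Hk: "set_integrable lborel {0..1} Hk" "\<And>x. 0 \<le> Hk x" "(LINT x:{0..1}|lborel. Hk x) \<le> 2 * \<tau>"
        "\<And>i x. i \<in> {1..n} \<Longrightarrow> x \<in> cell n i \<Longrightarrow> (\<Sum>r = 1..m. \<Sum>i' = 1..n. \<Sum>r' = 1..m.
         \<bar>(real (n * m))\<^sup>2 * (LINT x:cell (n * m) ((i - 1) * m + r)|lborel. LINT y:cell (n * m) ((i' - 1) * m + r')|lborel. w x y)
           - real n * (LINT y:cell n i'|lborel. w x y)\<bar>) / (real m * real (n * m)) \<le> Hk x"
        using n3(2)[of n m] n m1 by auto
      have sol: "discrete_solution T W D (n * m) (\<lambda>i. u0 (n * m) i \<omega>) (u (n * m) \<omega>)"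
        using u_solution elim N1 unfolding N_def by blast
      have "(SUP t\<in>{0..T}. fam_dist (emp_family n m (\<lambda>k. u (n * m) \<omega> k t)) (\<lambda>x. circ_density (\<lambda>v. \<rho> t v x))) \<le> \<epsilon> / 2"
      proof (rule cSUP_least)
        show "{0..T} \<noteq> {}" using T_pos by simp
        fix t assume t: "t \<in> {0..T}"
        have "fam_dist (emp_family n m (\<lambda>k. u (n * m) \<omega> k t)) (\<lambda>x. circ_density (\<lambda>v. \<rho> t v x))
          \<le> 2 * exp T * exp (2 * exp T * T) * (2 * \<tau> + T * (2 * \<tau>))"
          by (rule error_propagation[OF n1 m1 sol init d0_nonneg d0_avg Hk t])
        also have "\<dots> = \<epsilon> / 2" using K\<tau> unfolding K_def .
        finally show "fam_dist (emp_family n m (\<lambda>k. u (n * m) \<omega> k t)) (\<lambda>x. circ_density (\<lambda>v. \<rho> t v x)) \<le> \<epsilon> / 2" .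
      qed
      then show ?thesis using \<epsilon>_pos by linarith
    qed
    moreover have "max n2 n3 \<ge> 1" "max 1 m0 \<ge> 1" using n3(1) by auto
    ultimately show ?case by blast
  qed
qed

end
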